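(* Let $N\ge 2$ be an integer. For $r\in\frac N2+\mathbb{Z}$, the $r$-th Fourier coefficient $\chi(N,r;\tau)$ of $\phi_N(z;\tau)=\vartheta(z;\tau)^{-N}$, in the range $|q|<|\zeta|<1$, is given by $$\chi(N,r;\tau)=\frac{i^N\,\mathrm{sign}\left(r-\frac N2\right)q^{-\frac{r^2}{2N}}}{\eta(\tau)^{N(N+1)}d_{N-1}}\sum_{t\in T_{r-\frac N2}}\ \prod_{\alpha\in\Delta_0^+}(t|\alpha)\,q^{\frac{t^2}{2(N-1)}}=\frac{i^N\,\mathrm{sign}\left(r-\frac N2\right)q^{-\frac{r^2}{2N}}}{\eta(\tau)^{N(N+1)}d_{N-1}}\ \partial P_{r-\frac N2}(\tau)\Big|_{\{e^t=1\,\mid\, t\in\frac1N A_{N-1}\}}.$$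
   Context: Notation: $\tau\in\mathbb{H}$, $z\in\mathbb{C}$, $q=e^{2\pi i\tau}$, $\zeta=e^{2\pi iz}$, $q^a=e^{2\pi i a\tau}$, $\zeta^a=e^{2\pi i az}$, $(a)_\infty=\prod_{j\ge0}(1-aq^j)$, $\eta(\tau)=q^{1/24}(q)_\infty$, and $\vartheta(z;\tau)=-i\zeta^{-1/2}q^{1/8}(q)_\infty(\zeta)_\infty(\zeta^{-1}q)_\infty$. The coefficients are defined by $\phi_N(z;\tau)=\sum_{r\in\frac N2+\mathbb{Z}}\chi(N,r;\tau)\zeta^r$; they depend on the range fixed for $z$. $A_{N-1}=\mathbb{Z}\alpha_1\oplus\dots\oplus\mathbb{Z}\alpha_{N-1}$ is the root lattice of $\mathfrak{sl}(N)$ with simple roots $\alpha_n$ (linear functionals on the Cartan subalgebra $\mathfrak h\cong\mathbb{C}^{N-1}$ of $\mathfrak{sl}(N)$) and bilinear form $(\,\cdot\,|\,\cdot\,)$ whose Gram matrix is the Cartan matrix of $\mathfrak{sl}(N)$ ($(\alpha_n|\alpha_n)=2$, $(\alpha_n|\alpha_{n\pm1})=-1$, all others $0$), extended bilinearly; $t^2=(t|t)$. $\Delta_0^+=\{\alpha_i+\alpha_{i+1}+\dots+\alpha_j\mid 1\le i\le j\le N-1\}$ is the set of positive roots of $\mathfrak{sl}(N)$. For $s\in\mathbb{Z}$, $$T_s=\Big\{\sum_{n=1}^{N-1}a_n\alpha_n\ \Big|\ a_n=\tfrac{(N-n)n}{2}-\tfrac{sn}{N}+(N-1)m_n,\ m_n\in\mathbb{Z},\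 \left(m_{N-1}-\tfrac12\right)\left(s-\tfrac12\right)\ge 0\Big\}\subset\tfrac1N A_{N-1},$$ and $P_s(\tau)=\sum_{t\in T_s}e^tq^{\frac{t^2}{2(N-1)}}$ is its partial theta function, where $e^t$ is the function $u\mapsto e^{t(u)}$ on $\mathfrak h$. The differential operator $\partial=\prod_{\alpha\in\Delta_0^+}\partial_\alpha$ is given by $\partial_\alpha e^\lambda=(\lambda|\alpha)e^\lambda$, and the subscript $e^t=1$ means replacing every $e^t$ with $t\in\frac1NA_{N-1}$ by $1$. Finally $d_N=\prod_{j=1}^N j!$, and $\mathrm{sign}(x)=1$ if $x\ge0$, $-1$ otherwise.
   Formalization: In the definition of T_s the condition (m_{N-1} − 1/2)(s − 1/2) ≥ 0 is replaced by (m_{N-1} + 1/2)(s + 1/2) ≥ 0; as printed the formula fails, e.g. for N = 2, r = 3 it gives leading term −q^{-9/4} instead of −3q^{-1/4}. *)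

theory Defs
  imports "HOL-Analysis.Analysis"
begin

definition qpow :: "complex \<Rightarrow> real \<Rightarrow> complex" where
  "qpow \<tau> a = exp (2 * of_real pi * \<i> * of_real a * \<tau>)"

abbreviation nome :: "complex \<Rightarrow> complex" where
  "nome \<tau> \<equiv> qpow \<tau> 1"

definition zpow :: "complex \<Rightarrow> real \<Rightarrow> complex" where
  "zpow z a = exp (2 * of_real pi * \<i> * of_real a * z)"

definition qpoch_inf :: "complex \<Rightarrow> complex \<Rightarrow> complex" where
  "qpoch_inf \<tau> a = (\<Prod>j. 1 - a * nome \<tau> ^ j)"

definition dedekind_eta :: "complex \<Rightarrow> complex" where
  "dedekind_eta \<tau> = qpow \<tau> (1/24) * qpoch_inf \<tau> (nome \<tau>)"

definition jacobi_theta :: "complex \<Rightarrow> complex \<Rightarrow> complex" where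
  "jacobi_theta z \<tau> = - \<i> * zpow z (-1/2) * qpow \<tau> (1/8) * qpoch_inf \<tau> (nome \<tau>)
      * qpoch_inf \<tau> (zpow z 1) * qpoch_inf \<tau> (zpow z (-1) * nome \<tau>)"

definition phi :: "nat \<Rightarrow> complex \<Rightarrow> complex \<Rightarrow> complex" where
  "phi N z \<tau> = jacobi_theta z \<tau> powi (- int N)"

definition half_shifted_ints :: "nat \<Rightarrow> real set" where
  "half_shifted_ints N = {real N / 2 + of_int k | k :: int. True}"

definition is_fourier_expansion :: "nat \<Rightarrow> complex \<Rightarrow> (real \<Rightarrow> complex) \<Rightarrow> bool" where
  "is_fourier_expansion N \<tau> c \<longleftrightarrow>
     (\<forall>z. norm (nome \<tau>) < norm (zpow z 1) \<and> norm (zpow z 1) < 1 \<longrightarrow>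
        ((\<lambda>r. c r * zpow z r) has_sum phi N z \<tau>) (half_shifted_ints N))"

text \<open>The coefficient family is pinned down as a function on all reals by letting it vanish
  outside the index set. A statement about \<open>chi\<close> thus rests on the
  existence and uniqueness of the expansion in the annulus.\<close>
definition chi :: "nat \<Rightarrow> real \<Rightarrow> complex \<Rightarrow> complex" where
  "chi N r \<tau> =
     (THE c. is_fourier_expansion N \<tau> c \<and> (\<forall>r. r \<notin> half_shifted_ints N \<longrightarrow> c r = 0)) r"

text \<open>An element \<open>a\<^sub>1 \<alpha>\<^sub>1 + \<dots> + a\<^sub>N\<^sub>-\<^sub>1 \<alpha>\<^sub>N\<^sub>-\<^sub>1\<close> of the real span of the root lattice is represented
  by its coefficient function, which is \<open>0\<close> outside \<open>{1..<N}\<close>. A point \<open>u\<close> of the Cartan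
  subalgebra is represented by the coordinates \<open>u n = \<alpha>\<^sub>n(u)\<close> for \<open>n \<in> {1..<N}\<close>.\<close>

definition cartan_sl :: "nat \<Rightarrow> nat \<Rightarrow> real" where
  "cartan_sl m n = (if m = n then 2 else if m = Suc n \<or> n = Suc m then -1 else 0)"

definition bilin :: "nat \<Rightarrow> (nat \<Rightarrow> real) \<Rightarrow> (nat \<Rightarrow> real) \<Rightarrow> real" where
  "bilin N s t = (\<Sum>m\<in>{1..<N}. \<Sum>n\<in>{1..<N}. s m * cartan_sl m n * t n)"

definition root_sum :: "nat \<Rightarrow> nat \<Rightarrow> nat \<Rightarrow> real" where
  "root_sum i j = (\<lambda>n. if i \<le> n \<and> n \<le> j then 1 else 0)"

abbreviation simple_root :: "nat \<Rightarrow> nat \<Rightarrow> real" where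
  "simple_root n \<equiv> root_sum n n"

definition pos_roots :: "nat \<Rightarrow> (nat \<Rightarrow> real) set" where
  "pos_roots N = {root_sum i j | i j. 1 \<le> i \<and> i \<le> j \<and> j \<le> N - 1}"

definition lin_form :: "nat \<Rightarrow> (nat \<Rightarrow> real) \<Rightarrow> (nat \<Rightarrow> complex) \<Rightarrow> complex" where
  "lin_form N t u = (\<Sum>n\<in>{1..<N}. of_real (t n) * u n)"

definition exp_form :: "nat \<Rightarrow> (nat \<Rightarrow> real) \<Rightarrow> (nat \<Rightarrow> complex) \<Rightarrow> complex" where
  "exp_form N t u = exp (lin_form N t u)"

text \<open>The condition on \<open>m (N - 1)\<close> selects \<open>m (N - 1) \<ge> 0\<close> for \<open>s \<ge> 0\<close> and \<open>m (N - 1) < 0\<close> for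
  \<open>s < 0\<close>, in agreement with \<open>sign_ge0 0 = 1\<close>. The condition is printed in the source with \<open>- 1/2\<close> in
  place of \<open>+ 1/2\<close> in both factors, which is a misprint, as it is incompatible with the expansion in the annulus
  \<open>|q| < |\<zeta>| < 1\<close>: for \<open>N = 2\<close> and \<open>s = 2\<close> it drops the terms with \<open>m 1 = 0\<close>, and the resulting
  coefficient has leading exponent \<open>-9/4\<close> in \<open>q\<close> instead of \<open>-1/4\<close>.\<close>
definition T_set :: "nat \<Rightarrow> int \<Rightarrow> (nat \<Rightarrow> real) set" where
  "T_set N s =
     {(\<lambda>n. if n \<in> {1..<N}
           then (real N - real n) * real n / 2 - of_int s * real n / real N
                  + (real N - 1) * of_int (m n)
           else 0)
      | m :: nat \<Rightarrow> int. (real_of_int (m (N - 1)) + 1/2) * (real_of_int s + 1/2) \<ge> 0}"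

definition partial_theta :: "nat \<Rightarrow> int \<Rightarrow> complex \<Rightarrow> (nat \<Rightarrow> complex) \<Rightarrow> complex" where
  "partial_theta N s \<tau> u =
     (\<Sum>\<^sub>\<infinity>t\<in>T_set N s. exp_form N t u * qpow \<tau> (bilin N t t / (2 * (real N - 1))))"

text \<open>The derivative in the direction of the vector \<open>h\<^sub>\<alpha>\<close> with \<open>\<lambda>(h\<^sub>\<alpha>) = (\<lambda>|\<alpha>)\<close> for all \<open>\<lambda>\<close>;
  its coordinates are \<open>\<alpha>\<^sub>n(h\<^sub>\<alpha>) = (\<alpha>\<^sub>n|\<alpha>)\<close>.\<close>
definition root_deriv ::
    "nat \<Rightarrow> (nat \<Rightarrow> real) \<Rightarrow> ((nat \<Rightarrow> complex) \<Rightarrow> complex) \<Rightarrow> (nat \<Rightarrow> complex) \<Rightarrow> complex" where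
  "root_deriv N \<alpha> f u =
     deriv (\<lambda>w. f (\<lambda>n. u n + w * of_real (bilin N (simple_root n) \<alpha>))) 0"

lemma root_deriv_exp_form:
  "root_deriv N \<alpha> (exp_form N t) = (\<lambda>u. of_real (bilin N t \<alpha>) * exp_form N t u)"
proof
  fix u :: "nat \<Rightarrow> complex"
  have simple: "bilin N (simple_root m) \<alpha> = (\<Sum>n\<in>{1..<N}. cartan_sl m n * \<alpha> n)"
    if "m \<in> {1..<N}" for m
  proof -
    have "bilin N (simple_root m) \<alpha>
        = (\<Sum>k\<in>{1..<N}. if k = m then (\<Sum>n\<in>{1..<N}. cartan_sl k n * \<alpha> n) else 0)"
      unfolding bilin_def root_sum_def by (intro sum.cong refl) auto
    then show ?thesis
      using that by (simp add: sum.delta)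
  qed
  have bil: "bilin N t \<alpha> = (\<Sum>m\<in>{1..<N}. t m * bilin N (simple_root m) \<alpha>)"
    unfolding bilin_def[of N t]
    by (intro sum.cong refl) (simp add: simple sum_distrib_left mult.assoc)
  have lin: "lin_form N t (\<lambda>n. u n + w * of_real (bilin N (simple_root n) \<alpha>))
      = lin_form N t u + w * of_real (bilin N t \<alpha>)" for w
    unfolding lin_form_def bil
    by (simp add: algebra_simps sum.distrib sum_distrib_left)
  have "((\<lambda>w. exp (lin_form N t u + w * of_real (bilin N t \<alpha>))) has_field_derivative
      of_real (bilin N t \<alpha>) * exp (lin_form N t u)) (at 0)"
    by (auto intro!: derivative_eq_intros)
  then show "root_deriv N \<alpha> (exp_form N t) u = of_real (bilin N t \<alpha>) * exp_form N t u"
    unfolding root_deriv_def exp_form_def lin by (rule DERIV_imp_deriv)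
qed

text \<open>The product of the operators \<open>\<partial>\<^sub>\<alpha>\<close> is their composition; they commute on smooth functions, but
  a definition for arbitrary functions has to fix an order.\<close>
definition pos_root_list :: "nat \<Rightarrow> (nat \<Rightarrow> real) list" where
  "pos_root_list N = [root_sum i j. i \<leftarrow> [1..<N], j \<leftarrow> [i..<N]]"

lemma root_sum_eq_iff:
  assumes "i \<le> j" "k \<le> l"
  shows "root_sum i j = root_sum k l \<longleftrightarrow> i = k \<and> j = l"
proof
  assume eq: "root_sum i j = root_sum k l"
  have mem: "i \<le> n \<and> n \<le> j \<longleftrightarrow> k \<le> n \<and> n \<le> l" for n
    using fun_cong[OF eq, of n] unfolding root_sum_def by (auto split: if_splits)
  show "i = k \<and> j = l"
    using mem[of i] mem[of j] mem[of k] mem[of l] assms by linarith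
qed simp

lemma set_pos_root_list: "set (pos_root_list N) = pos_roots N"
  unfolding pos_root_list_def pos_roots_def by fastforce

lemma distinct_pos_root_list: "distinct (pos_root_list N)"
proof -
  have "distinct (concat (map (\<lambda>i. map (root_sum i) [i..<N]) xs))" if "distinct xs" for xs
    using that
  proof (induction xs)
    case (Cons i xs)
    have "distinct (map (root_sum i) [i..<N])"
      by (auto simp: distinct_map inj_on_def root_sum_eq_iff)
    moreover have "set (map (root_sum i) [i..<N])
        \<inter> set (concat (map (\<lambda>i. map (root_sum i) [i..<N]) xs)) = {}"
      using Cons.prems by (auto simp: root_sum_eq_iff)
    ultimately show ?case
      using Cons by simp
  qed simp
  then show ?thesis
    unfolding pos_root_list_def by simp
qed

definition root_diff_op ::
    "nat \<Rightarrow> ((nat \<Rightarrow> complex) \<Rightarrow> complex) \<Rightarrow> (nat \<Rightarrow> complex) \<Rightarrow> complex" where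
  "root_diff_op N = foldr (root_deriv N) (pos_root_list N)"

text \<open>Every function \<open>e\<^sup>t\<close> takes the value \<open>1\<close> at the origin, so that evaluation there replaces all
  \<open>e\<^sup>t\<close> in a series by \<open>1\<close>.\<close>
definition all_exp_one :: "((nat \<Rightarrow> complex) \<Rightarrow> complex) \<Rightarrow> complex" where
  "all_exp_one f = f (\<lambda>_. 0)"

lemma all_exp_one_exp_form: "all_exp_one (exp_form N t) = 1"
  by (simp add: all_exp_one_def exp_form_def lin_form_def)

definition superfact :: "nat \<Rightarrow> nat" where
  "superfact N = (\<Prod>j=1..N. fact j)"

definition sign_ge0 :: "real \<Rightarrow> real" where
  "sign_ge0 x = (if x \<ge> 0 then 1 else -1)"

definition chi_prefactor :: "nat \<Rightarrow> real \<Rightarrow> complex \<Rightarrow> complex" where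
  "chi_prefactor N r \<tau> =
     \<i> ^ N * of_real (sign_ge0 (r - real N / 2)) * qpow \<tau> (- (r\<^sup>2 / (2 * real N)))
       / (dedekind_eta \<tau> ^ (N * (N + 1)) * of_nat (superfact (N - 1)))"

end

theory Submission
  imports Defs "HOL-Complex_Analysis.Complex_Analysis"
begin

text \<open>
  Put \<open>F(\<zeta>) = ((\<zeta>)\<^sub>\<infinity> (q/\<zeta>)\<^sub>\<infinity>)\<^sup>-\<^sup>N\<close>, which is \<open>\<phi>\<^sub>N\<close> up to an elementary factor. It has a pole of order
  \<open>N\<close> at \<open>\<zeta> = 1\<close>, hence one Laurent expansion with coefficients \<open>c s\<close> on \<open>|q| < |\<zeta>| < 1\<close> and another
  one on \<open>1 < |\<zeta>| < 1/|q|\<close>. The difference of the two coefficients is a residue at \<open>\<zeta> = 1\<close> and therefore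
  a polynomial \<open>R\<close> of degree \<open>N - 1\<close> in the exponent, while \<open>F(q\<zeta>) = (-\<zeta>)\<^sup>N F(\<zeta>)\<close> expresses the outer
  coefficients by the inner ones. With \<open>r = s + N/2\<close> this gives the recursion
  \<open>R(r) = c s - (-1)\<^sup>N q\<^sup>s\<^sup>+\<^sup>N c (s + N)\<close>. Weighted with \<open>(-1)\<^sup>N\<^sup>j\<close> and the Gaussian with exponent
  \<open>(r + N j)\<^sup>2 / (2 N)\<close> it telescopes (\<open>telescoping_theta_sum\<close>): the sum of the weighted values
  \<open>R(r + N j)\<close> over \<open>j \<ge> 0\<close> is \<open>c s\<close> times the Gaussian at \<open>r\<close>, and the sum over all \<open>j\<close> is \<open>0\<close>.

  On the lattice side, let \<open>x\<^sub>1, \<dots>, x\<^sub>N\<close> be the coordinates of \<open>t\<close> in which the roots are differences. The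
  product of the \<open>(t|\<alpha>)\<close> is their Vandermonde product. Up to a common translation the first \<open>N - 1\<close>
  coordinates are \<open>\<rho>\<^sub>i + (N - 1) k\<^sub>i\<close> with \<open>\<rho>\<close> the Weyl vector of \<open>sl(N - 1)\<close>, and the total
  \<open>\<kappa> = k\<^sub>1 + \<dots> + k\<^sub>N\<^sub>-\<^sub>1\<close> determines \<open>x\<^sub>N\<close>. For fixed \<open>\<kappa>\<close> the sum is a polynomial in \<open>x\<^sub>N\<close>, and a cyclic
  permutation of the coordinates relates all values of \<open>\<kappa>\<close> to \<open>\<kappa> = 0\<close> (\<open>slice_sum_shift\<close>).

  The key point is that the polynomial for \<open>\<kappa> = 0\<close> is a multiple of \<open>R\<close> (\<open>slice_sum_proportional\<close>). The
  polynomial \<open>R\<close> is interpolated at the \<open>N - 1\<close> lattice coordinates; the remainder is its leading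
  coefficient times the product of the differences to the nodes. In the average over the lattice, every
  interpolation term contains the complete weighted sum of values of \<open>R\<close> along a progression of step \<open>N\<close>,
  which vanishes; what remains is the lattice polynomial on one side and \<open>R\<close> on the other.

  The factor of proportionality contains the lattice sum of the Vandermonde product, a theta function in
  \<open>\<tau>\<close> alone. Comparing the coefficients two below the top in the same proportionality expresses its
  logarithmic derivative by a divisor sum, which is the one that occurs for \<open>\<eta>\<close>; with the limit
  \<open>Im \<tau> \<rightarrow> \<infinity>\<close> this yields the Macdonald identity for \<open>sl(N - 1)\<close> (\<open>slice_sum_eq_eta_power\<close>). Summing the
  slices over a half-line of \<open>\<kappa>\<close> reproduces the one-sided sum for \<open>c s\<close>. The half-line may be chosen on
  either side at the cost of a sign, as the two-sided sum is \<open>0\<close>; this is the factor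
  \<open>sign(r - N/2)\<close>. Finally, Gaussian decay justifies differentiating the partial theta function term by
  term, which turns the product of the operators \<open>\<partial>\<^sub>\<alpha>\<close> into the product of the \<open>(t|\<alpha>)\<close>.
\<close>

section \<open>Absolutely convergent sums\<close>

lemma norm_summable_onI:
  fixes f :: "'a \<Rightarrow> complex"
  assumes "g summable_on A" "\<And>x. x \<in> A \<Longrightarrow> norm (f x) \<le> g x"
  shows "f summable_on A"
  using Infinite_Sum.abs_summable_on_comparison_test'[OF assms] summable_on_iff_abs_summable_on_complex by blast

lemma summable_on_normD:
  fixes f :: "'a \<Rightarrow> complex"
  shows "f summable_on A \<Longrightarrow> (\<lambda>x. norm (f x)) summable_on A"
  using summable_on_iff_abs_summable_on_complex by blast

lemma has_sum_diff:
  fixes f g :: "'a \<Rightarrow> complex"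
  assumes "(f has_sum a) A" "(g has_sum b) A"
  shows "((\<lambda>x. f x - g x) has_sum (a - b)) A"
  using has_sum_add[OF assms(1) has_sum_uminusI[OF assms(2)]] by simp

lemma has_sum_product:
  fixes f :: "'a \<Rightarrow> complex" and g :: "'b \<Rightarrow> complex"
  assumes f: "(f has_sum F) A" and g: "(g has_sum G) B"
  shows "((\<lambda>(x, y). f x * g y) has_sum F * G) (A \<times> B)"
proof (rule has_sum_SigmaI)
  have nf: "(\<lambda>x. norm (f x)) summable_on A" and ng: "(\<lambda>x. norm (g x)) summable_on B"
    by (intro summable_on_normD has_sum_imp_summable[OF f] has_sum_imp_summable[OF g])+
  have "(\<lambda>p. norm (case p of (x, y) \<Rightarrow> f x * g y)) summable_on A \<times> B"
  proof (rule summable_on_SigmaI)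
    show "((\<lambda>y. norm (case (x, y) of (x, y) \<Rightarrow> f x * g y)) has_sum norm (f x) * infsum (\<lambda>y. norm (g y)) B) B" for x
      using has_sum_cmult_right[OF has_sum_infsum[OF ng], of "norm (f x)"] by (simp add: norm_mult)
    show "(\<lambda>x. norm (f x) * infsum (\<lambda>y. norm (g y)) B) summable_on A"
      using nf by (rule summable_on_cmult_left)
  qed auto
  then show "(\<lambda>(x, y). f x * g y) summable_on A \<times> B"
    using summable_on_iff_abs_summable_on_complex by blast
  show "((\<lambda>y. case (x, y) of (x, y) \<Rightarrow> f x * g y) has_sum f x * G) B" for x
    using has_sum_cmult_right[OF g] by simp
  show "((\<lambda>x. f x * G) has_sum F * G) A"
    using f by (rule has_sum_cmult_left)
qed

lemma summable_on_int_halvesI: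
  fixes f :: "int \<Rightarrow> real"
  assumes "summable (\<lambda>n. norm (f (int n)))" "summable (\<lambda>n. norm (f (- int n)))"
  shows "f summable_on UNIV"
proof -
  have "(\<lambda>n. f (int n)) summable_on UNIV" "(\<lambda>n. f (- int n)) summable_on UNIV"
    by (intro norm_summable_imp_summable_on assms)+
  then have "f summable_on range int" "f summable_on range (\<lambda>n. - int n)"
    by (simp_all add: summable_on_reindex inj_on_def o_def)
  then have "f summable_on range int \<union> range (\<lambda>n. - int n)"
    by (rule summable_on_union)
  moreover have "range int \<union> range (\<lambda>n. - int n) = UNIV"
  proof (intro equalityI subsetI)
    fix k :: int
    show "k \<in> range int \<union> range (\<lambda>n. - int n)"
      by (cases k rule: int_cases2) auto
  qed simp
  ultimately show ?thesis by simp
qed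

lemma summable_on_gauss_int:
  fixes C a :: real
  assumes "a > 0"
  shows "(\<lambda>k::int. exp (C * \<bar>k\<bar> - a * (real_of_int k)\<^sup>2)) summable_on UNIV"
proof (rule summable_on_comparison_test)
  define B where "B = exp ((C + 1)\<^sup>2 / (4 * a))"
  show "(\<lambda>k::int. B * exp (- real_of_int \<bar>k\<bar>)) summable_on UNIV"
  proof (intro summable_on_cmult_right summable_on_int_halvesI)
    have "summable (\<lambda>n. exp (-1 :: real) ^ n)" by (rule summable_geometric) auto
    then have "summable (\<lambda>n. exp (- real n))" by (simp flip: exp_of_nat_mult)
    then show "summable (\<lambda>n. norm (exp (- real_of_int \<bar>int n\<bar>)))"
      and "summable (\<lambda>n. norm (exp (- real_of_int \<bar>- int n\<bar>)))" by simp_all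
  qed
  fix k :: int
  define x where "x = real_of_int \<bar>k\<bar>"
  have x2: "(real_of_int k)\<^sup>2 = x\<^sup>2" by (simp add: x_def)
  have "0 \<le> (2 * a * x - (C + 1))\<^sup>2 / (4 * a)" using assms by simp
  also have "\<dots> = a * x\<^sup>2 - (C + 1) * x + (C + 1)\<^sup>2 / (4 * a)"
    using assms by (simp add: power2_eq_square field_simps)
  finally have "C * x - a * x\<^sup>2 \<le> (C + 1)\<^sup>2 / (4 * a) - x" by (simp add: algebra_simps)
  then show "exp (C * \<bar>k\<bar> - a * (real_of_int k)\<^sup>2) \<le> B * exp (- real_of_int \<bar>k\<bar>)"
    unfolding B_def x2 x_def[symmetric] by (simp flip: exp_add)
qed auto

lemma summable_on_gauss_lattice:
  fixes C a :: real
  assumes J: "finite J" and a: "a > 0"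
  shows "(\<lambda>k. exp (C * (\<Sum>j\<in>J. \<bar>k j\<bar>) - a * (\<Sum>j\<in>J. (real_of_int (k j))\<^sup>2)))
          summable_on (PiE J (\<lambda>_. UNIV :: int set))"
proof -
  define f where "f = (\<lambda>k::int. exp (C * \<bar>k\<bar> - a * (real_of_int k)\<^sup>2))"
  have "Infinite_Set_Sum.abs_summable_on f UNIV"
    unfolding abs_summable_equivalent[symmetric]
    using summable_on_gauss_int[OF a, of C] by (simp add: f_def)
  then have "Infinite_Set_Sum.abs_summable_on (\<lambda>k. \<Prod>j\<in>J. f (k j)) (PiE J (\<lambda>_. UNIV))"
    by (intro abs_summable_on_prod_PiE J) auto
  then have "(\<lambda>k. norm (\<Prod>j\<in>J. f (k j))) summable_on (PiE J (\<lambda>_. UNIV))"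
    unfolding abs_summable_equivalent[symmetric] .
  moreover have "norm (\<Prod>j\<in>J. f (k j)) = exp (C * (\<Sum>j\<in>J. \<bar>k j\<bar>) - a * (\<Sum>j\<in>J. (real_of_int (k j))\<^sup>2))" for k
    by (simp add: f_def prod_norm[symmetric] exp_sum[OF J, symmetric] sum_subtractf sum_distrib_left)
  ultimately show ?thesis by simp
qed

text \<open>The second-order Taylor remainder of \<open>exp (a t * w)\<close> is at most a constant times \<open>|w|\<^sup>2\<close> times the
  summable majorant, because a square is absorbed by half of the exponential growth.\<close>

lemma DERIV_infsum_exp:
  fixes a c :: "'i \<Rightarrow> complex"
  assumes \<delta>: "\<delta> > 0" and sm: "(\<lambda>t. norm (c t) * exp (\<delta> * norm (a t))) summable_on A"
  shows "((\<lambda>w. \<Sum>\<^sub>\<infinity>t\<in>A. c t * exp (a t * w)) has_field_derivative (\<Sum>\<^sub>\<infinity>t\<in>A. c t * a t)) (at 0)"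
proof -
  define B where "B = (\<Sum>\<^sub>\<infinity>t\<in>A. (8 / \<delta>\<^sup>2) * (norm (c t) * exp (\<delta> * norm (a t))))"
  have sq: "x\<^sup>2 \<le> 8 / \<delta>\<^sup>2 * exp (\<delta> / 2 * x)" if "x \<ge> 0" for x
  proof -
    have "1 + \<delta>/2 * x + (\<delta>/2 * x)\<^sup>2 / 2 \<le> exp (\<delta> / 2 * x)"
      using that \<delta> by (intro exp_lower_Taylor_quadratic) auto
    moreover have "0 \<le> \<delta> * x" using \<delta> that by simp
    ultimately have "(\<delta>/2 * x)\<^sup>2 / 2 \<le> exp (\<delta> / 2 * x)" by linarith
    then show ?thesis using \<delta> by (simp add: field_simps power2_eq_square)
  qed
  have bound: "norm (c t * exp (a t * w) - c t - c t * a t * w)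
      \<le> (norm w)\<^sup>2 * ((8 / \<delta>\<^sup>2) * (norm (c t) * exp (\<delta> * norm (a t))))" if w: "norm w \<le> \<delta> / 2" for w t
  proof -
    define z where "z = a t * w"
    have aw: "norm z \<le> \<delta> / 2 * norm (a t)"
      unfolding z_def norm_mult using mult_left_mono[OF w norm_ge_zero[of "a t"]] by (simp add: mult.commute)
    have "norm (exp z - (\<Sum>i\<le>1. z ^ i / fact i)) \<le> exp \<bar>Re z\<bar> * (norm z ^ Suc 1) / fact 1"
      by (rule Taylor_exp)
    then have "norm (exp z - 1 - z) \<le> exp \<bar>Re z\<bar> * (norm z)\<^sup>2"
      by (simp add: diff_diff_add power2_eq_square)
    also have "\<dots> \<le> exp (\<delta> / 2 * norm (a t)) * (norm z)\<^sup>2"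
      using abs_Re_le_cmod[of z] aw by (intro mult_right_mono) auto
    also have "\<dots> = (norm w)\<^sup>2 * (exp (\<delta> / 2 * norm (a t)) * (norm (a t))\<^sup>2)"
      by (simp add: z_def norm_mult power_mult_distrib)
    also have "\<dots> \<le> (norm w)\<^sup>2 * (exp (\<delta> / 2 * norm (a t)) * (8 / \<delta>\<^sup>2 * exp (\<delta> / 2 * norm (a t))))"
      by (intro mult_left_mono sq) auto
    also have "\<dots> = (norm w)\<^sup>2 * (8 / \<delta>\<^sup>2 * exp (\<delta> * norm (a t)))"
      by (simp add: field_simps flip: exp_add)
    finally have "norm (c t) * norm (exp z - 1 - z) \<le> norm (c t) * ((norm w)\<^sup>2 * (8 / \<delta>\<^sup>2 * exp (\<delta> * norm (a t))))"
      by (rule mult_left_mono) auto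
    moreover have "c t * exp (a t * w) - c t - c t * a t * w = c t * (exp z - 1 - z)"
      by (simp add: z_def algebra_simps)
    ultimately show ?thesis by (simp add: norm_mult mult_ac)
  qed
  have ge1: "1 \<le> exp (\<delta> * norm (a t))" for t using \<delta> by simp
  have s0: "c summable_on A"
    using mult_left_mono[OF ge1 norm_ge_zero] by (intro norm_summable_onI[OF sm]) simp
  have s1: "(\<lambda>t. c t * exp (a t * w)) summable_on A" if w: "norm w \<le> \<delta> / 2" for w
  proof (rule norm_summable_onI[OF sm])
    fix t
    have "norm (a t * w) \<le> \<delta> * norm (a t)"
      unfolding norm_mult using mult_left_mono[OF w norm_ge_zero[of "a t"]] \<delta>
      by (smt (verit, best) field_sum_of_halves mult.commute mult_left_mono norm_ge_zero)
    then have "norm (exp (a t * w)) \<le> exp (\<delta> * norm (a t))"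
      using complex_Re_le_cmod[of "a t * w"] by (simp add: norm_exp_eq_Re)
    then show "norm (c t * exp (a t * w)) \<le> norm (c t) * exp (\<delta> * norm (a t))"
      unfolding norm_mult by (rule mult_left_mono) auto
  qed
  have s2: "(\<lambda>t. c t * a t) summable_on A"
  proof (rule norm_summable_onI)
    show "(\<lambda>t. norm (c t) * exp (\<delta> * norm (a t)) * (1 / \<delta>)) summable_on A"
      using sm by (rule summable_on_cmult_left)
    fix t
    have "\<delta> * norm (a t) \<le> exp (\<delta> * norm (a t))"
      using exp_ge_add_one_self[of "\<delta> * norm (a t)"] by linarith
    then have "norm (a t) \<le> exp (\<delta> * norm (a t)) * (1 / \<delta>)" using \<delta> by (simp add: field_simps)
    from mult_left_mono[OF this norm_ge_zero[of "c t"]]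
    show "norm (c t * a t) \<le> norm (c t) * exp (\<delta> * norm (a t)) * (1 / \<delta>)"
      by (simp add: norm_mult)
  qed
  define f where "f = (\<lambda>w. \<Sum>\<^sub>\<infinity>t\<in>A. c t * exp (a t * w))"
  define f' where "f' = (\<Sum>\<^sub>\<infinity>t\<in>A. c t * a t)"
  have main: "norm (f w - f 0 - f' * w) \<le> (norm w)\<^sup>2 * B" if w: "norm w \<le> \<delta> / 2" for w
  proof -
    have "((\<lambda>t. c t * exp (a t * w) - c t - c t * a t * w) has_sum (f w - f 0 - f' * w)) A"
      unfolding f_def f'_def using s0 s1[OF w] s2
      by (intro has_sum_diff has_sum_cmult_left has_sum_infsum) auto
    then have "norm (f w - f 0 - f' * w)
        \<le> (\<Sum>\<^sub>\<infinity>t\<in>A. (norm w)\<^sup>2 * ((8 / \<delta>\<^sup>2) * (norm (c t) * exp (\<delta> * norm (a t)))))"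
      by (rule norm_infsum_le[OF _ has_sum_infsum]) (intro summable_on_cmult_right sm bound[OF w])+
    also have "\<dots> = (norm w)\<^sup>2 * B"
      unfolding B_def by (rule infsum_cmult_right) (intro summable_on_cmult_right sm)
    finally show ?thesis .
  qed
  have "((\<lambda>w. (f w - f 0) / w) \<longlongrightarrow> f') (at 0)"
  proof (rule LIM_zero_cancel, rule Lim_null_comparison)
    show "\<forall>\<^sub>F w in at 0. norm ((f w - f 0) / w - f') \<le> norm w * B"
      unfolding eventually_at
    proof (intro exI[of _ "\<delta>/2"] conjI ballI impI)
      fix w :: complex assume "w \<noteq> 0 \<and> dist w 0 < \<delta> / 2"
      then have w: "w \<noteq> 0" "norm w \<le> \<delta> / 2" by auto
      have "norm ((f w - f 0) / w - f') = norm (f w - f 0 - f' * w) / norm w"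
        using w by (simp add: field_simps flip: norm_divide)
      also have "\<dots> \<le> ((norm w)\<^sup>2 * B) / norm w" using main[OF w(2)] by (intro divide_right_mono) auto
      finally show "norm ((f w - f 0) / w - f') \<le> norm w * B" using w by (simp add: power2_eq_square)
    qed (use \<delta> in auto)
    show "((\<lambda>w. norm w * B) \<longlongrightarrow> 0) (at (0::complex))"
      by (auto intro!: tendsto_eq_intros)
  qed
  then show ?thesis
    unfolding f_def f'_def by (simp add: has_field_derivative_iff)
qed

text \<open>Used for limits at the cusp: the gap \<open>e\<close> lets a factor \<open>exp (- (y - 1) * e)\<close> be pulled out of the
  whole series at once.\<close>

lemma infsum_exp_decay:
  fixes c :: "'i \<Rightarrow> complex" and E :: "'i \<Rightarrow> real"
  assumes "e > 0" and E: "\<And>t. t \<in> A \<Longrightarrow> E t \<ge> e"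
    and sm: "(\<lambda>t. c t * of_real (exp (- E t))) summable_on A"
  shows "((\<lambda>y. \<Sum>\<^sub>\<infinity>t\<in>A. c t * of_real (exp (- (y * E t)))) \<longlongrightarrow> 0) at_top"
proof (rule Lim_null_comparison)
  define S where "S = (\<Sum>\<^sub>\<infinity>t\<in>A. norm (c t * of_real (exp (- E t))))"
  have nsm: "(\<lambda>t. norm (c t * of_real (exp (- E t)))) summable_on A"
    using sm by (rule summable_on_normD)
  show "\<forall>\<^sub>F y in at_top. norm (\<Sum>\<^sub>\<infinity>t\<in>A. c t * of_real (exp (- (y * E t)))) \<le> exp (- ((y - 1) * e)) * S"
    using eventually_ge_at_top[of 1]
  proof eventually_elim
    case (elim y)
    have le: "norm (c t * of_real (exp (- (y * E t))))
        \<le> exp (- ((y - 1) * e)) * norm (c t * of_real (exp (- E t)))" if "t \<in> A" for t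
    proof -
      have "(y - 1) * e \<le> (y - 1) * E t" using E[OF that] elim by (intro mult_left_mono) auto
      then have "exp (- (y * E t)) \<le> exp (- ((y - 1) * e)) * exp (- E t)"
        by (simp add: algebra_simps flip: exp_add)
      from mult_left_mono[OF this norm_ge_zero[of "c t"]] show ?thesis
        by (simp add: norm_mult mult_ac)
    qed
    have s2: "(\<lambda>t. exp (- ((y - 1) * e)) * norm (c t * of_real (exp (- E t)))) summable_on A"
      using nsm by (rule summable_on_cmult_right)
    have "(\<lambda>t. c t * of_real (exp (- (y * E t)))) summable_on A"
      by (rule norm_summable_onI[OF s2]) (rule le)
    from norm_infsum_le[OF has_sum_infsum[OF this] has_sum_infsum[OF s2] le]
    have "norm (\<Sum>\<^sub>\<infinity>t\<in>A. c t * of_real (exp (- (y * E t))))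
        \<le> (\<Sum>\<^sub>\<infinity>t\<in>A. exp (- ((y - 1) * e)) * norm (c t * of_real (exp (- E t))))" by blast
    also have "\<dots> = exp (- ((y - 1) * e)) * S"
      unfolding S_def by (rule infsum_cmult_right) (rule nsm)
    finally show ?case .
  qed
  have "((\<lambda>y::real. exp (- ((y - 1) * e))) \<longlongrightarrow> 0) at_top"
    using \<open>e > 0\<close> by real_asymp
  then show "((\<lambda>y. exp (- ((y - 1) * e)) * S) \<longlongrightarrow> 0) at_top"
    by (rule tendsto_mult_left_zero)
qed

section \<open>Laurent series\<close>

lemma laurent_mult:
  fixes a b :: "int \<Rightarrow> complex"
  assumes "\<zeta> \<noteq> 0" and A: "((\<lambda>k. a k * \<zeta> powi k) has_sum A) UNIV"
    and B: "((\<lambda>k. b k * \<zeta> powi k) has_sum B) UNIV"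
  shows laurent_mult_summable: "(\<lambda>k. a k * b (s - k)) summable_on UNIV"
    and laurent_mult_has_sum:
      "((\<lambda>s. (\<Sum>\<^sub>\<infinity>k. a k * b (s - k)) * \<zeta> powi s) has_sum A * B) UNIV"
proof -
  have "((\<lambda>(k, l). (a k * \<zeta> powi k) * (b l * \<zeta> powi l)) has_sum A * B) (UNIV \<times> UNIV)"
    using has_sum_product[OF A B] by simp
  also have "?this \<longleftrightarrow> ((\<lambda>(s, k). (a k * b (s - k)) * \<zeta> powi s) has_sum A * B) (UNIV \<times> UNIV)"
    using \<open>\<zeta> \<noteq> 0\<close>
    by (intro has_sum_reindex_bij_witness[of _ "\<lambda>(s, k). (k, s - k)" "\<lambda>(k, l). (k + l, k)"])
       (auto simp: power_int_add)
  finally have *: "((\<lambda>(s, k). (a k * b (s - k)) * \<zeta> powi s) has_sum A * B) (UNIV \<times> UNIV)" .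
  have inner: "(\<lambda>k. a k * b (s - k) * \<zeta> powi s) summable_on UNIV" for s
    using summable_on_SigmaD1[OF has_sum_imp_summable[OF *], of s] by simp
  show s: "(\<lambda>k. a k * b (s - k)) summable_on UNIV" for s
    using summable_on_cmult_left[OF inner[of s], of "\<zeta> powi (- s)"] \<open>\<zeta> \<noteq> 0\<close>
    by (simp add: power_int_minus field_simps)
  show "((\<lambda>s. (\<Sum>\<^sub>\<infinity>k. a k * b (s - k)) * \<zeta> powi s) has_sum A * B) UNIV"
    by (rule has_sum_SigmaD[OF *]) (auto intro!: has_sum_cmult_left has_sum_infsum s)
qed

lemma has_integral_circle_mode:
  fixes m :: int
  shows "((\<lambda>x. exp (\<i> * of_int m * of_real x)) has_integral (if m = 0 then 2 * of_real pi else 0)) {0..2*pi}"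
proof (cases "m = 0")
  case True
  then show ?thesis using has_integral_const_real[of "1::complex" 0 "2*pi"]
    by (simp add: scaleR_conv_of_real)
next
  case False
  define F where "F = (\<lambda>z::complex. exp (\<i> * of_int m * z) / (\<i> * of_int m))"
  have "(F has_field_derivative exp (\<i> * of_int m * z)) (at z)" for z
    unfolding F_def using False by (auto intro!: derivative_eq_intros)
  then have "((\<lambda>x. F (of_real x)) has_vector_derivative exp (\<i> * of_int m * of_real x)) (at x within {0..2*pi})" for x
    by (rule has_vector_derivative_real_field)
  then have "((\<lambda>x. exp (\<i> * of_int m * of_real x)) has_integral (F (of_real (2*pi)) - F (of_real 0))) {0..2*pi}"
    by (intro fundamental_theorem_of_calculus) auto
  moreover have "exp (\<i> * of_int m * of_real (2*pi)) = 1"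
    unfolding exp_eq_1 by (auto intro!: exI[of _ m])
  ultimately show ?thesis using False by (simp add: F_def)
qed

text \<open>Uniform convergence on the circle allows integrating against a single mode, which isolates one
  coefficient.\<close>

lemma laurent_zero:
  fixes d :: "int \<Rightarrow> complex"
  assumes "\<rho> > 0" and d: "\<And>\<zeta>. norm \<zeta> = \<rho> \<Longrightarrow> ((\<lambda>k. d k * \<zeta> powi k) has_sum 0) UNIV"
  shows "d m = 0"
proof -
  define e where "e = (\<lambda>k. d k * of_real \<rho> powi k)"
  define f where "f = (\<lambda>k x. e k * exp (\<i> * of_int (k - m) * of_real x))"
  have hs: "((\<lambda>k. f k x) has_sum 0) UNIV" for x
  proof -
    define \<zeta> where "\<zeta> = of_real \<rho> * exp (\<i> * of_real x)"
    have "norm \<zeta> = \<rho>" using \<open>\<rho> > 0\<close> by (simp add: \<zeta>_def norm_mult)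
    from has_sum_cmult_left[OF d[OF this], of "exp (- (\<i> * of_int m * of_real x))"]
    have "((\<lambda>k. d k * \<zeta> powi k * exp (- (\<i> * of_int m * of_real x))) has_sum 0) UNIV" by simp
    moreover have "d k * \<zeta> powi k * exp (- (\<i> * of_int m * of_real x)) = f k x" for k
    proof -
      have "exp (of_int k * (\<i> * of_real x)) * exp (- (\<i> * of_int m * of_real x)) = exp (\<i> * of_int (k - m) * of_real x)"
        unfolding exp_add[symmetric] by (rule arg_cong[where f = exp]) (simp add: algebra_simps)
      then show ?thesis by (simp only: \<zeta>_def f_def e_def power_int_mult_distrib exp_power_int mult.assoc)
    qed
    ultimately show ?thesis by simp
  qed
  have "((\<lambda>k. d k * of_real \<rho> powi k) has_sum 0) UNIV" by (rule d) (use \<open>\<rho> > 0\<close> in auto)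
  then have M: "(\<lambda>k. norm (e k)) summable_on UNIV"
    unfolding e_def by (intro summable_on_normD) (rule has_sum_imp_summable)
  have unif: "uniform_limit {0..2*pi} (\<lambda>X x. \<Sum>k\<in>X. f k x) (\<lambda>_. 0) (finite_subsets_at_top UNIV)"
    by (rule Weierstrass_m_test_general'[OF _ hs M])
       (auto simp: f_def norm_mult norm_exp_eq_Re)
  have cont: "continuous_on {0..2*pi} (\<lambda>x. \<Sum>k\<in>X. f k x)" for X
    unfolding f_def by (intro continuous_intros)
  obtain I J where I: "\<And>X. ((\<lambda>x. \<Sum>k\<in>X. f k x) has_integral I X) {0..2*pi}"
    and J: "((\<lambda>_. 0) has_integral J) {0..2*pi}" and lim: "(I \<longlongrightarrow> J) (finite_subsets_at_top UNIV)"
    by (rule uniform_limit_integral[OF unif cont finite_subsets_at_top_neq_bot]) (rule that)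
  have "J = 0" by (rule has_integral_unique[OF J has_integral_0])
  have Ieq: "I X = e m * (2 * of_real pi)" if "finite X" "m \<in> X" for X
  proof -
    have "((\<lambda>x. \<Sum>k\<in>X. f k x) has_integral (\<Sum>k\<in>X. e k * (if k - m = 0 then 2 * of_real pi else 0))) {0..2*pi}"
      unfolding f_def by (intro has_integral_sum that has_integral_mult_right has_integral_circle_mode)
    then have "I X = (\<Sum>k\<in>X. e k * (if k - m = 0 then 2 * of_real pi else 0))"
      by (rule has_integral_unique[OF I])
    also have "\<dots> = (\<Sum>k\<in>X. if k = m then e k * (2 * of_real pi) else 0)"
      by (intro sum.cong) auto
    also have "\<dots> = e m * (2 * of_real pi)" using that by (simp add: sum.delta)
    finally show ?thesis .
  qed
  have "\<forall>\<^sub>F X in finite_subsets_at_top UNIV. e m * (2 * of_real pi) = I X"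
    unfolding eventually_finite_subsets_at_top by (intro exI[of _ "{m}"]) (auto simp: Ieq)
  from Lim_transform_eventually[OF tendsto_const this]
  have "(I \<longlongrightarrow> e m * (2 * of_real pi)) (finite_subsets_at_top UNIV)" .
  with lim have "e m * (2 * of_real pi) = J"
    by (intro tendsto_unique[OF finite_subsets_at_top_neq_bot])
  with \<open>J = 0\<close> have "e m = 0" by simp
  then show ?thesis using \<open>\<rho> > 0\<close> by (simp add: e_def power_int_eq_0_iff)
qed

lemma laurent_unique:
  fixes a b :: "int \<Rightarrow> complex"
  assumes "\<rho> > 0"
    and "\<And>\<zeta>. norm \<zeta> = \<rho> \<Longrightarrow> ((\<lambda>k. a k * \<zeta> powi k) has_sum f \<zeta>) UNIV"
    and "\<And>\<zeta>. norm \<zeta> = \<rho> \<Longrightarrow> ((\<lambda>k. b k * \<zeta> powi k) has_sum f \<zeta>) UNIV"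
  shows "a = b"
proof
  fix m
  have "((\<lambda>k. (a k - b k) * \<zeta> powi k) has_sum 0) UNIV" if "norm \<zeta> = \<rho>" for \<zeta>
    using has_sum_diff[OF assms(2,3)[OF that]] by (simp add: algebra_simps)
  from laurent_zero[OF \<open>\<rho> > 0\<close> this] have "a m - b m = 0" .
  then show "a m = b m" by simp
qed

section \<open>Products and their logarithms\<close>

lemma qpow_0 [simp]: "qpow \<tau> 0 = 1"
  by (simp add: qpow_def)

lemma qpow_neq_0 [simp]: "qpow \<tau> a \<noteq> 0"
  by (simp add: qpow_def)

lemma qpow_add: "qpow \<tau> (a + b) = qpow \<tau> a * qpow \<tau> b"
  by (simp add: qpow_def ring_distribs exp_add)

lemma qpow_minus: "qpow \<tau> (- a) = inverse (qpow \<tau> a)"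
  by (simp add: qpow_def exp_minus)

lemma qpow_power: "qpow \<tau> a ^ n = qpow \<tau> (of_nat n * a)"
  by (simp add: qpow_def mult_ac flip: exp_of_nat_mult)

lemma qpow_powi: "qpow \<tau> a powi k = qpow \<tau> (of_int k * a)"
  by (simp add: qpow_def exp_power_int mult_ac)

lemma norm_qpow: "norm (qpow \<tau> a) = exp (- (2 * pi * Im \<tau> * a))"
  by (simp add: qpow_def norm_exp_eq_Re)

lemma nome_bounds:
  assumes "Im \<tau> > 0"
  shows "nome \<tau> \<noteq> 0" "norm (nome \<tau>) < 1" "0 < norm (nome \<tau>)"
  using assms by (auto simp: norm_qpow)

text \<open>The expansion of \<open>- log (a)\<^sub>\<infinity>\<close>. As a double series of exponentials it can be differentiated in
  \<open>a\<close> and in \<open>\<tau>\<close> by the same lemma.\<close>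

definition log_poch :: "complex \<Rightarrow> complex \<Rightarrow> complex" where
  "log_poch \<tau> a = (\<Sum>\<^sub>\<infinity>(m, j)\<in>{1..} \<times> UNIV. a ^ m * nome \<tau> ^ (m * j) / of_nat m)"

lemma log_poch_summable:
  assumes \<tau>: "Im \<tau> > 0" and a: "norm a < 1"
  shows "(\<lambda>(m, j). a ^ m * nome \<tau> ^ (m * j) / of_nat m) summable_on {1..} \<times> (UNIV :: nat set)"
proof (rule norm_summable_onI)
  have "((\<lambda>m. complex_of_real (norm a ^ m)) has_sum of_real (1 / (1 - norm a))) UNIV"
    using a by (intro has_sum_of_real norm_summable_imp_has_sum geometric_sums)
       (auto intro!: summable_geometric)
  then have 1: "(\<lambda>m. complex_of_real (norm a ^ m)) summable_on {1..}"
    using has_sum_imp_summable summable_on_subset by blast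
  have 2: "(\<lambda>j. complex_of_real (norm (nome \<tau>) ^ j)) summable_on UNIV"
    using nome_bounds[OF \<tau>]
    by (intro summable_on_of_real norm_summable_imp_summable_on)
       (auto intro!: summable_geometric simp: norm_power)
  have "(\<lambda>(m, j). complex_of_real (norm a ^ m) * complex_of_real (norm (nome \<tau>) ^ j)) summable_on {1..} \<times> UNIV"
    by (rule has_sum_imp_summable[OF has_sum_product[OF has_sum_infsum[OF 1] has_sum_infsum[OF 2]]])
  from summable_on_Re[OF this]
  show "(\<lambda>(m, j). norm a ^ m * norm (nome \<tau>) ^ j) summable_on {1..} \<times> UNIV"
    by (simp add: case_prod_unfold)
  fix p :: "nat \<times> nat" assume p: "p \<in> {1..} \<times> UNIV"
  obtain m j where mj: "p = (m, j)" by force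
  with p have m: "m \<ge> 1" by auto
  have "j \<le> m * j" using m by (cases m) auto
  then have "norm (nome \<tau>) ^ (m * j) \<le> norm (nome \<tau>) ^ j"
    using nome_bounds[OF \<tau>] by (intro power_decreasing) auto
  then have "norm a ^ m * norm (nome \<tau>) ^ (m * j) / of_nat m \<le> norm a ^ m * norm (nome \<tau>) ^ j / 1"
    using m by (intro frac_le mult_left_mono) auto
  then show "norm (case p of (m, j) \<Rightarrow> a ^ m * nome \<tau> ^ (m * j) / of_nat m)
      \<le> (case p of (m, j) \<Rightarrow> norm a ^ m * norm (nome \<tau>) ^ j)"
    by (simp add: mj norm_mult norm_divide norm_power)
qed

lemma has_sum_neg_Ln:
  fixes x :: complex
  assumes "norm x < 1"
  shows "((\<lambda>m. x ^ m / of_nat m) has_sum (- Ln (1 - x))) {1..}"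
proof -
  have "(\<lambda>m. (-1) ^ Suc m / of_nat m * (- x) ^ m) sums Ln (1 + - x)"
    using assms by (intro Ln_series) simp
  moreover have "(-1) ^ Suc m / of_nat m * (- x) ^ m = - (x ^ m / of_nat m)" for m
    by (cases "even m") simp_all
  ultimately have "(\<lambda>m. - (x ^ m / of_nat m)) sums Ln (1 + - x)" by (simp only:)
  from sums_minus[OF this] have s: "(\<lambda>m. x ^ m / of_nat m) sums (- Ln (1 - x))" by simp
  have "norm (x ^ m / of_nat m) \<le> norm x ^ m" for m
    using divide_left_mono[of 1 "real m" "norm x ^ m"] by (cases "m = 0") (auto simp: norm_divide norm_power)
  then have "summable (\<lambda>m. norm (x ^ m / of_nat m))"
    using assms by (intro summable_comparison_test'[OF summable_geometric[of "norm x"]]) auto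
  from norm_summable_imp_has_sum[OF this s]
  show ?thesis
    by (rule has_sum_cong_neutral[THEN iffD1, rotated -1]) (auto simp: not_le)
qed

lemma qpoch_inf_exp:
  assumes \<tau>: "Im \<tau> > 0" and a: "norm a < 1"
  shows convergent_prod_qpoch: "convergent_prod (\<lambda>j. 1 - a * nome \<tau> ^ j)"
    and qpoch_inf_eq_exp: "qpoch_inf \<tau> a = exp (- log_poch \<tau> a)"
proof -
  let ?q = "nome \<tau>"
  have lt: "norm (a * ?q ^ j) < 1" for j
  proof -
    have "norm ?q ^ j \<le> 1" using nome_bounds[OF \<tau>] by (intro power_le_one) auto
    then show ?thesis using mult_left_le[of "norm ?q ^ j" "norm a"] a
      by (simp add: norm_mult norm_power)
  qed
  have "((\<lambda>(m, j). a ^ m * ?q ^ (m * j) / of_nat m) has_sum log_poch \<tau> a) ({1..} \<times> UNIV)"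
    unfolding log_poch_def by (rule has_sum_infsum[OF log_poch_summable[OF assms]])
  then have "((\<lambda>(j, m). a ^ m * ?q ^ (m * j) / of_nat m) has_sum log_poch \<tau> a) (UNIV \<times> {1..})"
    by (subst (asm) has_sum_swap) (simp add: case_prod_unfold)
  then have "((\<lambda>j. - Ln (1 - a * ?q ^ j)) has_sum log_poch \<tau> a) UNIV"
  proof (rule has_sum_SigmaD)
    show "((\<lambda>m. case (j, m) of (j, m) \<Rightarrow> a ^ m * ?q ^ (m * j) / of_nat m) has_sum - Ln (1 - a * ?q ^ j)) {1..}" for j
      using has_sum_neg_Ln[OF lt[of j]] by (simp add: power_mult_distrib power_mult[symmetric] mult.commute)
  qed
  then have "(\<lambda>j. - Ln (1 - a * ?q ^ j)) sums log_poch \<tau> a" by (rule has_sum_imp_sums)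
  from sums_minus[OF this] have s: "(\<lambda>j. Ln (1 - a * ?q ^ j)) sums (- log_poch \<tau> a)" by simp
  have e: "exp (Ln (1 - a * ?q ^ j)) = 1 - a * ?q ^ j" for j
    using lt[of j] by (intro exp_Ln) auto
  show "convergent_prod (\<lambda>j. 1 - a * ?q ^ j)"
    using convergent_prod_exp[OF sums_summable[OF s]] by (simp add: e)
  show "qpoch_inf \<tau> a = exp (- log_poch \<tau> a)"
    using prodinf_exp[OF sums_summable[OF s]] sums_unique[OF s] by (simp add: e qpoch_inf_def)
qed

lemma qpoch_inf_neq_0:
  assumes "Im \<tau> > 0" "norm a < 1"
  shows "qpoch_inf \<tau> a \<noteq> 0"
  by (simp add: qpoch_inf_eq_exp[OF assms])

lemma qpoch_inf_split:
  assumes "Im \<tau> > 0" "norm a < 1"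
  shows "qpoch_inf \<tau> a = (1 - a) * qpoch_inf \<tau> (a * nome \<tau>)"
proof -
  have "a \<noteq> 1" using assms by auto
  then have "(\<Prod>j. 1 - a * nome \<tau> ^ Suc j) = qpoch_inf \<tau> a / (1 - a)"
    using prodinf_split_head[OF convergent_prod_qpoch[OF assms]] by (simp add: qpoch_inf_def)
  then show ?thesis using \<open>a \<noteq> 1\<close> by (simp add: qpoch_inf_def mult.assoc)
qed

text \<open>The logarithm is a power series in \<open>x\<close>, so that the \<open>N\<close>-th power of the inverse is the exponential of a holomorphic
  function on the disc of radius \<open>1/|q|\<close>.\<close>

lemma inverse_qpoch_power_series:
  assumes \<tau>: "Im \<tau> > 0"
  obtains A :: "nat \<Rightarrow> complex" where
    "\<And>x::complex. norm x * norm (nome \<tau>) < 1 \<Longrightarrow>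
       ((\<lambda>k. A k * x ^ k) has_sum 1 / qpoch_inf \<tau> (x * nome \<tau>) ^ N) UNIV"
proof -
  let ?q = "nome \<tau>"
  define R where "R = 1 / norm ?q"
  have inR: "x \<in> ball 0 R \<longleftrightarrow> norm (x * ?q) < 1" for x :: complex
    using nome_bounds[OF \<tau>] by (simp add: R_def norm_mult field_simps)
  define b where "b = (\<lambda>m. if m = 0 then 0 else \<Sum>\<^sub>\<infinity>j::nat. ?q ^ m * ?q ^ (m * j) / of_nat m)"
  have hol: "(\<lambda>x. log_poch \<tau> (x * ?q)) holomorphic_on ball 0 R"
  proof (rule power_series_holomorphic)
    fix x :: complex assume "x \<in> ball 0 R"
    then have x: "norm (x * ?q) < 1" by (rule inR[THEN iffD1])
    have "((\<lambda>m. b m * x ^ m) has_sum log_poch \<tau> (x * ?q)) {1..}"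
    proof (rule has_sum_SigmaD)
      show "((\<lambda>(m, j). (x * ?q) ^ m * ?q ^ (m * j) / of_nat m) has_sum log_poch \<tau> (x * ?q)) ({1..} \<times> (UNIV :: nat set))"
        unfolding log_poch_def by (rule has_sum_infsum[OF log_poch_summable[OF \<tau> x]])
      fix m :: nat assume "m \<in> {1..}"
      then have m: "m \<ge> 1" by simp
      have "norm (?q ^ m) < 1" using nome_bounds[OF \<tau>] m by (simp add: norm_power power_Suc_less_one power_less_one_iff)
      then have "(\<lambda>j. ?q ^ m * ?q ^ (m * j) / of_nat m) summable_on UNIV"
        unfolding power_mult
        by (intro norm_summable_imp_summable_on) (auto simp: norm_mult norm_divide norm_power intro!: summable_mult summable_divide summable_geometric)
      from has_sum_cmult_right[OF has_sum_infsum[OF this], of "x ^ m"]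
      show "((\<lambda>j. case (m, j) of (m, j) \<Rightarrow> (x * ?q) ^ m * ?q ^ (m * j) / of_nat m) has_sum b m * x ^ m) UNIV"
        using m by (simp add: b_def power_mult_distrib mult_ac)
    qed
    then have "((\<lambda>m. b m * x ^ m) has_sum log_poch \<tau> (x * ?q)) UNIV"
      by (rule has_sum_cong_neutral[THEN iffD1, rotated -1]) (auto simp: not_le b_def)
    then show "(\<lambda>m. b m * (x - 0) ^ m) sums log_poch \<tau> (x * ?q)"
      by (simp add: has_sum_imp_sums)
  qed
  define F where "F = (\<lambda>x. exp (of_nat N * log_poch \<tau> (x * ?q)))"
  have Fhol: "F holomorphic_on ball 0 R" unfolding F_def by (intro holomorphic_intros hol)
  have ps: "(\<lambda>k. (deriv ^^ k) F 0 / fact k * x ^ k) sums F x" if "norm (x * ?q) < 1" for x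
    using holomorphic_power_series[OF Fhol inR[THEN iffD2, OF that]] by simp
  show thesis
  proof (rule that)
    fix x :: complex assume "norm x * norm ?q < 1"
    then have x: "norm x < R" by (simp add: R_def nome_bounds[OF \<tau>] field_simps)
    then obtain r where r: "norm x < r" "r < R" using dense by blast
    have "0 \<le> r" using r(1) norm_ge_zero[of x] by linarith
    then have "norm (of_real r * ?q) < 1"
      using r(2) nome_bounds[OF \<tau>] by (simp add: R_def norm_mult field_simps)
    from sums_summable[OF ps[OF this]]
    have "summable (\<lambda>k. (deriv ^^ k) F 0 / fact k * of_real r ^ k)" .
    then have "summable (\<lambda>k. norm ((deriv ^^ k) F 0 / fact k * x ^ k))"
      by (rule powser_insidea) (use r \<open>0 \<le> r\<close> in auto)
    moreover have xq: "norm (x * ?q) < 1" using \<open>norm x * norm ?q < 1\<close> by (simp add: norm_mult)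
    ultimately have "((\<lambda>k. (deriv ^^ k) F 0 / fact k * x ^ k) has_sum F x) UNIV"
      by (intro norm_summable_imp_has_sum ps)
    moreover have "F x = 1 / qpoch_inf \<tau> (x * ?q) ^ N"
      by (simp add: F_def qpoch_inf_eq_exp[OF \<tau> xq] exp_minus exp_of_nat_mult power_inverse divide_inverse)
    ultimately show "((\<lambda>k. (deriv ^^ k) F 0 / fact k * x ^ k) has_sum 1 / qpoch_inf \<tau> (x * ?q) ^ N) UNIV"
      by simp
  qed
qed

text \<open>With the factor \<open>(1 - \<zeta>)\<^sup>-\<^sup>N\<close> removed, the function is a product of a power series in \<open>\<zeta>\<close> and one in
  \<open>1/\<zeta>\<close>, both convergent across the unit circle.\<close>

lemma regular_part_laurent:
  assumes \<tau>: "Im \<tau> > 0"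
  obtains h :: "int \<Rightarrow> complex" where
    "\<And>\<zeta>::complex. norm (nome \<tau>) < norm \<zeta> \<Longrightarrow> norm \<zeta> * norm (nome \<tau>) < 1 \<Longrightarrow>
       ((\<lambda>k. h k * \<zeta> powi k) has_sum
          1 / (qpoch_inf \<tau> (\<zeta> * nome \<tau>) * qpoch_inf \<tau> (nome \<tau> / \<zeta>)) ^ N) UNIV"
proof -
  let ?q = "nome \<tau>"
  obtain A where A: "\<And>x :: complex. norm x * norm ?q < 1 \<Longrightarrow>
       ((\<lambda>k. A k * x ^ k) has_sum 1 / qpoch_inf \<tau> (x * ?q) ^ N) UNIV"
    using inverse_qpoch_power_series[OF \<tau>, of N] by blast
  define a where "a = (\<lambda>k::int. if k \<ge> 0 then A (nat k) else 0)"
  define b where "b = (\<lambda>k::int. if k \<le> 0 then A (nat (- k)) else 0)"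
  show thesis
  proof (rule that)
    fix \<zeta> :: complex assume z: "norm ?q < norm \<zeta>" "norm \<zeta> * norm ?q < 1"
    then have z0: "\<zeta> \<noteq> 0" by auto
    have "((\<lambda>k. a k * \<zeta> powi k) has_sum 1 / qpoch_inf \<tau> (\<zeta> * ?q) ^ N) (range int)"
      by (subst has_sum_reindex) (use A[OF z(2)] in \<open>auto simp: o_def a_def\<close>)
    then have a: "((\<lambda>k. a k * \<zeta> powi k) has_sum 1 / qpoch_inf \<tau> (\<zeta> * ?q) ^ N) UNIV"
      by (rule has_sum_cong_neutral[THEN iffD1, rotated -1])
         (auto simp: a_def image_iff dest: zero_le_imp_eq_int)
    have "norm (1 / \<zeta>) * norm ?q < 1" using z z0 by (simp add: norm_divide field_simps)
    note A' = A[OF this]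
    have "((\<lambda>k. b k * \<zeta> powi k) has_sum 1 / qpoch_inf \<tau> (1 / \<zeta> * ?q) ^ N) (range (\<lambda>k. - int k))"
      by (subst has_sum_reindex)
         (use A' in \<open>auto simp: o_def b_def power_int_minus inj_on_def power_one_over divide_inverse power_inverse\<close>)
    then have b: "((\<lambda>k. b k * \<zeta> powi k) has_sum 1 / qpoch_inf \<tau> (1 / \<zeta> * ?q) ^ N) UNIV"
    proof (rule has_sum_cong_neutral[THEN iffD1, rotated -1])
      fix k :: int assume "k \<in> UNIV - range (\<lambda>k. - int k)"
      then have "k > 0" by (cases k rule: int_cases2) auto
      then show "b k * \<zeta> powi k = 0" by (simp add: b_def)
    qed auto
    show "((\<lambda>k. (\<Sum>\<^sub>\<infinity>i. a i * b (k - i)) * \<zeta> powi k) has_sum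
          1 / (qpoch_inf \<tau> (\<zeta> * ?q) * qpoch_inf \<tau> (?q / \<zeta>)) ^ N) UNIV"
      using laurent_mult_has_sum[OF z0 a b] by (simp add: power_mult_distrib)
  qed
qed

section \<open>The two Laurent expansions around the pole\<close>

text \<open>The coefficient of \<open>x\<^sup>y\<close> in \<open>(1 - x)\<^sup>-\<^sup>n\<^sup>-\<^sup>1\<close>, continued to a polynomial in \<open>y\<close>. The same polynomial,
  with the opposite sign, gives the coefficients at negative exponents of the expansion for \<open>|x| > 1\<close>.\<close>

definition pole_poly :: "nat \<Rightarrow> complex \<Rightarrow> complex" where
  "pole_poly n y = (y + of_nat n) gchoose n"

lemma pole_poly_of_nat: "pole_poly n (of_nat k) = of_nat ((k + n) choose k)"
  using binomial_symmetric[of k "k + n"]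
  by (simp add: pole_poly_def binomial_gbinomial flip: of_nat_add)

lemma pole_poly_eq_0:
  assumes "k < 0" "- int n \<le> k"
  shows "pole_poly n (of_int k) = 0"
proof -
  obtain m where m: "k + int n = int m" using assms zero_le_imp_eq_int[of "k + int n"] by auto
  with assms have "m < n" by linarith
  have "(of_int k + of_nat n :: complex) = of_int (k + int n)" by simp
  then have "(of_int k + of_nat n :: complex) = of_nat m" unfolding m by simp
  then show ?thesis using \<open>m < n\<close> by (simp add: pole_poly_def flip: binomial_gbinomial)
qed

lemma pole_poly_reflect:
  "pole_poly n (- of_nat (Suc n) - of_nat k) = (-1) ^ n * pole_poly n (of_nat k)"
proof -
  have *: "- of_nat (Suc n) - of_nat k + of_nat n = - (of_nat (Suc k) :: complex)" by simp
  show ?thesis unfolding pole_poly_def * gbinomial_minus by (simp add: add_ac)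
qed

lemma has_sum_pole_poly:
  fixes x :: complex
  assumes "norm x < 1"
  shows "((\<lambda>k. pole_poly n (of_nat k) * x ^ k) has_sum 1 / (1 - x) ^ Suc n) UNIV"
proof (rule norm_summable_imp_has_sum)
  have eq: "(- of_nat (Suc n) gchoose k) * (- y) ^ k = pole_poly n (of_nat k) * y ^ k" for k and y :: complex
  proof -
    have "(- of_nat (Suc n) gchoose k :: complex) = (-1) ^ k * (of_nat (Suc n) + of_nat k - 1 gchoose k)"
      by (rule gbinomial_minus)
    also have "of_nat (Suc n) + of_nat k - (1::complex) = of_nat (k + n)" by simp
    finally show ?thesis
      by (cases "even k") (simp_all add: pole_poly_of_nat binomial_gbinomial)
  qed
  have gen: "(\<lambda>k. pole_poly n (of_nat k) * y ^ k) sums (1 / (1 - y) ^ Suc n)" if "norm y < 1" for y :: complex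
  proof -
    have "y \<noteq> 1" using that by auto
    have "(\<lambda>k. (- of_nat (Suc n) gchoose k) * (- y) ^ k) sums (1 + (- y)) powr (- of_nat (Suc n))"
      by (rule gen_binomial_complex) (use that in simp)
    moreover have "(1 + (- y)) powr (- of_nat (Suc n)) = 1 / (1 - y) ^ Suc n"
      using \<open>y \<noteq> 1\<close> unfolding powr_minus by (subst powr_nat) (auto simp: divide_inverse)
    ultimately show ?thesis by (simp only: eq)
  qed
  show "(\<lambda>k. pole_poly n (of_nat k) * x ^ k) sums (1 / (1 - x) ^ Suc n)"
    by (rule gen[OF assms])
  have "summable (\<lambda>k. pole_poly n (of_nat k) * of_real (norm x) ^ k)"
    using assms by (intro sums_summable[OF gen]) simp
  moreover have "pole_poly n (of_nat k) * of_real (norm x) ^ k = of_real (norm (pole_poly n (of_nat k) * x ^ k))" for k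
    by (simp add: pole_poly_of_nat norm_mult norm_power)
  ultimately show "summable (\<lambda>k. norm (pole_poly n (of_nat k) * x ^ k))"
    by (simp only: summable_complex_of_real)
qed

lemma has_sum_pole_inner:
  fixes \<zeta> :: complex
  assumes "norm \<zeta> < 1"
  shows "((\<lambda>k. (if k \<ge> 0 then pole_poly n (of_int k) else 0) * \<zeta> powi k) has_sum 1 / (1 - \<zeta>) ^ Suc n) UNIV"
proof -
  have "((\<lambda>k. (if k \<ge> 0 then pole_poly n (of_int k) else 0) * \<zeta> powi k) has_sum 1 / (1 - \<zeta>) ^ Suc n) (range int)"
    by (subst has_sum_reindex) (use has_sum_pole_poly[OF assms] in \<open>auto simp: o_def\<close>)
  then show ?thesis
    by (rule has_sum_cong_neutral[THEN iffD1, rotated -1])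
       (auto simp: image_iff dest: zero_le_imp_eq_int)
qed

lemma has_sum_pole_outer:
  fixes \<zeta> :: complex
  assumes "norm \<zeta> > 1"
  shows "((\<lambda>k. (if k < 0 then - pole_poly n (of_int k) else 0) * \<zeta> powi k) has_sum 1 / (1 - \<zeta>) ^ Suc n) UNIV"
proof -
  have z: "\<zeta> \<noteq> 0" "\<zeta> \<noteq> 1" "norm (1 / \<zeta>) < 1"
    using assms by (auto simp: norm_divide divide_less_eq)
  define g where "g = (\<lambda>k::int. (if k < 0 then - pole_poly n (of_int k) else 0) * \<zeta> powi k)"
  have "(g has_sum 1 / (1 - \<zeta>) ^ Suc n) (range (\<lambda>k. - int (Suc n) - int k))"
  proof (subst has_sum_reindex)
    have "((\<lambda>k. pole_poly n (of_nat k) * (1 / \<zeta>) ^ k * ((-1) ^ Suc n * \<zeta> powi (- int (Suc n))))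
        has_sum 1 / (1 - 1 / \<zeta>) ^ Suc n * ((-1) ^ Suc n * \<zeta> powi (- int (Suc n)))) UNIV"
      by (intro has_sum_cmult_left has_sum_pole_poly z)
    also have "1 / (1 - 1 / \<zeta>) ^ Suc n * ((-1) ^ Suc n * \<zeta> powi (- int (Suc n)))
        = 1 / ((1 - 1 / \<zeta>) ^ Suc n * (-1) ^ Suc n * \<zeta> ^ Suc n)"
      unfolding power_int_minus power_int_of_nat by (simp add: divide_simps)
    also have "(1 - 1 / \<zeta>) ^ Suc n * (-1) ^ Suc n * \<zeta> ^ Suc n = ((1 - 1 / \<zeta>) * (-1) * \<zeta>) ^ Suc n"
      by (simp only: power_mult_distrib)
    also have "(1 - 1 / \<zeta>) * (-1) * \<zeta> = 1 - \<zeta>" using z by (simp add: field_simps)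
    finally have *: "((\<lambda>k. pole_poly n (of_nat k) * (1 / \<zeta>) ^ k * ((-1) ^ Suc n * \<zeta> powi (- int (Suc n))))
        has_sum 1 / (1 - \<zeta>) ^ Suc n) UNIV" .
    have "(g \<circ> (\<lambda>k. - int (Suc n) - int k)) k
        = pole_poly n (of_nat k) * (1 / \<zeta>) ^ k * ((-1) ^ Suc n * \<zeta> powi (- int (Suc n)))" for k
    proof -
      have "\<zeta> powi (- int (Suc n) - int k) = \<zeta> powi (- int (Suc n)) * (1 / \<zeta>) ^ k"
        using z by (simp add: power_int_diff power_one_over divide_inverse power_inverse)
      then show ?thesis
        using pole_poly_reflect[of n k] by (simp add: g_def)
    qed
    then have "g \<circ> (\<lambda>k. - int (Suc n) - int k)
        = (\<lambda>k. pole_poly n (of_nat k) * (1 / \<zeta>) ^ k * ((-1) ^ Suc n * \<zeta> powi (- int (Suc n))))" ..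
    then show "((g \<circ> (\<lambda>k. - int (Suc n) - int k)) has_sum 1 / (1 - \<zeta>) ^ Suc n) UNIV"
      using * by (simp only:)
  qed (auto simp: inj_on_def)
  then show ?thesis unfolding g_def[symmetric]
  proof (rule has_sum_cong_neutral[THEN iffD1, rotated -1])
    fix k assume k: "k \<in> UNIV - range (\<lambda>k. - int (Suc n) - int k)"
    show "g k = 0"
    proof (cases "k < - int n")
      case True
      then obtain j where "- int (Suc n) - k = int j" using zero_le_imp_eq_int[of "- int (Suc n) - k"] by auto
      then have "k = - int (Suc n) - int j" by linarith
      with k show ?thesis by blast
    next
      case False
      then show ?thesis by (auto simp: g_def pole_poly_eq_0)
    qed
  qed auto
qed

text \<open>Multiplying the expansion \<open>h\<close> of the regular part by the two expansions of \<open>(1 - \<zeta>)\<^sup>-\<^sup>N\<close> gives the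
  expansions of the function on both sides of the pole. As the two differ by the polynomial
  \<open>pole_poly\<close>, so do the coefficients after convolution with \<open>h\<close>. The substitution \<open>\<zeta> \<mapsto> q \<zeta>\<close> maps the outer
  annulus to the inner one and, by uniqueness, identifies the outer coefficients.\<close>

lemma annulus_expansion:
  assumes \<tau>: "Im \<tau> > 0"
  obtains h c :: "int \<Rightarrow> complex" where
    "\<And>\<zeta>::complex. norm (nome \<tau>) < norm \<zeta> \<Longrightarrow> norm \<zeta> * norm (nome \<tau>) < 1 \<Longrightarrow>
       ((\<lambda>k. h k * \<zeta> powi k) has_sum
          1 / (qpoch_inf \<tau> (\<zeta> * nome \<tau>) * qpoch_inf \<tau> (nome \<tau> / \<zeta>)) ^ Suc n) UNIV"
    and "\<And>\<zeta>::complex. norm (nome \<tau>) < norm \<zeta> \<Longrightarrow> norm \<zeta> < 1 \<Longrightarrow>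
       ((\<lambda>k. c k * \<zeta> powi k) has_sum
          1 / (qpoch_inf \<tau> \<zeta> * qpoch_inf \<tau> (nome \<tau> / \<zeta>)) ^ Suc n) UNIV"
    and "\<And>s. ((\<lambda>k. h k * pole_poly n (of_int (s - k))) has_sum
       c s - (-1) ^ Suc n * nome \<tau> powi (s + int (Suc n)) * c (s + int (Suc n))) UNIV"
proof -
  let ?q = "nome \<tau>" and ?N = "Suc n"
  note q = nome_bounds[OF \<tau>]
  let ?H = "\<lambda>\<zeta>. 1 / (qpoch_inf \<tau> (\<zeta> * ?q) * qpoch_inf \<tau> (?q / \<zeta>)) ^ ?N"
  obtain h where h: "\<And>\<zeta>::complex. norm ?q < norm \<zeta> \<Longrightarrow> norm \<zeta> * norm ?q < 1 \<Longrightarrow>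
       ((\<lambda>k. h k * \<zeta> powi k) has_sum ?H \<zeta>) UNIV"
    using regular_part_laurent[OF \<tau>, of ?N] by blast
  define p1 where "p1 = (\<lambda>k::int. if k \<ge> 0 then pole_poly n (of_int k) else 0)"
  define p2 where "p2 = (\<lambda>k::int. if k < 0 then - pole_poly n (of_int k) else 0)"
  define c where "c = (\<lambda>s. \<Sum>\<^sub>\<infinity>k. h k * p1 (s - k))"
  define c' where "c' = (\<lambda>s. \<Sum>\<^sub>\<infinity>k. h k * p2 (s - k))"
  have in1: "((\<lambda>s. c s * \<zeta> powi s) has_sum ?H \<zeta> * (1 / (1 - \<zeta>) ^ ?N)) UNIV"
    and in2: "\<And>s. (\<lambda>k. h k * p1 (s - k)) summable_on UNIV" if z: "norm ?q < norm \<zeta>" "norm \<zeta> < 1" for \<zeta>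
  proof -
    have z0: "\<zeta> \<noteq> 0" using z q by auto
    have "norm \<zeta> * norm ?q < 1" using mult_strict_mono[of "norm \<zeta>" 1 "norm ?q" 1] z q by auto
    note hz = h[OF z(1) this]
    have "((\<lambda>k. p1 k * \<zeta> powi k) has_sum 1 / (1 - \<zeta>) ^ ?N) UNIV"
      unfolding p1_def by (rule has_sum_pole_inner[OF z(2)])
    note L = laurent_mult[OF z0 hz this]
    show "((\<lambda>s. c s * \<zeta> powi s) has_sum ?H \<zeta> * (1 / (1 - \<zeta>) ^ ?N)) UNIV"
      unfolding c_def by (rule L)
    show "\<And>s. (\<lambda>k. h k * p1 (s - k)) summable_on UNIV" by (rule L)
  qed
  have out1: "((\<lambda>s. c' s * \<zeta> powi s) has_sum ?H \<zeta> * (1 / (1 - \<zeta>) ^ ?N)) UNIV"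
    and out2: "\<And>s. (\<lambda>k. h k * p2 (s - k)) summable_on UNIV" if z: "norm \<zeta> > 1" "norm \<zeta> * norm ?q < 1" for \<zeta>
  proof -
    have z0: "\<zeta> \<noteq> 0" using z q by auto
    have "norm ?q < norm \<zeta>" using z q by linarith
    note hz = h[OF this z(2)]
    have "((\<lambda>k. p2 k * \<zeta> powi k) has_sum 1 / (1 - \<zeta>) ^ ?N) UNIV"
      unfolding p2_def by (rule has_sum_pole_outer[OF z(1)])
    note L = laurent_mult[OF z0 hz this]
    show "((\<lambda>s. c' s * \<zeta> powi s) has_sum ?H \<zeta> * (1 / (1 - \<zeta>) ^ ?N)) UNIV"
      unfolding c'_def by (rule L)
    show "\<And>s. (\<lambda>k. h k * p2 (s - k)) summable_on UNIV" by (rule L)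
  qed
  obtain \<rho> where \<rho>: "norm ?q < \<rho>" "\<rho> < 1" using dense q by blast
  have "\<rho> > 0" using q(3) \<rho>(1) by (rule less_trans)
  have s1: "(\<lambda>k. h k * p1 (s - k)) summable_on UNIV" for s
    using in2[of "of_real \<rho>"] \<rho> \<open>\<rho> > 0\<close> by simp
  \<comment> \<open>The circle of radius \<open>\<sigma>\<close> lies outside the pole and is mapped to the circle of radius \<open>\<rho>\<close> by
      multiplication with \<open>q\<close>.\<close>
  define \<sigma> where "\<sigma> = \<rho> / norm ?q"
  have \<sigma>: "\<sigma> > 1" "\<sigma> * norm ?q < 1" "\<sigma> > 0" using \<rho> q \<open>\<rho> > 0\<close> by (auto simp: \<sigma>_def field_simps)
  have s2: "(\<lambda>k. h k * p2 (s - k)) summable_on UNIV" for s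
    using out2[of "of_real \<sigma>"] \<sigma> by simp
  have diff: "((\<lambda>k. h k * pole_poly n (of_int (s - k))) has_sum c s - c' s) UNIV" for s
  proof -
    have "((\<lambda>k. h k * p1 (s - k) - h k * p2 (s - k)) has_sum c s - c' s) UNIV"
      unfolding c_def c'_def by (intro has_sum_diff has_sum_infsum s1 s2)
    also have "(\<lambda>k. h k * p1 (s - k) - h k * p2 (s - k)) = (\<lambda>k. h k * pole_poly n (of_int (s - k)))"
      by (rule ext) (simp add: p1_def p2_def)
    finally show ?thesis .
  qed
  have fe: "c' = (\<lambda>s. (-1) ^ ?N * ?q powi (s + int ?N) * c (s + int ?N))"
  proof (rule laurent_unique[OF \<open>\<sigma> > 0\<close>])
    fix \<zeta> :: complex assume nz: "norm \<zeta> = \<sigma>"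
    then have z: "norm \<zeta> > 1" "norm \<zeta> * norm ?q < 1" "\<zeta> \<noteq> 0" using \<sigma> by auto
    show "((\<lambda>s. c' s * \<zeta> powi s) has_sum ?H \<zeta> * (1 / (1 - \<zeta>) ^ ?N)) UNIV"
      by (rule out1) (use z in auto)
    have nq: "norm (\<zeta> * ?q) = \<rho>" using nz q by (simp add: norm_mult \<sigma>_def)
    define K where "K = (-1) ^ ?N / \<zeta> ^ ?N"
    have "((\<lambda>s. K * (c s * (\<zeta> * ?q) powi s)) has_sum K * (?H (\<zeta> * ?q) * (1 / (1 - \<zeta> * ?q) ^ ?N))) UNIV"
      by (intro has_sum_cmult_right in1) (use nq \<rho> in auto)
    also have "?this \<longleftrightarrow> ((\<lambda>s. (-1) ^ ?N * ?q powi (s + int ?N) * c (s + int ?N) * \<zeta> powi s) has_sum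
        K * (?H (\<zeta> * ?q) * (1 / (1 - \<zeta> * ?q) ^ ?N))) UNIV"
    proof (rule has_sum_reindex_bij_witness[of _ "\<lambda>s. s + int ?N" "\<lambda>s. s - int ?N"])
      fix s :: int
      have "\<zeta> powi (s - int ?N) = \<zeta> powi s / \<zeta> ^ ?N"
        using z power_int_diff[of \<zeta> s "int ?N"] power_int_of_nat[of \<zeta> ?N]
        by (simp del: of_nat_Suc power_Suc)
      then show "(-1) ^ ?N * ?q powi (s - int ?N + int ?N) * c (s - int ?N + int ?N) * \<zeta> powi (s - int ?N)
          = K * (c s * (\<zeta> * ?q) powi s)"
        by (simp add: K_def power_int_mult_distrib mult_ac)
    qed auto
    also have "K * (?H (\<zeta> * ?q) * (1 / (1 - \<zeta> * ?q) ^ ?N)) = ?H \<zeta> * (1 / (1 - \<zeta>) ^ ?N)"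
    proof -
      have 1: "qpoch_inf \<tau> (\<zeta> * ?q) = (1 - \<zeta> * ?q) * qpoch_inf \<tau> (\<zeta> * ?q * ?q)"
        by (rule qpoch_inf_split[OF \<tau>]) (use nq \<rho> in simp)
      have "qpoch_inf \<tau> (1 / \<zeta>) = (1 - 1 / \<zeta>) * qpoch_inf \<tau> (1 / \<zeta> * ?q)"
        by (rule qpoch_inf_split[OF \<tau>]) (use z in \<open>simp add: norm_divide divide_less_eq\<close>)
      then have 2: "qpoch_inf \<tau> (?q / (\<zeta> * ?q)) = (1 - 1 / \<zeta>) * qpoch_inf \<tau> (?q / \<zeta>)"
        using q z by simp
      have nz: "1 - \<zeta> * ?q \<noteq> 0" using nq \<rho> by auto
      have 3: "- (\<zeta> * (1 - 1 / \<zeta>)) = 1 - \<zeta>" using z by (simp add: field_simps)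
      have m1: "(-1) ^ ?N = (1 :: complex) / (-1) ^ ?N" by (simp add: minus_one_power_iff)
      have "K * (?H (\<zeta> * ?q) * (1 / (1 - \<zeta> * ?q) ^ ?N))
          = 1 / ((-1) * \<zeta> * (qpoch_inf \<tau> (\<zeta> * ?q * ?q) * ((1 - 1 / \<zeta>) * qpoch_inf \<tau> (?q / \<zeta>))) * (1 - \<zeta> * ?q)) ^ ?N"
        unfolding K_def 2 by (subst m1)
          (simp only: power_mult_distrib times_divide_times_eq divide_divide_eq_left mult_1_left mult_1_right mult.assoc)
      also have "(-1) * \<zeta> * (qpoch_inf \<tau> (\<zeta> * ?q * ?q) * ((1 - 1 / \<zeta>) * qpoch_inf \<tau> (?q / \<zeta>))) * (1 - \<zeta> * ?q)
          = (- (\<zeta> * (1 - 1 / \<zeta>))) * (((1 - \<zeta> * ?q) * qpoch_inf \<tau> (\<zeta> * ?q * ?q)) * qpoch_inf \<tau> (?q / \<zeta>))"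
        by (simp add: mult_ac)
      also have "\<dots> = (1 - \<zeta>) * (qpoch_inf \<tau> (\<zeta> * ?q) * qpoch_inf \<tau> (?q / \<zeta>))"
        unfolding 3 1[symmetric] ..
      also have "1 / \<dots> ^ ?N = ?H \<zeta> * (1 / (1 - \<zeta>) ^ ?N)"
        by (simp only: power_mult_distrib times_divide_times_eq mult_1_left mult_1_right mult.commute)
      finally show ?thesis .
    qed
    finally show "((\<lambda>s. (-1) ^ ?N * ?q powi (s + int ?N) * c (s + int ?N) * \<zeta> powi s) has_sum
        ?H \<zeta> * (1 / (1 - \<zeta>) ^ ?N)) UNIV" .
  qed
  show thesis
  proof (rule that[of h c])
    fix \<zeta> :: complex assume z: "norm ?q < norm \<zeta>" "norm \<zeta> < 1"
    have "?H \<zeta> * (1 / (1 - \<zeta>) ^ ?N) = 1 / (qpoch_inf \<tau> \<zeta> * qpoch_inf \<tau> (?q / \<zeta>)) ^ ?N"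
      unfolding qpoch_inf_split[OF \<tau> z(2)]
      by (simp only: power_mult_distrib times_divide_times_eq mult_1_left mult_1_right mult_ac)
    with in1[OF z] show "((\<lambda>k. c k * \<zeta> powi k) has_sum 1 / (qpoch_inf \<tau> \<zeta> * qpoch_inf \<tau> (?q / \<zeta>)) ^ ?N) UNIV"
      by (simp only:)
  next
    fix s
    show "((\<lambda>k. h k * pole_poly n (of_int (s - k))) has_sum
       c s - (-1) ^ ?N * ?q powi (s + int ?N) * c (s + int ?N)) UNIV"
      using diff[of s] by (simp only: fe)
  qed (rule h)
qed

lemma laurent_coeff_growth:
  fixes c :: "int \<Rightarrow> complex"
  assumes "\<zeta> \<noteq> 0" "(\<lambda>k. c k * \<zeta> powi k) summable_on UNIV"
  obtains B C where "\<And>k. norm (c k) \<le> B * exp (C * of_int \<bar>k\<bar>)" "B \<ge> 0" "C \<ge> 0"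
proof
  define B where "B = (\<Sum>\<^sub>\<infinity>k. norm (c k * \<zeta> powi k))"
  define l where "l = ln (norm \<zeta>)"
  have nz: "norm \<zeta> = exp l" using assms(1) by (simp add: l_def)
  show "B \<ge> 0" unfolding B_def by (intro infsum_nonneg) auto
  fix k
  have "norm (c k * \<zeta> powi k) \<le> B"
    unfolding B_def using finite_sum_le_infsum[of "\<lambda>k. norm (c k * \<zeta> powi k)" UNIV "{k}"]
      summable_on_normD[OF assms(2)] by simp
  then have "norm (c k) * exp (of_int k * l) \<le> B"
    by (simp add: norm_mult norm_power_int nz exp_power_int)
  then have "norm (c k) \<le> B * exp (- (of_int k * l))"
    by (simp add: exp_minus field_simps)
  also have "- (of_int k * l) \<le> \<bar>l\<bar> * of_int \<bar>k\<bar>"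
    by (metis abs_ge_minus_self abs_mult mult.commute of_int_abs)
  then have "B * exp (- (of_int k * l)) \<le> B * exp (\<bar>l\<bar> * of_int \<bar>k\<bar>)"
    using \<open>B \<ge> 0\<close> by (intro mult_left_mono) auto
  finally show "norm (c k) \<le> B * exp (\<bar>l\<bar> * of_int \<bar>k\<bar>)" .
qed simp

text \<open>After multiplication by the Gaussian factor, the recursion says that the terms are differences
  \<open>y j - y (j + 1)\<close> of one summable sequence.\<close>

lemma telescoping_theta_sum:
  fixes c Q :: "int \<Rightarrow> complex" and N :: nat and s :: int
  assumes \<tau>: "Im \<tau> > 0" and N: "N > 0"
    and growth: "\<And>k. norm (c k) \<le> B * exp (C * of_int \<bar>k\<bar>)" "B \<ge> 0" "C \<ge> 0"
    and rec: "\<And>s. Q s = c s - (-1) ^ N * nome \<tau> powi (s + int N) * c (s + int N)"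
  defines "r \<equiv> of_int s + real N / 2"
  defines "f \<equiv> \<lambda>j::int. ((-1) ^ N) powi j * qpow \<tau> ((r + real N * of_int j)\<^sup>2 / (2 * real N)) * Q (s + int N * j)"
  shows "(f has_sum 0) UNIV" "(f has_sum qpow \<tau> (r\<^sup>2 / (2 * real N)) * c s) {0..}"
proof -
  define y where "y = (\<lambda>j::int. ((-1) ^ N) powi j * qpow \<tau> ((r + real N * of_int j)\<^sup>2 / (2 * real N)) * c (s + int N * j))"
  have f: "f j = y j - y (j + 1)" for j
  proof -
    have e: "(r + real N * of_int (j + 1))\<^sup>2 / (2 * real N)
        = (r + real N * of_int j)\<^sup>2 / (2 * real N) + of_int (s + int N * j + int N)"
      using N unfolding r_def by (simp add: field_simps power2_eq_square)
    have p: "((-1) ^ N :: complex) powi (j + 1) = ((-1) ^ N) powi j * (-1) ^ N"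
      by (simp add: power_int_add)
    have ix: "s + int N * (j + 1) = s + int N * j + int N" by (simp add: algebra_simps)
    show ?thesis
      unfolding f_def y_def rec e p ix qpow_add qpow_powi by (simp add: algebra_simps)
  qed
  have ysum: "y summable_on UNIV"
  proof (rule norm_summable_onI)
    define D where "D = 2 * pi * Im \<tau> * \<bar>r\<bar> + C * real N"
    define a where "a = pi * Im \<tau> * real N"
    show "(\<lambda>j. B * exp (C * of_int \<bar>s\<bar>) * exp (D * of_int \<bar>j\<bar> - a * (of_int j)\<^sup>2)) summable_on UNIV"
      by (intro summable_on_cmult_right summable_on_gauss_int) (use \<tau> N in \<open>simp add: a_def\<close>)
    fix j :: int
    have "(r + real N * of_int j)\<^sup>2 / (2 * real N) = r\<^sup>2 / (2 * real N) + r * of_int j + real N / 2 * (of_int j)\<^sup>2"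
      using N by (simp add: field_simps power2_eq_square)
    moreover have "- (r * of_int j) \<le> \<bar>r\<bar> * \<bar>of_int j\<bar>" by (metis abs_ge_minus_self abs_mult)
    moreover have "r\<^sup>2 / (2 * real N) \<ge> 0" by simp
    ultimately have 1: "real N / 2 * (of_int j)\<^sup>2 - \<bar>r\<bar> * \<bar>of_int j\<bar> \<le> (r + real N * of_int j)\<^sup>2 / (2 * real N)"
      by linarith
    have "norm (qpow \<tau> ((r + real N * of_int j)\<^sup>2 / (2 * real N)))
        \<le> exp (- (2 * pi * Im \<tau> * (real N / 2 * (of_int j)\<^sup>2 - \<bar>r\<bar> * \<bar>of_int j\<bar>)))"
      unfolding norm_qpow using mult_left_mono[OF 1, of "2 * pi * Im \<tau>"] \<tau> by simp
    also have "\<dots> = exp (2 * pi * Im \<tau> * \<bar>r\<bar> * of_int \<bar>j\<bar> - a * (of_int j)\<^sup>2)"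
      by (simp add: a_def algebra_simps)
    finally have 2: "norm (qpow \<tau> ((r + real N * of_int j)\<^sup>2 / (2 * real N))) \<le> \<dots>" .
    have "\<bar>s + int N * j\<bar> \<le> \<bar>s\<bar> + int N * \<bar>j\<bar>"
      using abs_triangle_ineq[of s "int N * j"] by (simp add: abs_mult)
    then have "real_of_int \<bar>s + int N * j\<bar> \<le> of_int (\<bar>s\<bar> + int N * \<bar>j\<bar>)" by (simp only: of_int_le_iff)
    then have "C * of_int \<bar>s + int N * j\<bar> \<le> C * (of_int \<bar>s\<bar> + real N * of_int \<bar>j\<bar>)"
      using growth(3) by (intro mult_left_mono) auto
    then have "B * exp (C * of_int \<bar>s + int N * j\<bar>) \<le> B * exp (C * (of_int \<bar>s\<bar> + real N * of_int \<bar>j\<bar>))"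
      using growth(2) by (intro mult_left_mono) auto
    with growth(1)[of "s + int N * j"]
    have 3: "norm (c (s + int N * j)) \<le> B * exp (C * (of_int \<bar>s\<bar> + real N * of_int \<bar>j\<bar>))" by linarith
    have "norm (((-1) ^ N :: complex) powi j) = 1" by (simp add: norm_power_int norm_power)
    then have "norm (y j) = norm (qpow \<tau> ((r + real N * of_int j)\<^sup>2 / (2 * real N))) * norm (c (s + int N * j))"
      by (simp add: y_def norm_mult)
    also have "\<dots> \<le> exp (2 * pi * Im \<tau> * \<bar>r\<bar> * of_int \<bar>j\<bar> - a * (of_int j)\<^sup>2) * (B * exp (C * (of_int \<bar>s\<bar> + real N * of_int \<bar>j\<bar>)))"
      by (intro mult_mono 2 3) auto
    also have "\<dots> = B * exp (C * of_int \<bar>s\<bar>) * exp (D * of_int \<bar>j\<bar> - a * (of_int j)\<^sup>2)"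
      by (simp add: D_def algebra_simps flip: exp_add)
    finally show "norm (y j) \<le> B * exp (C * of_int \<bar>s\<bar>) * exp (D * of_int \<bar>j\<bar> - a * (of_int j)\<^sup>2)" .
  qed
  have f': "f = (\<lambda>j. y j - y (j + 1))" using f by blast
  have 1: "(y has_sum infsum y UNIV) UNIV" using ysum by (rule has_sum_infsum)
  then have 2: "((\<lambda>j. y (j + 1)) has_sum infsum y UNIV) UNIV"
    by (rule has_sum_reindex_bij_witness[of _ "\<lambda>j. j + 1" "\<lambda>j. j - 1", THEN iffD1, rotated -1]) auto
  show "(f has_sum 0) UNIV" unfolding f' using has_sum_diff[OF 1 2] by simp
  have s0: "y summable_on {0..}" using ysum by (rule summable_on_subset) auto
  have 1: "(y has_sum infsum y {0..}) {0..}" using s0 by (rule has_sum_infsum)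
  from has_sum_Diff[OF this has_sum_finite[of "{0}" y]]
  have "(y has_sum infsum y {0..} - y 0) ({0..} - {0})" by simp
  then have 2: "((\<lambda>j. y (j + 1)) has_sum infsum y {0..} - y 0) {0..}"
    by (rule has_sum_reindex_bij_witness[of _ "\<lambda>j. j + 1" "\<lambda>j. j - 1", THEN iffD1, rotated -1]) auto
  show "(f has_sum qpow \<tau> (r\<^sup>2 / (2 * real N)) * c s) {0..}"
    unfolding f' using has_sum_diff[OF 1 2] by (simp add: y_def)
qed

section \<open>Polynomials\<close>

lemma coeff_linear_mult:
  fixes P :: "'a :: comm_ring_1 poly"
  shows "coeff ([:- a, 1:] * P) (Suc k) = coeff P k - a * coeff P (Suc k)"
  by (simp add: mult_pCons_left)

text \<open>The third coefficient from the top is the one compared later; the second one is carried along for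
  the induction.\<close>

lemma prod_linear_coeffs:
  fixes a :: "'i \<Rightarrow> 'a :: field_char_0"
  assumes "finite I"
  defines "P \<equiv> \<lambda>I. \<Prod>i\<in>I. [:- a i, 1:]"
  shows degree_prod_linear: "degree (P I) \<le> card I"
    and coeff_prod_linear_top: "coeff (P I) (card I) = 1"
    and coeff_prod_linear_2: "card I = Suc (Suc e) \<Longrightarrow>
        coeff (P I) e = ((\<Sum>i\<in>I. a i)\<^sup>2 - (\<Sum>i\<in>I. (a i)\<^sup>2)) / 2"
proof -
  have "degree (P I) \<le> card I \<and> coeff (P I) (card I) = 1
      \<and> (\<forall>d. card I = Suc d \<longrightarrow> coeff (P I) d = - (\<Sum>i\<in>I. a i))
      \<and> (\<forall>e. card I = Suc (Suc e) \<longrightarrow> coeff (P I) e = ((\<Sum>i\<in>I. a i)\<^sup>2 - (\<Sum>i\<in>I. (a i)\<^sup>2)) / 2)"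
    using assms(1)
  proof (induction I)
    case empty
    show ?case by (simp add: P_def)
  next
    case (insert i I)
    have P: "P (insert i I) = [:- a i, 1:] * P I" using insert.hyps by (simp add: P_def)
    have c: "card (insert i I) = Suc (card I)" using insert.hyps by simp
    have 1: "degree (P (insert i I)) \<le> Suc (card I)"
      unfolding P using insert.IH degree_mult_le[of "[:- a i, 1:]" "P I"] by simp
    have 2: "coeff (P (insert i I)) (Suc (card I)) = 1"
      unfolding P coeff_linear_mult using insert.IH by (simp add: coeff_eq_0)
    have 3: "coeff (P (insert i I)) (card I) = - (\<Sum>i\<in>insert i I. a i)"
    proof (cases "card I")
      case 0
      then have "I = {}" using insert.hyps by simp
      then show ?thesis by (simp add: P_def)
    next
      case (Suc d)
      then have "coeff (P I) (Suc d) = 1" "coeff (P I) d = - (\<Sum>i\<in>I. a i)" using insert.IH by auto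
      then show ?thesis unfolding P Suc coeff_linear_mult using insert.hyps by simp
    qed
    have 4: "coeff (P (insert i I)) e = ((\<Sum>i\<in>insert i I. a i)\<^sup>2 - (\<Sum>i\<in>insert i I. (a i)\<^sup>2)) / 2"
      if e: "card I = Suc e" for e
    proof -
      have IH1: "coeff (P I) (Suc e) = 1" "coeff (P I) e = - (\<Sum>i\<in>I. a i)" using insert.IH e by auto
      show ?thesis
      proof (cases e)
        case 0
        with e obtain j where "I = {j}" using card_1_singletonE by auto
        then show ?thesis using insert.hyps 0
          by (simp add: P_def power2_eq_square algebra_simps)
      next
        case (Suc e')
        then have IH2: "coeff (P I) e' = ((\<Sum>i\<in>I. a i)\<^sup>2 - (\<Sum>i\<in>I. (a i)\<^sup>2)) / 2"
          using insert.IH e by auto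
        show ?thesis unfolding P Suc coeff_linear_mult IH2 using IH1 insert.hyps
          by (simp add: Suc power2_eq_square field_simps)
      qed
    qed
    show ?case unfolding c using 1 2 3 4 by auto
  qed
  then show "degree (P I) \<le> card I" "coeff (P I) (card I) = 1"
    "card I = Suc (Suc e) \<Longrightarrow> coeff (P I) e = ((\<Sum>i\<in>I. a i)\<^sup>2 - (\<Sum>i\<in>I. (a i)\<^sup>2)) / 2"
    by auto
qed

lemma norm_coeff_prod_linear:
  fixes a :: "'i \<Rightarrow> complex"
  assumes "finite I"
  shows "norm (coeff (\<Prod>i\<in>I. [:- a i, 1:]) l) \<le> (\<Prod>i\<in>I. 1 + norm (a i))"
  using assms
proof (induction I arbitrary: l)
  case empty
  then show ?case by (cases l) auto
next
  case (insert i I)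
  let ?P = "\<Prod>i\<in>I. [:- a i, 1:]" and ?B = "\<Prod>i\<in>I. 1 + norm (a i)"
  have B: "?B \<ge> 0" by (intro prod_nonneg) simp
  have le: "norm (a i * coeff ?P k) \<le> norm (a i) * ?B" for k
    unfolding norm_mult by (intro mult_left_mono insert.IH) auto
  have "norm (coeff ([:- a i, 1:] * ?P) l) \<le> ?B + norm (a i) * ?B"
  proof (cases l)
    case 0
    then show ?thesis using le[of 0] B by (simp add: mult_pCons_left norm_mult)
  next
    case (Suc k)
    have "norm (coeff ?P k - a i * coeff ?P (Suc k)) \<le> norm (coeff ?P k) + norm (a i * coeff ?P (Suc k))"
      by (rule norm_triangle_ineq4)
    then show ?thesis unfolding Suc coeff_linear_mult using insert.IH[of k] le[of "Suc k"] by linarith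
  qed
  then show ?case using insert.hyps by (simp add: algebra_simps)
qed

text \<open>Both sides have the same coefficient in degree \<open>card I\<close> and agree at the nodes.\<close>

lemma lagrange_interpolation:
  fixes p :: "'a :: field_char_0 poly" and f :: "'i \<Rightarrow> 'a"
  assumes I: "finite I" and inj: "inj_on f I" and deg: "degree p \<le> card I"
  shows "coeff p (card I) * (\<Prod>i\<in>I. x - f i)
    = poly p x - (\<Sum>i\<in>I. poly p (f i) * (\<Prod>j\<in>I-{i}. (x - f j) / (f i - f j)))"
proof -
  define P where "P = (\<lambda>J. \<Prod>i\<in>J. [:- f i, 1:])"
  define L where "L = p - smult (coeff p (card I)) (P I)"
  define R where "R = (\<Sum>i\<in>I. smult (poly p (f i) / (\<Prod>j\<in>I-{i}. f i - f j)) (P (I - {i})))"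
  have pP: "poly (P J) y = (\<Prod>i\<in>J. y - f i)" for J y
    by (simp add: P_def poly_prod)
  have degR: "degree (P (I - {i})) \<le> card I - 1" if "i \<in> I" for i
    using degree_prod_linear[of "I - {i}" f] I that by (simp add: P_def)
  have dR: "degree R \<le> card I - 1"
    unfolding R_def by (intro degree_sum_le I order.trans[OF degree_smult_le] degR)
  have "L = R"
  proof (rule poly_eqI_degree_lead_coeff[of _ "card I" _ "f ` I"])
    show "coeff L (card I) = coeff R (card I)"
    proof (cases "card I = 0")
      case True
      then have "I = {}" using I by simp
      then show ?thesis by (simp add: L_def R_def P_def)
    next
      case False
      then have "coeff R (card I) = 0" using dR by (intro coeff_eq_0) linarith
      moreover have "coeff (P I) (card I) = 1" unfolding P_def by (rule coeff_prod_linear_top[OF I])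
      ultimately show ?thesis by (simp add: L_def)
    qed
    show "card I \<le> card (f ` I)" using card_image[OF inj] by simp
    have "degree (P I) \<le> card I" unfolding P_def by (rule degree_prod_linear[OF I])
    then show "degree L \<le> card I"
      unfolding L_def using deg by (intro degree_diff_le order.trans[OF degree_smult_le])
    show "degree R \<le> card I" using dR by linarith
  next
    fix z assume "z \<in> f ` I"
    then obtain l where l: "l \<in> I" "z = f l" by blast
    have z: "(\<Prod>j\<in>J. f l - f j) = 0" if "l \<in> J" "J \<subseteq> I" for J
      using that I by (intro prod_zero) (auto intro: finite_subset)
    have nz: "(\<Prod>j\<in>I-{l}. f l - f j) \<noteq> 0" using I inj l by (auto simp: inj_on_def)
    have "poly R z = (\<Sum>i\<in>I. if i = l then poly p (f l) else 0)"
      unfolding R_def poly_sum using l nz by (intro sum.cong) (auto simp: pP z)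
    then have "poly R z = poly p z" using l I by (simp add: sum.delta)
    moreover have "poly (P I) z = 0" unfolding pP l(2) by (rule z) (use l in auto)
    ultimately show "poly L z = poly R z" by (simp add: L_def)
  qed
  then have "poly L x = poly R x" by simp
  moreover have "poly R x = (\<Sum>i\<in>I. poly p (f i) * (\<Prod>j\<in>I-{i}. (x - f j) / (f i - f j)))"
    unfolding R_def poly_sum by (intro sum.cong) (simp_all add: pP prod_dividef)
  ultimately show ?thesis by (simp add: L_def pP algebra_simps)
qed

text \<open>The hypothesis is stable under the difference operator, which lowers the degree; so \<open>E\<close> is constant,
  and a constant is killed by the nonzero sum of the weights.\<close>

lemma poly_zero_from_shifts:
  fixes E :: "complex poly" and a :: "int \<Rightarrow> complex"
  assumes "\<And>x. ((\<lambda>K. a K * poly E (x - of_int K)) has_sum 0) UNIV"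
    and a: "(a has_sum A) UNIV" "A \<noteq> 0"
  shows "E = 0"
  using assms(1)
proof (induction "degree E" arbitrary: E rule: less_induct)
  case less
  show ?case
  proof (cases "degree E = 0")
    case True
    then obtain c where c: "E = [:c:]" by (auto elim: degree_eq_zeroE)
    have "((\<lambda>K. a K * c) has_sum A * c) UNIV" using a(1) by (rule has_sum_cmult_left)
    moreover have "((\<lambda>K. a K * c) has_sum 0) UNIV" using less.prems[of 0] by (simp add: c)
    ultimately have "A * c = 0" using has_sum_unique by blast
    then show ?thesis using a(2) c by simp
  next
    case False
    define D where "D = pcompose E [:1, 1:] - E"
    have pD: "poly D x = poly E (x + 1) - poly E x" for x
      by (simp add: D_def poly_pcompose add.commute)
    have "D = 0"
    proof (rule ccontr)
      assume "D \<noteq> 0"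
      have dc: "degree (pcompose E [:1, 1:]) = degree E" by (simp add: degree_pcompose)
      have "coeff D (degree E) = 0"
        using lead_coeff_comp[of "[:1, 1:]" E] dc by (simp add: D_def)
      moreover have "degree D \<le> degree E" unfolding D_def using dc by (intro degree_diff_le) auto
      ultimately have "degree D < degree E"
        using \<open>D \<noteq> 0\<close> by (metis le_neq_implies_less leading_coeff_0_iff)
      then have "D = 0"
      proof (rule less.hyps)
        fix x
        show "((\<lambda>K. a K * poly D (x - of_int K)) has_sum 0) UNIV"
          using has_sum_diff[OF less.prems[of "x + 1"] less.prems[of x]]
          by (simp add: pD algebra_simps)
      qed
      with \<open>D \<noteq> 0\<close> show False by simp
    qed
    then have per: "poly E (x + 1) = poly E x" for x using pD[of x] by simp
    have "poly E (of_nat k) = poly E 0" for k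
    proof (induction k)
      case (Suc k)
      then show ?case using per[of "of_nat k"] by (simp add: add.commute)
    qed simp
    then have "range of_nat \<subseteq> {x. poly (E - [:poly E 0:]) x = 0}" by auto
    then have "infinite {x. poly (E - [:poly E 0:]) x = 0}"
      using infinite_super[OF _ range_inj_infinite[OF inj_of_nat]] by blast
    then have "E - [:poly E 0:] = 0" using poly_roots_finite by blast
    then have "degree E = 0" by (metis degree_pCons_0 right_minus_eq)
    with False show ?thesis by simp
  qed
qed

text \<open>A coefficientwise infinite sum of polynomials of degree at most \<open>d\<close>.\<close>

definition poly_infsum :: "'i set \<Rightarrow> nat \<Rightarrow> ('i \<Rightarrow> complex poly) \<Rightarrow> complex poly" where
  "poly_infsum A d P = (\<Sum>l\<le>d. monom (\<Sum>\<^sub>\<infinity>t\<in>A. coeff (P t) l) l)"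

lemma coeff_poly_infsum: "l \<le> d \<Longrightarrow> coeff (poly_infsum A d P) l = (\<Sum>\<^sub>\<infinity>t\<in>A. coeff (P t) l)"
  by (simp add: poly_infsum_def coeff_sum sum.delta)

lemma degree_poly_infsum: "degree (poly_infsum A d P) \<le> d"
  unfolding poly_infsum_def by (intro degree_sum_le) (auto intro: order.trans[OF degree_monom_le])

lemma has_sum_finite_sum:
  fixes f :: "'i \<Rightarrow> 'a \<Rightarrow> complex"
  assumes "finite I" "\<And>i. i \<in> I \<Longrightarrow> (f i has_sum s i) A"
  shows "((\<lambda>x. \<Sum>i\<in>I. f i x) has_sum (\<Sum>i\<in>I. s i)) A"
  using assms by (induction I) (auto intro: has_sum_add)

lemma has_sum_poly_infsum:
  assumes deg: "\<And>t. t \<in> A \<Longrightarrow> degree (P t) \<le> d"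
    and sm: "\<And>l. l \<le> d \<Longrightarrow> (\<lambda>t. coeff (P t) l) summable_on A"
  shows "((\<lambda>t. poly (P t) x) has_sum poly (poly_infsum A d P) x) A"
proof -
  have 1: "((\<lambda>t. \<Sum>l\<le>d. coeff (P t) l * x ^ l) has_sum (\<Sum>l\<le>d. (\<Sum>\<^sub>\<infinity>t\<in>A. coeff (P t) l) * x ^ l)) A"
    by (intro has_sum_finite_sum has_sum_cmult_left has_sum_infsum sm) auto
  have 2: "(\<Sum>l\<le>d. (\<Sum>\<^sub>\<infinity>t\<in>A. coeff (P t) l) * x ^ l) = poly (poly_infsum A d P) x"
    by (simp add: poly_infsum_def poly_sum poly_monom)
  have 3: "(\<Sum>l\<le>d. coeff (P t) l * x ^ l) = poly (P t) x" if "t \<in> A" for t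
    unfolding poly_altdef using deg[OF that]
    by (intro sum.mono_neutral_right) (auto simp: coeff_eq_0)
  from 1 show ?thesis
    unfolding 2 by (rule has_sum_cong[THEN iffD1, rotated]) (rule 3)
qed

section \<open>Functions of at most exponential growth\<close>

text \<open>Every factor next to a Gaussian weight in the sums below is of this kind, and the property passes through products
  and polynomials. It replaces explicit majorants.\<close>

definition exp_growth :: "'a set \<Rightarrow> ('a \<Rightarrow> real) \<Rightarrow> ('a \<Rightarrow> complex) \<Rightarrow> bool" where
  "exp_growth A S f \<longleftrightarrow> (\<exists>B C. \<forall>x\<in>A. norm (f x) \<le> B * exp (C * S x))"

locale exp_growth_scale =
  fixes A :: "'a set" and S :: "'a \<Rightarrow> real"
  assumes S_nonneg: "x \<in> A \<Longrightarrow> S x \<ge> 0"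
begin

lemma exp_growthE:
  assumes "exp_growth A S f"
  obtains B C where "B \<ge> 0" "C \<ge> 0" "\<And>x. x \<in> A \<Longrightarrow> norm (f x) \<le> B * exp (C * S x)"
proof -
  from assms obtain B C where BC: "\<And>x. x \<in> A \<Longrightarrow> norm (f x) \<le> B * exp (C * S x)"
    unfolding exp_growth_def by blast
  have "norm (f x) \<le> \<bar>B\<bar> * exp (\<bar>C\<bar> * S x)" if "x \<in> A" for x
    using BC[OF that] S_nonneg[OF that]
    by (elim order.trans) (intro mult_mono, auto intro!: mult_right_mono)
  then show ?thesis using that[of "\<bar>B\<bar>" "\<bar>C\<bar>"] by simp
qed

lemma exp_growth_linear:
  assumes "\<And>x. x \<in> A \<Longrightarrow> norm (f x) \<le> a + b * S x"
  shows "exp_growth A S f"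
  unfolding exp_growth_def
proof (intro exI ballI)
  fix x assume x: "x \<in> A"
  have "norm (f x) \<le> \<bar>a\<bar> + \<bar>b\<bar> * S x"
    using assms[OF x] S_nonneg[OF x] abs_ge_self[of a] mult_right_mono[OF abs_ge_self[of b] S_nonneg[OF x]] by linarith
  also have "\<dots> \<le> (\<bar>a\<bar> + \<bar>b\<bar>) * (1 + S x)"
    using S_nonneg[OF x] by (simp add: algebra_simps)
  also have "\<dots> \<le> (\<bar>a\<bar> + \<bar>b\<bar>) * exp (1 * S x)"
    using exp_ge_add_one_self[of "S x"] by (intro mult_left_mono) auto
  finally show "norm (f x) \<le> (\<bar>a\<bar> + \<bar>b\<bar>) * exp (1 * S x)" .
qed

lemma exp_growth_const: "exp_growth A S (\<lambda>_. c)"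
  by (rule exp_growth_linear[of _ "norm c" 0]) simp

lemma exp_growth_mult:
  assumes "exp_growth A S f" "exp_growth A S g"
  shows "exp_growth A S (\<lambda>x. f x * g x)"
proof -
  from assms(1) obtain B C where 1: "B \<ge> 0" "C \<ge> 0" "\<And>x. x \<in> A \<Longrightarrow> norm (f x) \<le> B * exp (C * S x)"
    by (rule exp_growthE) blast
  from assms(2) obtain B' C' where 2: "B' \<ge> 0" "C' \<ge> 0" "\<And>x. x \<in> A \<Longrightarrow> norm (g x) \<le> B' * exp (C' * S x)"
    by (rule exp_growthE) blast
  have "norm (f x * g x) \<le> (B * B') * exp ((C + C') * S x)" if "x \<in> A" for x
  proof -
    have "norm (f x * g x) \<le> (B * exp (C * S x)) * (B' * exp (C' * S x))"
      unfolding norm_mult using 1 2 that by (intro mult_mono) auto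
    then show ?thesis by (simp add: algebra_simps exp_add)
  qed
  then show ?thesis unfolding exp_growth_def by blast
qed

lemma exp_growth_add:
  assumes "exp_growth A S f" "exp_growth A S g"
  shows "exp_growth A S (\<lambda>x. f x + g x)"
proof -
  from assms(1) obtain B C where 1: "B \<ge> 0" "C \<ge> 0" "\<And>x. x \<in> A \<Longrightarrow> norm (f x) \<le> B * exp (C * S x)"
    by (rule exp_growthE) blast
  from assms(2) obtain B' C' where 2: "B' \<ge> 0" "C' \<ge> 0" "\<And>x. x \<in> A \<Longrightarrow> norm (g x) \<le> B' * exp (C' * S x)"
    by (rule exp_growthE) blast
  have "norm (f x + g x) \<le> (B + B') * exp ((C + C') * S x)" if x: "x \<in> A" for x
  proof -
    have "norm (f x + g x) \<le> B * exp (C * S x) + B' * exp (C' * S x)"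
      using norm_triangle_ineq[of "f x" "g x"] 1(3)[OF x] 2(3)[OF x] by linarith
    also have "\<dots> \<le> B * exp ((C + C') * S x) + B' * exp ((C + C') * S x)"
      using 1 2 S_nonneg[OF x] by (intro add_mono mult_left_mono) (auto simp: algebra_simps)
    finally show ?thesis by (simp add: algebra_simps)
  qed
  then show ?thesis unfolding exp_growth_def by blast
qed

lemma exp_growth_prod:
  "(\<And>i. i \<in> I \<Longrightarrow> exp_growth A S (f i)) \<Longrightarrow> exp_growth A S (\<lambda>x. \<Prod>i\<in>I. f i x)"
  by (induction I rule: infinite_finite_induct) (auto intro: exp_growth_const exp_growth_mult)

lemma exp_growth_diff:
  assumes "exp_growth A S f" "exp_growth A S g"
  shows "exp_growth A S (\<lambda>x. f x - g x)"
  using exp_growth_add[OF assms(1) exp_growth_mult[OF exp_growth_const[of "-1"] assms(2)]] by simp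

lemma exp_growth_poly: "exp_growth A S f \<Longrightarrow> exp_growth A S (\<lambda>x. poly p (f x))"
  by (induction p) (auto intro!: exp_growth_const exp_growth_mult exp_growth_add)

lemma exp_growth_exp:
  assumes "\<And>x. x \<in> A \<Longrightarrow> norm (f x) \<le> a + b * S x"
  shows "exp_growth A S (\<lambda>x. exp (f x))"
  unfolding exp_growth_def
proof (intro exI ballI)
  fix x assume x: "x \<in> A"
  have "norm (exp (f x)) \<le> exp (norm (f x))" by (rule norm_exp)
  also have "\<dots> \<le> exp (a + b * S x)" using assms[OF x] by simp
  finally show "norm (exp (f x)) \<le> exp a * exp (b * S x)" by (simp add: exp_add)
qed

end

section \<open>Sums over the shifted lattice\<close>

text \<open>The Weyl vector of \<open>sl(N - 1)\<close> in the coordinates in which the roots are differences of two entries.\<close>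

definition rho :: "nat \<Rightarrow> nat \<Rightarrow> real" where
  "rho N i = real N / 2 - real i"

text \<open>The modulus \<open>N - 1\<close> is the dual Coxeter number of \<open>sl(N - 1)\<close>. The entries are pairwise distinct
  modulo \<open>N - 1\<close>.\<close>

definition lat :: "nat \<Rightarrow> (nat \<Rightarrow> int) \<Rightarrow> nat \<Rightarrow> real" where
  "lat N k i = rho N i + (real N - 1) * of_int (k i)"

abbreviation Lat :: "nat \<Rightarrow> (nat \<Rightarrow> int) set" where
  "Lat N \<equiv> PiE {1..<N} (\<lambda>_. UNIV)"

definition Lat_slice :: "nat \<Rightarrow> int \<Rightarrow> (nat \<Rightarrow> int) set" where
  "Lat_slice N \<kappa> = {k \<in> Lat N. (\<Sum>i\<in>{1..<N}. k i) = \<kappa>}"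

definition idx_pairs :: "nat \<Rightarrow> (nat \<times> nat) set" where
  "idx_pairs N = {(a, b). 1 \<le> a \<and> a < b \<and> b < N}"

definition vdm :: "nat \<Rightarrow> (nat \<Rightarrow> real) \<Rightarrow> real" where
  "vdm N f = (\<Prod>(a, b)\<in>idx_pairs N. f a - f b)"

definition weight :: "complex \<Rightarrow> nat \<Rightarrow> (nat \<Rightarrow> int) \<Rightarrow> complex" where
  "weight \<tau> N k = qpow \<tau> ((\<Sum>i\<in>{1..<N}. (lat N k i)\<^sup>2) / (2 * (real N - 1)))"

abbreviation lat_size :: "nat \<Rightarrow> (nat \<Rightarrow> int) \<Rightarrow> real" where
  "lat_size N k \<equiv> \<Sum>i\<in>{1..<N}. \<bar>of_int (k i)\<bar>"

lemma finite_idx_pairs [simp]: "finite (idx_pairs N)"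
proof (rule finite_subset)
  show "idx_pairs N \<subseteq> {..<N} \<times> {..<N}" by (auto simp: idx_pairs_def)
qed auto

text \<open>The linear terms \<open>rho N i * k i\<close> of the quadratic form are moved into the exponential factor, which
  leaves a pure Gaussian in \<open>k\<close>.\<close>

lemma norm_weight_le:
  assumes "Im \<tau> > 0" "N \<ge> 2"
  shows "norm (weight \<tau> N k)
    \<le> exp (2 * pi * Im \<tau> * real N * lat_size N k
         - pi * Im \<tau> * (real N - 1) * (\<Sum>i\<in>{1..<N}. (of_int (k i))\<^sup>2))"
proof -
  define n where "n = real N - 1"
  have n: "n \<ge> 1" using assms(2) by (simp add: n_def)
  have 1: "n / 2 * (of_int (k i))\<^sup>2 - real N * \<bar>of_int (k i)\<bar> \<le> (lat N k i)\<^sup>2 / (2 * n)" if i: "i \<in> {1..<N}" for i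
  proof -
    define x where "x = real_of_int (k i)"
    have "(lat N k i)\<^sup>2 / (2 * n) = (rho N i)\<^sup>2 / (2 * n) + rho N i * x + n / 2 * x\<^sup>2"
      using n by (simp add: lat_def n_def[symmetric] x_def[symmetric] field_simps power2_eq_square)
    moreover have "(rho N i)\<^sup>2 / (2 * n) \<ge> 0" using n by simp
    moreover have "- (rho N i * x) \<le> real N * \<bar>x\<bar>"
    proof -
      have "\<bar>rho N i\<bar> \<le> real N" using i by (auto simp: rho_def abs_le_iff)
      then have "\<bar>rho N i * x\<bar> \<le> real N * \<bar>x\<bar>" by (simp add: abs_mult mult_right_mono)
      then show ?thesis by linarith
    qed
    ultimately show ?thesis unfolding x_def by linarith
  qed
  have "n / 2 * (\<Sum>i\<in>{1..<N}. (of_int (k i))\<^sup>2) - real N * lat_size N k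
      = (\<Sum>i\<in>{1..<N}. n / 2 * (of_int (k i))\<^sup>2 - real N * \<bar>of_int (k i)\<bar>)"
    by (simp add: sum_subtractf sum_distrib_left)
  also have "\<dots> \<le> (\<Sum>i\<in>{1..<N}. (lat N k i)\<^sup>2 / (2 * n))" by (intro sum_mono 1)
  also have "\<dots> = (\<Sum>i\<in>{1..<N}. (lat N k i)\<^sup>2) / (2 * n)" by (simp add: sum_divide_distrib)
  finally have 2: "n / 2 * (\<Sum>i\<in>{1..<N}. (of_int (k i))\<^sup>2) - real N * lat_size N k
      \<le> (\<Sum>i\<in>{1..<N}. (lat N k i)\<^sup>2) / (2 * n)" .
  have "2 * pi * Im \<tau> * (n / 2 * (\<Sum>i\<in>{1..<N}. (of_int (k i))\<^sup>2) - real N * lat_size N k)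
      \<le> 2 * pi * Im \<tau> * ((\<Sum>i\<in>{1..<N}. (lat N k i)\<^sup>2) / (2 * n))"
    using assms(1) by (intro mult_left_mono 2) auto
  then show ?thesis by (simp add: weight_def norm_qpow n_def[symmetric] algebra_simps)
qed

interpretation lat_scale: exp_growth_scale "Lat N" "lat_size N" for N
  by unfold_locales (auto intro: sum_nonneg)

interpretation latZ_scale: exp_growth_scale "Lat N \<times> UNIV"
    "\<lambda>(k, K). lat_size N k + \<bar>of_int K\<bar>" for N
  by unfold_locales (auto intro!: sum_nonneg add_nonneg_nonneg)

lemma weighted_lattice_summable:
  assumes \<tau>: "Im \<tau> > 0" and N: "N \<ge> 2"
    and "exp_growth (Lat N) (lat_size N) f"
  shows "(\<lambda>k. weight \<tau> N k * f k) summable_on Lat N"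
proof -
  from assms(3) obtain B C where BC: "B \<ge> 0" "C \<ge> 0"
    "\<And>k. k \<in> Lat N \<Longrightarrow> norm (f k) \<le> B * exp (C * lat_size N k)"
    by (rule lat_scale.exp_growthE) blast
  define D where "D = C + 2 * pi * Im \<tau> * real N"
  define a where "a = pi * Im \<tau> * (real N - 1)"
  have a: "a > 0" using \<tau> N by (simp add: a_def)
  show ?thesis
  proof (rule norm_summable_onI)
    show "(\<lambda>k. B * exp (D * (\<Sum>i\<in>{1..<N}. \<bar>k i\<bar>) - a * (\<Sum>i\<in>{1..<N}. (real_of_int (k i))\<^sup>2))) summable_on Lat N"
      using a by (intro summable_on_cmult_right summable_on_gauss_lattice) auto
    fix k assume k: "k \<in> Lat N"
    have "norm (weight \<tau> N k * f k) \<le> exp (2 * pi * Im \<tau> * real N * lat_size N k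
         - a * (\<Sum>i\<in>{1..<N}. (of_int (k i))\<^sup>2)) * (B * exp (C * lat_size N k))"
      unfolding norm_mult a_def by (intro mult_mono norm_weight_le \<tau> N BC(3) k) auto
    also have "\<dots> = B * exp (D * (\<Sum>i\<in>{1..<N}. \<bar>k i\<bar>) - a * (\<Sum>i\<in>{1..<N}. (real_of_int (k i))\<^sup>2))"
      by (simp add: D_def algebra_simps flip: exp_add)
    finally show "norm (weight \<tau> N k * f k) \<le> \<dots>" .
  qed
qed

text \<open>The terms of a theta function of index one. The sign is the one that a cyclic shift produces in the
  Vandermonde product.\<close>

definition theta_weight :: "complex \<Rightarrow> nat \<Rightarrow> int \<Rightarrow> complex" where
  "theta_weight \<tau> N K = ((-1) ^ N) powi K * qpow \<tau> ((of_int K)\<^sup>2 / 2)"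

lemma norm_theta_weight: "norm (theta_weight \<tau> N K) = exp (- (pi * Im \<tau> * (of_int K)\<^sup>2))"
  by (simp add: theta_weight_def norm_mult norm_power_int norm_power norm_qpow)

lemma weighted_lattice_int_summable:
  assumes \<tau>: "Im \<tau> > 0" and N: "N \<ge> 2"
    and "exp_growth (Lat N \<times> UNIV) (\<lambda>(k, K). lat_size N k + \<bar>of_int K\<bar>) f"
  shows "(\<lambda>(k, K). weight \<tau> N k * theta_weight \<tau> N K * f (k, K)) summable_on Lat N \<times> UNIV"
proof -
  from assms(3) obtain B C where BC: "B \<ge> 0" "C \<ge> 0"
    "\<And>p. p \<in> Lat N \<times> UNIV \<Longrightarrow> norm (f p) \<le> B * exp (C * (case p of (k, K) \<Rightarrow> lat_size N k + \<bar>of_int K\<bar>))"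
    by (rule latZ_scale.exp_growthE) blast
  define D where "D = C + 2 * pi * Im \<tau> * real N"
  define a where "a = pi * Im \<tau> * (real N - 1)"
  define b where "b = pi * Im \<tau>"
  have ab: "a > 0" "b > 0" using \<tau> N by (simp_all add: a_def b_def)
  define g1 where "g1 = (\<lambda>k::nat \<Rightarrow> int. exp (D * (\<Sum>i\<in>{1..<N}. \<bar>k i\<bar>) - a * (\<Sum>i\<in>{1..<N}. (real_of_int (k i))\<^sup>2)))"
  define g2 where "g2 = (\<lambda>K::int. exp (C * \<bar>K\<bar> - b * (real_of_int K)\<^sup>2))"
  have "g1 summable_on Lat N" unfolding g1_def using ab by (intro summable_on_gauss_lattice) auto
  then have s1: "(\<lambda>k. complex_of_real (g1 k)) summable_on Lat N" by (rule summable_on_of_real)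
  have "g2 summable_on UNIV" unfolding g2_def using ab by (intro summable_on_gauss_int)
  then have s2: "(\<lambda>K. complex_of_real (g2 K)) summable_on UNIV" by (rule summable_on_of_real)
  have "(\<lambda>(k, K). complex_of_real (g1 k) * complex_of_real (g2 K)) summable_on Lat N \<times> UNIV"
    by (rule has_sum_imp_summable[OF has_sum_product[OF has_sum_infsum[OF s1] has_sum_infsum[OF s2]]])
  from summable_on_Re[OF this]
  have g: "(\<lambda>(k, K). g1 k * g2 K) summable_on Lat N \<times> UNIV" by (simp add: case_prod_unfold)
  show ?thesis
  proof (rule norm_summable_onI)
    show "(\<lambda>p. B * (case p of (k, K) \<Rightarrow> g1 k * g2 K)) summable_on Lat N \<times> UNIV"
      using g by (rule summable_on_cmult_right)
    fix p assume p: "p \<in> Lat N \<times> (UNIV :: int set)"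
    obtain k K where kK: "p = (k, K)" by force
    with p have k: "k \<in> Lat N" by auto
    have "norm (weight \<tau> N k * theta_weight \<tau> N K * f (k, K)) \<le> exp (2 * pi * Im \<tau> * real N * lat_size N k
         - a * (\<Sum>i\<in>{1..<N}. (of_int (k i))\<^sup>2)) * exp (- (b * (of_int K)\<^sup>2)) * (B * exp (C * (lat_size N k + \<bar>of_int K\<bar>)))"
      unfolding norm_mult a_def b_def norm_theta_weight using BC(3)[OF p] BC(1)
      by (intro mult_mono norm_weight_le \<tau> N k) (auto simp: kK)
    also have "\<dots> = B * (g1 k * g2 K)"
      by (simp add: D_def g1_def g2_def algebra_simps flip: exp_add)
    finally show "norm (case p of (k, K) \<Rightarrow> weight \<tau> N k * theta_weight \<tau> N K * f (k, K)) \<le> B * (case p of (k, K) \<Rightarrow> g1 k * g2 K)"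
      by (simp add: kK)
  qed
qed

interpretation int_scale: exp_growth_scale UNIV "\<lambda>K::int. \<bar>of_int K\<bar>"
  by unfold_locales auto

lemma theta_weighted_summable:
  assumes \<tau>: "Im \<tau> > 0" and "exp_growth UNIV (\<lambda>K::int. \<bar>of_int K\<bar>) f"
  shows "(\<lambda>K. theta_weight \<tau> N K * f K) summable_on UNIV"
proof -
  from assms(2) obtain B C where BC: "B \<ge> 0" "C \<ge> 0" "\<And>K. norm (f K) \<le> B * exp (C * \<bar>of_int K\<bar>)"
    by (rule int_scale.exp_growthE) blast
  show ?thesis
  proof (rule norm_summable_onI)
    show "(\<lambda>K::int. B * exp (C * \<bar>K\<bar> - pi * Im \<tau> * (real_of_int K)\<^sup>2)) summable_on UNIV"
      using \<tau> by (intro summable_on_cmult_right summable_on_gauss_int) auto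
    fix K :: int
    have "norm (theta_weight \<tau> N K * f K) \<le> exp (- (pi * Im \<tau> * (of_int K)\<^sup>2)) * (B * exp (C * \<bar>of_int K\<bar>))"
      unfolding norm_mult norm_theta_weight by (intro mult_left_mono BC) auto
    then show "norm (theta_weight \<tau> N K * f K) \<le> B * exp (C * \<bar>K\<bar> - pi * Im \<tau> * (real_of_int K)\<^sup>2)"
      by (simp add: algebra_simps flip: exp_add)
  qed
qed

lemma theta_weight_summable:
  assumes \<tau>: "Im \<tau> > 0" and y: "norm y = 1"
  shows "(\<lambda>K. theta_weight \<tau> N K * y powi K) summable_on UNIV"
  by (intro theta_weighted_summable \<tau> int_scale.exp_growth_linear[of _ 1 0])
     (simp add: norm_power_int y)

text \<open>Otherwise the Laurent coefficients would all vanish.\<close>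

lemma theta_value_nonzero:
  assumes \<tau>: "Im \<tau> > 0"
  shows "\<exists>y. norm y = 1 \<and> (\<Sum>\<^sub>\<infinity>K. theta_weight \<tau> N K * y powi K) \<noteq> 0"
proof (rule ccontr)
  assume "\<not> ?thesis"
  then have z: "(\<Sum>\<^sub>\<infinity>K. theta_weight \<tau> N K * y powi K) = 0" if "norm y = 1" for y
    using that by blast
  have "theta_weight \<tau> N 0 = 0"
  proof (rule laurent_zero[of 1])
    fix \<zeta> :: complex assume "norm \<zeta> = 1"
    from has_sum_infsum[OF theta_weight_summable[OF \<tau> this, of N]] z[OF \<open>norm \<zeta> = 1\<close>]
    show "((\<lambda>K. theta_weight \<tau> N K * \<zeta> powi K) has_sum 0) UNIV" by simp
  qed simp
  then show False by (simp add: theta_weight_def)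
qed

subsection \<open>The cyclic shift\<close>

text \<open>The function \<open>g\<close> is evaluated at each coordinate: \<open>g = 1\<close> gives the sum of the Vandermonde products,
  and \<open>g t = x - t\<close> adjoins one further variable \<open>x\<close> to the Vandermonde product.\<close>

definition slice_sum :: "complex \<Rightarrow> nat \<Rightarrow> (real \<Rightarrow> complex) \<Rightarrow> int \<Rightarrow> complex" where
  "slice_sum \<tau> N g \<kappa> = (\<Sum>\<^sub>\<infinity>k\<in>Lat_slice N \<kappa>. weight \<tau> N k * (of_real (vdm N (lat N k)) * (\<Prod>i\<in>{1..<N}. g (lat N k i))))"

text \<open>In terms of \<open>lat\<close>, this is a cyclic permutation of the entries followed by the translation by \<open>-1\<close>.\<close>

definition cyc :: "nat \<Rightarrow> (nat \<Rightarrow> int) \<Rightarrow> nat \<Rightarrow> int" where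
  "cyc N k = restrict (\<lambda>i. if i = 1 then k (N - 1) - 1 else k (i - 1)) {1..<N}"

definition cyc_inv :: "nat \<Rightarrow> (nat \<Rightarrow> int) \<Rightarrow> nat \<Rightarrow> int" where
  "cyc_inv N k = restrict (\<lambda>i. if i = N - 1 then k 1 + 1 else k (i + 1)) {1..<N}"

lemma lat_cyc:
  assumes "i \<in> {1..<N}"
  shows "lat N (cyc N k) i = lat N k (if i = 1 then N - 1 else i - 1) - 1"
  using assms by (auto simp: lat_def cyc_def rho_def of_nat_diff algebra_simps)

lemma bij_betw_cyclic:
  fixes N :: nat
  assumes "N \<ge> 2"
  shows "bij_betw (\<lambda>i. if i = 1 then N - 1 else i - 1) {1..<N} {1..<N}"
  by (rule bij_betw_byWitness[where f' = "\<lambda>i. if i = N - 1 then 1 else i + 1"]) (use assms in auto)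

lemma prod_lat_cyc:
  assumes "N \<ge> 2"
  shows "(\<Prod>i\<in>{1..<N}. g (lat N (cyc N k) i)) = (\<Prod>i\<in>{1..<N}. g (lat N k i - 1))"
proof -
  have "(\<Prod>i\<in>{1..<N}. g (lat N (cyc N k) i)) = (\<Prod>i\<in>{1..<N}. g (lat N k (if i = 1 then N - 1 else i - 1) - 1))"
    by (intro prod.cong refl) (simp only: lat_cyc)
  also have "\<dots> = (\<Prod>i\<in>{1..<N}. g (lat N k i - 1))"
    by (rule prod.reindex_bij_betw[OF bij_betw_cyclic[OF assms]])
  finally show ?thesis .
qed

lemma sum_lat_cyc:
  assumes "N \<ge> 2"
  shows "(\<Sum>i\<in>{1..<N}. g (lat N (cyc N k) i)) = (\<Sum>i\<in>{1..<N}. g (lat N k i - 1))"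
proof -
  have "(\<Sum>i\<in>{1..<N}. g (lat N (cyc N k) i)) = (\<Sum>i\<in>{1..<N}. g (lat N k (if i = 1 then N - 1 else i - 1) - 1))"
    by (intro sum.cong refl) (simp only: lat_cyc)
  also have "\<dots> = (\<Sum>i\<in>{1..<N}. g (lat N k i - 1))"
    by (rule sum.reindex_bij_betw[OF bij_betw_cyclic[OF assms]])
  finally show ?thesis .
qed

lemma sum_cyc:
  assumes "N \<ge> 2"
  shows "(\<Sum>i\<in>{1..<N}. cyc N k i) = (\<Sum>i\<in>{1..<N}. k i) - 1"
proof -
  have "(\<Sum>i\<in>{1..<N}. cyc N k i) = (\<Sum>i\<in>{1..<N}. k (if i = 1 then N - 1 else i - 1) - (if i = 1 then 1 else 0))"
    by (intro sum.cong) (auto simp: cyc_def)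
  also have "\<dots> = (\<Sum>i\<in>{1..<N}. k (if i = 1 then N - 1 else i - 1)) - 1"
    using assms by (subst sum_subtractf) (simp add: sum.delta')
  also have "(\<Sum>i\<in>{1..<N}. k (if i = 1 then N - 1 else i - 1)) = (\<Sum>i\<in>{1..<N}. k i)"
    by (rule sum.reindex_bij_betw[OF bij_betw_cyclic[OF assms]])
  finally show ?thesis .
qed

lemma vdm_Suc: "vdm (Suc n) f = vdm n f * (\<Prod>c\<in>{1..<n}. f c - f n)"
proof -
  have "idx_pairs (Suc n) = idx_pairs n \<union> (\<lambda>c. (c, n)) ` {1..<n}"
    by (auto simp: idx_pairs_def image_iff)
  then have "vdm (Suc n) f = (\<Prod>(a, b)\<in>idx_pairs n \<union> (\<lambda>c. (c, n)) ` {1..<n}. f a - f b)"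
    by (simp add: vdm_def)
  also have "\<dots> = vdm n f * (\<Prod>(a, b)\<in>(\<lambda>c. (c, n)) ` {1..<n}. f a - f b)"
    unfolding vdm_def
    by (rule prod.union_disjoint) (use finite_idx_pairs[of n] in \<open>auto simp: idx_pairs_def\<close>)
  also have "(\<Prod>(a, b)\<in>(\<lambda>c. (c, n)) ` {1..<n}. f a - f b) = (\<Prod>c\<in>{1..<n}. f c - f n)"
    by (subst prod.reindex) (auto simp: inj_on_def)
  finally show ?thesis .
qed

lemma vdm_cyclic:
  assumes "N \<ge> 2"
  shows "vdm N (\<lambda>i. f (if i = 1 then N - 1 else i - 1)) = (-1) ^ N * vdm N f"
proof -
  define n where "n = N - 1"
  have N: "N = Suc n" "n \<ge> 1" using assms by (auto simp: n_def)
  define P where "P = idx_pairs n"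
  have fP: "finite P" by (simp add: P_def)
  have 1: "vdm N f = (\<Prod>(a, b)\<in>P. f a - f b) * (\<Prod>c\<in>{1..<n}. f c - f n)"
    unfolding N(1) vdm_Suc by (simp add: vdm_def P_def)
  let ?\<sigma> = "\<lambda>i::nat. if i = 1 then N - 1 else i - 1"
  have "idx_pairs N = (\<lambda>(a, b). (a + 1, b + 1)) ` P \<union> (\<lambda>c. (1, c + 1)) ` {1..<n}"
  proof (intro equalityI subsetI)
    fix p assume "p \<in> idx_pairs N"
    then obtain a b where p: "p = (a, b)" "1 \<le> a" "a < b" "b < N" by (auto simp: idx_pairs_def)
    show "p \<in> (\<lambda>(a, b). (a + 1, b + 1)) ` P \<union> (\<lambda>c. (1, c + 1)) ` {1..<n}"
    proof (cases "a = 1")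
      case True
      then show ?thesis using p N by (intro UnI2 image_eqI[of _ _ "b - 1"]) auto
    next
      case False
      then show ?thesis using p N by (intro UnI1 image_eqI[of _ _ "(a - 1, b - 1)"]) (auto simp: P_def idx_pairs_def)
    qed
  qed (auto simp: idx_pairs_def P_def N)
  then have "vdm N (\<lambda>i. f (?\<sigma> i)) = (\<Prod>(a, b)\<in>(\<lambda>(a, b). (a + 1, b + 1)) ` P. f (?\<sigma> a) - f (?\<sigma> b))
      * (\<Prod>(a, b)\<in>(\<lambda>c. (1, c + 1)) ` {1..<n}. f (?\<sigma> a) - f (?\<sigma> b))"
    unfolding vdm_def using fP by (simp only:) (subst prod.union_disjoint, auto simp: P_def idx_pairs_def)
  also have "(\<Prod>(a, b)\<in>(\<lambda>(a, b). (a + 1, b + 1)) ` P. f (?\<sigma> a) - f (?\<sigma> b)) = (\<Prod>(a, b)\<in>P. f a - f b)"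
    by (subst prod.reindex) (auto simp: inj_on_def P_def idx_pairs_def intro!: prod.cong)
  also have "(\<Prod>(a, b)\<in>(\<lambda>c. (1, c + 1)) ` {1..<n}. f (?\<sigma> a) - f (?\<sigma> b)) = (\<Prod>c\<in>{1..<n}. (-1) * (f c - f n))"
    by (subst prod.reindex) (auto simp: inj_on_def N intro!: prod.cong)
  also have "\<dots> = (-1) ^ (n - 1) * (\<Prod>c\<in>{1..<n}. f c - f n)"
    by (subst prod.distrib) simp
  also have "(-1) ^ (n - 1) = ((-1) ^ N :: real)"
    using N(2) by (cases n) (auto simp: N(1))
  finally show ?thesis unfolding 1 by (simp add: mult_ac)
qed

lemma vdm_shift: "vdm N (\<lambda>i. f i - c) = vdm N f"
  by (simp add: vdm_def)

lemma vdm_cong: "(\<And>i. i \<in> {1..<N} \<Longrightarrow> f i = g i) \<Longrightarrow> vdm N f = vdm N g"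
  unfolding vdm_def by (intro prod.cong) (auto simp: idx_pairs_def)

lemma vdm_lat_cyc:
  assumes "N \<ge> 2"
  shows "vdm N (lat N (cyc N k)) = (-1) ^ N * vdm N (lat N k)"
proof -
  have "vdm N (lat N (cyc N k)) = vdm N (\<lambda>i. lat N k (if i = 1 then N - 1 else i - 1) - 1)"
    by (rule vdm_cong) (rule lat_cyc)
  then show ?thesis using vdm_cyclic[OF assms, of "lat N k"] vdm_shift[of N _ 1] by simp
qed

lemma sum_rho: "(\<Sum>i\<in>{1..<N}. rho N i) = 0"
proof -
  have "(\<Sum>i\<in>{1..<N}. rho N i) = (\<Sum>i\<in>{1..<N}. rho N (N - i))"
    by (rule sum.reindex_bij_witness[of _ "\<lambda>i. N - i" "\<lambda>i. N - i"]) auto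
  also have "\<dots> = - (\<Sum>i\<in>{1..<N}. rho N i)"
    unfolding sum_negf[symmetric] by (intro sum.cong) (auto simp: rho_def of_nat_diff)
  finally show ?thesis by simp
qed

lemma sum_lat:
  "(\<Sum>i\<in>{1..<N}. lat N k i) = (real N - 1) * of_int (\<Sum>i\<in>{1..<N}. k i)"
  unfolding lat_def sum.distrib sum_rho by (simp add: sum_distrib_left)

lemma weight_cyc:
  assumes "N \<ge> 2"
  shows "weight \<tau> N k = weight \<tau> N (cyc N k) * qpow \<tau> (of_int (\<Sum>i\<in>{1..<N}. k i) - 1/2)"
proof -
  define n where "n = real N - 1"
  have n: "n \<ge> 1" using assms by (simp add: n_def)
  have cn: "real (card {1..<N}) = n" using assms by (simp add: n_def of_nat_diff)
  have "(\<Sum>i\<in>{1..<N}. (lat N (cyc N k) i)\<^sup>2) = (\<Sum>i\<in>{1..<N}. (lat N k i - 1)\<^sup>2)"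
    by (rule sum_lat_cyc[OF assms])
  also have "\<dots> = (\<Sum>i\<in>{1..<N}. (lat N k i)\<^sup>2 - 2 * lat N k i + 1)"
    by (intro sum.cong) (auto simp: power2_eq_square algebra_simps)
  also have "\<dots> = (\<Sum>i\<in>{1..<N}. (lat N k i)\<^sup>2) - 2 * (\<Sum>i\<in>{1..<N}. lat N k i) + n"
    unfolding cn[symmetric] by (simp add: sum.distrib sum_subtractf sum_distrib_left)
  finally have "(\<Sum>i\<in>{1..<N}. (lat N k i)\<^sup>2)
      = (\<Sum>i\<in>{1..<N}. (lat N (cyc N k) i)\<^sup>2) + 2 * n * (of_int (\<Sum>i\<in>{1..<N}. k i) - 1/2)"
    unfolding sum_lat by (simp add: n_def algebra_simps)
  then show ?thesis unfolding weight_def qpow_add[symmetric] n_def[symmetric] using n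
    by (simp add: add_divide_distrib)
qed

lemma slice_sum_step:
  assumes N: "N \<ge> 2"
  shows "slice_sum \<tau> N g \<kappa>
    = (-1) ^ N * qpow \<tau> (of_int \<kappa> - 1/2) * slice_sum \<tau> N (\<lambda>t. g (t + 1)) (\<kappa> - 1)"
proof -
  let ?F = "\<lambda>k. weight \<tau> N k * (of_real (vdm N (lat N k)) * (\<Prod>i\<in>{1..<N}. g (lat N k i + 1)))"
  have "slice_sum \<tau> N g \<kappa> = (\<Sum>\<^sub>\<infinity>k\<in>Lat_slice N (\<kappa> - 1). ((-1) ^ N * qpow \<tau> (of_int \<kappa> - 1/2)) * ?F k)"
    unfolding slice_sum_def
  proof (rule infsum_reindex_bij_witness[of _ "cyc_inv N" "cyc N"])
    fix k assume k: "k \<in> Lat_slice N \<kappa>"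
    show "cyc_inv N (cyc N k) = k"
    proof
      fix i show "cyc_inv N (cyc N k) i = k i"
        using k N by (auto simp: cyc_inv_def cyc_def Lat_slice_def PiE_def extensional_def)
    qed
    show "cyc N k \<in> Lat_slice N (\<kappa> - 1)"
      using k sum_cyc[OF N, of k] by (auto simp: Lat_slice_def cyc_def)
    have "(\<Prod>i\<in>{1..<N}. g (lat N (cyc N k) i + 1)) = (\<Prod>i\<in>{1..<N}. g (lat N k i))"
      using prod_lat_cyc[OF N, of "\<lambda>t. g (t + 1)"] by simp
    moreover have "(-1) ^ N * ((-1) ^ N * x) = x" for x :: complex
      by (simp flip: mult.assoc power_add mult_2)
    ultimately show "((-1) ^ N * qpow \<tau> (of_int \<kappa> - 1/2)) * ?F (cyc N k)
        = weight \<tau> N k * (of_real (vdm N (lat N k)) * (\<Prod>i\<in>{1..<N}. g (lat N k i)))"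
      using k by (simp add: vdm_lat_cyc[OF N] weight_cyc[OF N, of \<tau> k] Lat_slice_def mult_ac)
  next
    fix k assume k: "k \<in> Lat_slice N (\<kappa> - 1)"
    show *: "cyc N (cyc_inv N k) = k"
    proof
      fix i show "cyc N (cyc_inv N k) i = k i"
        using k N by (auto simp: cyc_inv_def cyc_def Lat_slice_def PiE_def extensional_def)
    qed
    have "(\<Sum>i\<in>{1..<N}. cyc_inv N k i) = \<kappa>"
      using sum_cyc[OF N, of "cyc_inv N k"] k unfolding * by (auto simp: Lat_slice_def)
    then show "cyc_inv N k \<in> Lat_slice N \<kappa>" by (auto simp: Lat_slice_def cyc_inv_def)
  qed
  also have "\<dots> = (-1) ^ N * qpow \<tau> (of_int \<kappa> - 1/2) * (\<Sum>\<^sub>\<infinity>k\<in>Lat_slice N (\<kappa> - 1). ?F k)"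
    by (rule infsum_cmult_right')
  finally show ?thesis unfolding slice_sum_def .
qed

text \<open>Iterating the cyclic shift changes the total \<open>\<kappa>\<close> in steps of one; the accumulated signs and powers of
  \<open>q\<close> are exactly the theta weights.\<close>

lemma slice_sum_shift:
  assumes N: "N \<ge> 2"
  shows "slice_sum \<tau> N g \<kappa> = theta_weight \<tau> N \<kappa> * slice_sum \<tau> N (\<lambda>t. g (t + of_int \<kappa>)) 0"
proof -
  have tw: "theta_weight \<tau> N (j + 1) = (-1) ^ N * qpow \<tau> (of_int (j + 1) - 1/2) * theta_weight \<tau> N j" for j
  proof -
    have "(of_int (j + 1))\<^sup>2 / 2 = (of_int (j + 1) - 1/2) + (of_int j)\<^sup>2 / (2::real)"
      by (simp add: power2_eq_square field_simps)
    then show ?thesis unfolding theta_weight_def by (simp only: qpow_add) (simp add: power_int_add)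
  qed
  show ?thesis
  proof (induction \<kappa> arbitrary: g rule: int_induct[where k = 0])
    case base
    show ?case by (simp add: theta_weight_def)
  next
    case (step1 j)
    show ?case unfolding slice_sum_step[OF N, of \<tau> g "j + 1"] tw using step1.IH[of "\<lambda>t. g (t + 1)"]
      by (simp add: add_ac)
  next
    case (step2 j)
    define g' where "g' = (\<lambda>t. g (t - 1))"
    have "slice_sum \<tau> N g' j = theta_weight \<tau> N j * slice_sum \<tau> N (\<lambda>t. g' (t + of_int j)) 0" by (rule step2.IH)
    moreover have "slice_sum \<tau> N g' j = (-1) ^ N * qpow \<tau> (of_int j - 1/2) * slice_sum \<tau> N g (j - 1)"
      using slice_sum_step[OF N, of \<tau> g' j] by (simp add: g'_def)
    moreover have "theta_weight \<tau> N j = (-1) ^ N * qpow \<tau> (of_int j - 1/2) * theta_weight \<tau> N (j - 1)"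
      using tw[of "j - 1"] by simp
    ultimately have "(-1) ^ N * qpow \<tau> (of_int j - 1/2) * slice_sum \<tau> N g (j - 1)
        = (-1) ^ N * qpow \<tau> (of_int j - 1/2) * (theta_weight \<tau> N (j - 1) * slice_sum \<tau> N (\<lambda>t. g' (t + of_int j)) 0)"
      by simp
    then have "slice_sum \<tau> N g (j - 1) = theta_weight \<tau> N (j - 1) * slice_sum \<tau> N (\<lambda>t. g' (t + of_int j)) 0"
      by simp
    then show ?case by (simp add: g'_def algebra_simps)
  qed
qed

section \<open>Interpolation at the lattice coordinates\<close>

lemma has_sum_level_sets:
  fixes F :: "'a \<Rightarrow> complex"
  assumes "F summable_on {k \<in> L. v k \<in> J}"
  shows "((\<lambda>\<kappa>. infsum F {k \<in> L. v k = \<kappa>}) has_sum infsum F {k \<in> L. v k \<in> J}) J"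
proof (rule has_sum_SigmaD[where f = "\<lambda>(\<kappa>, k). F k" and B = "\<lambda>\<kappa>. {k \<in> L. v k = \<kappa>}"])
  let ?A = "{k \<in> L. v k \<in> J}"
  have "(F has_sum infsum F ?A) ?A" using assms by (rule has_sum_infsum)
  also have "?this \<longleftrightarrow> ((\<lambda>(\<kappa>, k). F k) has_sum infsum F ?A) (Sigma J (\<lambda>\<kappa>. {k \<in> L. v k = \<kappa>}))"
    by (rule has_sum_reindex_bij_witness[of _ snd "\<lambda>k. (v k, k)"]) auto
  finally show "((\<lambda>(\<kappa>, k). F k) has_sum infsum F ?A) (Sigma J (\<lambda>\<kappa>. {k \<in> L. v k = \<kappa>}))" .
  fix \<kappa> assume "\<kappa> \<in> J"
  then have "F summable_on {k \<in> L. v k = \<kappa>}"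
    using assms by (rule_tac summable_on_subset_banach) auto
  then show "((\<lambda>k. case (\<kappa>, k) of (\<kappa>, k) \<Rightarrow> F k) has_sum infsum F {k \<in> L. v k = \<kappa>}) {k \<in> L. v k = \<kappa>}"
    by simp
qed

lemma has_sum_slices:
  fixes F :: "(nat \<Rightarrow> int) \<Rightarrow> complex"
  assumes "F summable_on {k \<in> Lat N. (\<Sum>i\<in>{1..<N}. k i) \<in> J}"
  shows "((\<lambda>\<kappa>. infsum F (Lat_slice N \<kappa>)) has_sum infsum F {k \<in> Lat N. (\<Sum>i\<in>{1..<N}. k i) \<in> J}) J"
  unfolding Lat_slice_def by (rule has_sum_level_sets) (rule assms)

text \<open>Distinctness of the nodes: the entries of \<open>rho\<close> lie in an interval of length less than \<open>N - 1\<close>.\<close>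

lemma inj_on_lat: "inj_on (lat N k) {1..<N}"
proof (rule inj_onI)
  fix i j assume ij: "i \<in> {1..<N}" "j \<in> {1..<N}" "lat N k i = lat N k j"
  then have "real_of_int (int i - int j) = of_int ((int N - 1) * (k i - k j))"
    by (simp add: lat_def rho_def algebra_simps)
  then have e: "int i - int j = (int N - 1) * (k i - k j)" by (simp only: of_int_eq_iff)
  have "\<bar>int i - int j\<bar> < int N - 1" using ij by auto
  then have "\<bar>int N - 1\<bar> * \<bar>k i - k j\<bar> < int N - 1" unfolding e abs_mult .
  then have "\<bar>k i - k j\<bar> < 1" using ij by (auto simp: mult_less_cancel_left1)
  then show "i = j" using e by simp
qed

text \<open>The factors of the Vandermonde product without the variable \<open>f i\<close>, with the sign that arises from ordering
  the remaining factors as \<open>f i - f j\<close>.\<close>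

definition vdm_omit :: "nat \<Rightarrow> nat \<Rightarrow> (nat \<Rightarrow> real) \<Rightarrow> real" where
  "vdm_omit N i f = (-1) ^ (i - 1) * (\<Prod>(a, b)\<in>{(a, b) \<in> idx_pairs N. a \<noteq> i \<and> b \<noteq> i}. f a - f b)"

lemma vdm_factor:
  assumes i: "i \<in> {1..<N}"
  shows "vdm N f = vdm_omit N i f * (\<Prod>j\<in>{1..<N}-{i}. f i - f j)"
proof -
  define P where "P = {(a, b) \<in> idx_pairs N. a \<noteq> i \<and> b \<noteq> i}"
  have fP: "finite P" by (rule finite_subset[of _ "idx_pairs N"]) (auto simp: P_def)
  define L where "L = (\<lambda>a. (a, i)) ` {1..<i}"
  define R where "R = (\<lambda>b. (i, b)) ` {i<..<N}"
  have "idx_pairs N = P \<union> (L \<union> R)"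
    using i by (auto simp: idx_pairs_def P_def L_def R_def image_iff)
  then have "vdm N f = (\<Prod>(a, b)\<in>P \<union> (L \<union> R). f a - f b)" by (simp add: vdm_def)
  also have "\<dots> = (\<Prod>(a, b)\<in>P. f a - f b) * ((\<Prod>(a, b)\<in>L. f a - f b) * (\<Prod>(a, b)\<in>R. f a - f b))"
  proof -
    have "(\<Prod>(a, b)\<in>P \<union> (L \<union> R). f a - f b) = (\<Prod>(a, b)\<in>P. f a - f b) * (\<Prod>(a, b)\<in>L \<union> R. f a - f b)"
      by (rule prod.union_disjoint) (use fP in \<open>auto simp: P_def L_def R_def\<close>)
    also have "(\<Prod>(a, b)\<in>L \<union> R. f a - f b) = (\<Prod>(a, b)\<in>L. f a - f b) * (\<Prod>(a, b)\<in>R. f a - f b)"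
      by (rule prod.union_disjoint) (auto simp: L_def R_def)
    finally show ?thesis .
  qed
  also have "(\<Prod>(a, b)\<in>L. f a - f b) = (\<Prod>a\<in>{1..<i}. (-1) * (f i - f a))"
    unfolding L_def by (subst prod.reindex) (auto simp: inj_on_def)
  also have "\<dots> = (-1) ^ (i - 1) * (\<Prod>a\<in>{1..<i}. f i - f a)"
    by (subst prod.distrib) simp
  also have "(\<Prod>(a, b)\<in>R. f a - f b) = (\<Prod>b\<in>{i<..<N}. f i - f b)"
    unfolding R_def by (subst prod.reindex) (auto simp: inj_on_def)
  also have "(\<Prod>(a, b)\<in>P. f a - f b) * ((-1) ^ (i - 1) * (\<Prod>a\<in>{1..<i}. f i - f a) * (\<Prod>b\<in>{i<..<N}. f i - f b))
      = vdm_omit N i f * ((\<Prod>a\<in>{1..<i}. f i - f a) * (\<Prod>b\<in>{i<..<N}. f i - f b))"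
    by (simp add: vdm_omit_def P_def mult_ac)
  also have "(\<Prod>a\<in>{1..<i}. f i - f a) * (\<Prod>b\<in>{i<..<N}. f i - f b) = (\<Prod>j\<in>{1..<N}-{i}. f i - f j)"
  proof -
    have e: "{1..<N} - {i} = {1..<i} \<union> {i<..<N}" using i by auto
    show ?thesis unfolding e by (rule prod.union_disjoint[symmetric]) auto
  qed
  finally show ?thesis .
qed

lemma vdm_omit_cong:
  assumes "\<And>j. j \<in> {1..<N} - {i} \<Longrightarrow> f j = g j"
  shows "vdm_omit N i f = vdm_omit N i g"
proof -
  have "f a - f b = g a - g b" if "(a, b) \<in> {(a, b) \<in> idx_pairs N. a \<noteq> i \<and> b \<noteq> i}" for a b
    using that assms[of a] assms[of b] by (auto simp: idx_pairs_def)
  then show ?thesis unfolding vdm_omit_def by (intro arg_cong2[where f = "(*)"] prod.cong) auto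
qed

text \<open>Lagrange interpolation of \<open>Q (y - c)\<close> at the lattice coordinates, multiplied by the Vandermonde
  product in order to clear the denominators. The term for the node \<open>i\<close> then depends on \<open>lat N k i\<close> only
  through \<open>Q\<close>.\<close>

lemma weighted_interpolation:
  fixes Q :: "complex poly"
  assumes N: "N \<ge> 2" and deg: "degree Q \<le> N - 1"
  shows "coeff Q (N - 1) * (of_real (vdm N (lat N k)) * (\<Prod>i\<in>{1..<N}. x - of_real (lat N k i)))
    = of_real (vdm N (lat N k)) * poly Q (x - c)
      - (\<Sum>i\<in>{1..<N}. of_real (vdm_omit N i (lat N k)) * (\<Prod>j\<in>{1..<N}-{i}. x - of_real (lat N k j))
            * poly Q (of_real (lat N k i) - c))"
proof -
  define p where "p = pcompose Q [:- c, 1:]"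
  define f where "f = (\<lambda>i. complex_of_real (lat N k i))"
  have pp: "poly p y = poly Q (y - c)" for y by (simp add: p_def poly_pcompose)
  have card: "card {1..<N} = N - 1" by simp
  have dp: "degree p = degree Q" by (simp add: p_def degree_pcompose)
  have cp: "coeff p (N - 1) = coeff Q (N - 1)"
  proof (cases "degree Q = N - 1")
    case True
    then show ?thesis using lead_coeff_comp[of "[:- c, 1:]" Q] dp by (simp add: p_def)
  next
    case False
    then show ?thesis using deg dp by (simp add: coeff_eq_0)
  qed
  have inj: "inj_on f {1..<N}" using inj_on_lat[of N k] by (auto simp: f_def inj_on_def)
  have "coeff p (N - 1) * (\<Prod>i\<in>{1..<N}. x - f i)
      = poly p x - (\<Sum>i\<in>{1..<N}. poly p (f i) * (\<Prod>j\<in>{1..<N}-{i}. (x - f j) / (f i - f j)))"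
    using lagrange_interpolation[of "{1..<N}" f p x] inj deg unfolding card dp by simp
  from arg_cong[OF this, of "(*) (of_real (vdm N (lat N k)))"]
  have "of_real (vdm N (lat N k)) * (coeff p (N - 1) * (\<Prod>i\<in>{1..<N}. x - f i))
      = of_real (vdm N (lat N k)) * poly p x
        - (\<Sum>i\<in>{1..<N}. of_real (vdm N (lat N k)) * (poly p (f i) * (\<Prod>j\<in>{1..<N}-{i}. (x - f j) / (f i - f j))))"
    by (simp only: right_diff_distrib sum_distrib_left)
  also have "(\<Sum>i\<in>{1..<N}. of_real (vdm N (lat N k)) * (poly p (f i) * (\<Prod>j\<in>{1..<N}-{i}. (x - f j) / (f i - f j))))
      = (\<Sum>i\<in>{1..<N}. of_real (vdm_omit N i (lat N k)) * (\<Prod>j\<in>{1..<N}-{i}. x - f j) * poly Q (f i - c))"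
  proof (rule sum.cong)
    fix i assume i: "i \<in> {1..<N}"
    show "of_real (vdm N (lat N k)) * (poly p (f i) * (\<Prod>j\<in>{1..<N}-{i}. (x - f j) / (f i - f j)))
      = of_real (vdm_omit N i (lat N k)) * (\<Prod>j\<in>{1..<N}-{i}. x - f j) * poly Q (f i - c)"
    proof -
    have "(\<Prod>j\<in>{1..<N}-{i}. f i - f j) \<noteq> 0" using inj i by (auto simp: inj_on_def)
    moreover have "of_real (vdm N (lat N k)) = of_real (vdm_omit N i (lat N k)) * (\<Prod>j\<in>{1..<N}-{i}. f i - f j)"
      unfolding vdm_factor[OF i] by (simp add: f_def)
    ultimately show ?thesis by (simp add: prod_dividef pp)
    qed
  qed simp
  finally show ?thesis by (simp only: cp pp f_def mult.left_commute)
qed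

lemma abs_lat_le:
  assumes "N \<ge> 2" "i \<in> {1..<N}"
  shows "\<bar>lat N k i\<bar> \<le> real N + real N * lat_size N k"
proof -
  have "\<bar>rho N i\<bar> \<le> real N" using assms by (auto simp: rho_def abs_le_iff)
  moreover have "\<bar>(real N - 1) * of_int (k i)\<bar> \<le> real N * lat_size N k"
  proof -
    have "\<bar>real_of_int (k i)\<bar> \<le> lat_size N k"
      using assms by (intro member_le_sum) auto
    then show ?thesis unfolding abs_mult using assms by (intro mult_mono) auto
  qed
  ultimately show ?thesis unfolding lat_def by linarith
qed

lemma exp_growth_lat:
  assumes "N \<ge> 2" "i \<in> {1..<N}"
  shows "exp_growth (Lat N) (lat_size N) (\<lambda>k. of_real (lat N k i))"
  by (rule lat_scale.exp_growth_linear[of _ _ "real N" "real N"]) (use abs_lat_le[OF assms] in simp)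

lemma exp_growth_vdm:
  assumes "N \<ge> 2"
  shows "exp_growth (Lat N) (lat_size N) (\<lambda>k. of_real (vdm N (lat N k)))"
  unfolding vdm_def of_real_prod case_prod_unfold of_real_diff
  by (intro lat_scale.exp_growth_prod lat_scale.exp_growth_diff exp_growth_lat assms)
     (auto simp: idx_pairs_def)

lemma exp_growth_pairI:
  assumes "exp_growth (Lat N) (lat_size N) f"
  shows "exp_growth (Lat N \<times> UNIV) (\<lambda>(k, K). lat_size N k + \<bar>of_int K\<bar>) (\<lambda>(k, K::int). f k)"
proof -
  from assms obtain B C where BC: "B \<ge> 0" "C \<ge> 0"
    "\<And>k. k \<in> Lat N \<Longrightarrow> norm (f k) \<le> B * exp (C * lat_size N k)"
    by (rule lat_scale.exp_growthE) blast
  show ?thesis unfolding exp_growth_def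
  proof (intro exI ballI, clarify)
    fix k and K :: int assume "k \<in> Lat N"
    from BC(3)[OF this] show "norm (f k) \<le> B * exp (C * (lat_size N k + \<bar>of_int K\<bar>))"
      using BC(1,2) by (elim order.trans) (intro mult_left_mono, auto simp: algebra_simps)
  qed
qed

text \<open>One term of the lattice sum with the extra variable as the polynomial variable.\<close>

definition slice_term :: "complex \<Rightarrow> nat \<Rightarrow> (nat \<Rightarrow> int) \<Rightarrow> complex poly" where
  "slice_term \<tau> N k = smult (weight \<tau> N k * of_real (vdm N (lat N k))) (\<Prod>i\<in>{1..<N}. [:- of_real (lat N k i), 1:])"

definition slice_poly :: "complex \<Rightarrow> nat \<Rightarrow> complex poly" where
  "slice_poly \<tau> N = poly_infsum (Lat_slice N 0) (N - 1) (slice_term \<tau> N)"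

lemma slice_term_summable:
  assumes \<tau>: "Im \<tau> > 0" and N: "N \<ge> 2"
  shows "(\<lambda>k. coeff (slice_term \<tau> N k) l) summable_on Lat_slice N 0"
proof -
  let ?I = "{1..<N}"
  have "exp_growth (Lat N) (lat_size N) (\<lambda>k. \<Prod>i\<in>?I. 1 + of_real \<bar>lat N k i\<bar>)"
  proof (intro lat_scale.exp_growth_prod lat_scale.exp_growth_add lat_scale.exp_growth_const)
    fix i assume i: "i \<in> ?I"
    show "exp_growth (Lat N) (lat_size N) (\<lambda>k. of_real \<bar>lat N k i\<bar>)"
      by (rule lat_scale.exp_growth_linear[of _ _ "real N" "real N"]) (use abs_lat_le[OF N i] in simp)
  qed
  moreover have "norm (coeff (\<Prod>i\<in>?I. [:- complex_of_real (lat N k i), 1:]) l) \<le> norm (\<Prod>i\<in>?I. 1 + complex_of_real \<bar>lat N k i\<bar>)" for k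
  proof -
    have "(\<Prod>i\<in>?I. 1 + complex_of_real \<bar>lat N k i\<bar>) = of_real (\<Prod>i\<in>?I. 1 + \<bar>lat N k i\<bar>)" by simp
    moreover have "(\<Prod>i\<in>?I. 1 + \<bar>lat N k i\<bar>) \<ge> 0" by (intro prod_nonneg) simp
    ultimately show ?thesis
      using norm_coeff_prod_linear[of ?I "\<lambda>i. complex_of_real (lat N k i)" l] by (simp del: of_real_prod of_real_add)
  qed
  ultimately have "exp_growth (Lat N) (lat_size N) (\<lambda>k. coeff (\<Prod>i\<in>?I. [:- complex_of_real (lat N k i), 1:]) l)"
    unfolding exp_growth_def by (meson order.trans)
  then have "(\<lambda>k. weight \<tau> N k * (of_real (vdm N (lat N k)) * coeff (\<Prod>i\<in>?I. [:- of_real (lat N k i), 1:]) l)) summable_on Lat N"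
    by (intro weighted_lattice_summable[OF \<tau> N] lat_scale.exp_growth_mult exp_growth_vdm N)
  then have "(\<lambda>k. coeff (slice_term \<tau> N k) l) summable_on Lat N" by (simp add: slice_term_def mult.assoc)
  then show ?thesis by (rule summable_on_subset_banach) (auto simp: Lat_slice_def)
qed

lemma poly_slice_poly:
  assumes \<tau>: "Im \<tau> > 0" and N: "N \<ge> 2"
  shows "poly (slice_poly \<tau> N) x = slice_sum \<tau> N (\<lambda>t. x - of_real t) 0"
proof -
  have "degree (slice_term \<tau> N k) \<le> N - 1" for k
    unfolding slice_term_def using degree_prod_linear[of "{1..<N}" "\<lambda>i. complex_of_real (lat N k i)"]
    by (intro order.trans[OF degree_smult_le]) simp
  then have "((\<lambda>k. poly (slice_term \<tau> N k) x) has_sum poly (slice_poly \<tau> N) x) (Lat_slice N 0)"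
    unfolding slice_poly_def by (intro has_sum_poly_infsum slice_term_summable \<tau> N)
  then have "poly (slice_poly \<tau> N) x = (\<Sum>\<^sub>\<infinity>k\<in>Lat_slice N 0. poly (slice_term \<tau> N k) x)" by (simp add: infsumI)
  then show ?thesis by (simp add: slice_sum_def slice_term_def poly_prod mult.assoc)
qed

text \<open>The interpolation formula with \<open>c = K\<close> is summed over all \<open>k\<close> and \<open>K\<close> with the weights
  \<open>weight \<tau> N k * theta_weight \<tau> N K * y powi (K + sum of k)\<close>. For the node \<open>i\<close>, fix \<open>k i + K\<close> and the
  other coordinates: the remaining sum over \<open>K\<close> is the hypothesis \<open>theta_orth\<close>, as
  \<open>(M - (N - 1) K)\<^sup>2 / (2 (N - 1)) + K\<^sup>2 / 2\<close> differs from \<open>(M - N K)\<^sup>2 / (2 N)\<close> by a term without \<open>K\<close>. Both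
  surviving sums contain the theta function at \<open>y\<close> as a factor. Cancelling it leaves an identity between
  averages of shifts of two polynomials, from which the identity of the polynomials follows.\<close>

theorem slice_sum_proportional:
  fixes Q :: "complex poly"
  assumes \<tau>: "Im \<tau> > 0" and N: "N \<ge> 2" and deg: "degree Q \<le> N - 1"
    and theta_orth: "\<And>s::int. ((\<lambda>K. ((-1) ^ N) powi K * qpow \<tau> ((of_int s + real N / 2 - real N * of_int K)\<^sup>2 / (2 * real N))
          * poly Q (of_real (of_int s + real N / 2 - real N * of_int K))) has_sum 0) UNIV"
  shows "smult (coeff Q (N - 1)) (slice_poly \<tau> N) = smult (slice_sum \<tau> N (\<lambda>_. 1) 0) Q"
proof -
  let ?I = "{1..<N}"
  let ?w = "weight \<tau> N" and ?\<theta> = "theta_weight \<tau> N"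
  define V where "V = (\<lambda>k. complex_of_real (vdm N (lat N k)))"
  obtain y where y: "norm y = 1" and \<Theta>0: "(\<Sum>\<^sub>\<infinity>K. ?\<theta> K * y powi K) \<noteq> 0"
    using theta_value_nonzero[OF \<tau>] by blast
  define \<Theta> where "\<Theta> = (\<Sum>\<^sub>\<infinity>K. ?\<theta> K * y powi K)"
  have y0: "y \<noteq> 0" using y by auto
  have \<Theta>: "((\<lambda>K. ?\<theta> K * y powi K) has_sum \<Theta>) UNIV"
    unfolding \<Theta>_def by (rule has_sum_infsum[OF theta_weight_summable[OF \<tau> y]])
  define sk where "sk = (\<lambda>k::nat \<Rightarrow> int. \<Sum>i\<in>?I. k i)"
  \<comment> \<open>The sum of a symmetric function over the whole lattice, sorted by slices.\<close>
  have slices: "(\<lambda>k. ?w k * (V k * (\<Prod>i\<in>?I. g (lat N k i)) * y powi sk k)) summable_on Lat N"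
    "((\<lambda>\<kappa>. y powi \<kappa> * slice_sum \<tau> N g \<kappa>) has_sum
        (\<Sum>\<^sub>\<infinity>k\<in>Lat N. ?w k * (V k * (\<Prod>i\<in>?I. g (lat N k i)) * y powi sk k))) UNIV"
    if g: "\<And>i. i \<in> ?I \<Longrightarrow> exp_growth (Lat N) (lat_size N) (\<lambda>k. g (lat N k i))" for g
  proof -
    let ?F = "\<lambda>k. ?w k * (V k * (\<Prod>i\<in>?I. g (lat N k i)) * y powi sk k)"
    show s: "?F summable_on Lat N"
      unfolding V_def
      by (intro weighted_lattice_summable[OF \<tau> N] lat_scale.exp_growth_mult exp_growth_vdm N
            lat_scale.exp_growth_prod g lat_scale.exp_growth_linear[of _ _ 1 0]) (simp_all add: norm_power_int y)
    have "infsum ?F (Lat_slice N \<kappa>) = y powi \<kappa> * slice_sum \<tau> N g \<kappa>" for \<kappa>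
      unfolding slice_sum_def infsum_cmult_right'[symmetric]
      by (rule infsum_cong) (auto simp: Lat_slice_def sk_def V_def)
    then show "((\<lambda>\<kappa>. y powi \<kappa> * slice_sum \<tau> N g \<kappa>) has_sum infsum ?F (Lat N)) UNIV"
      using has_sum_slices[of ?F N UNIV] s by simp
  qed
  define G0 where "G0 = slice_sum \<tau> N (\<lambda>_. 1) 0"
  define S where "S = (\<lambda>x. slice_sum \<tau> N (\<lambda>t. x - of_real t) 0)"
  define T1 where "T1 = (\<Sum>\<^sub>\<infinity>k\<in>Lat N. ?w k * (V k * y powi sk k))"
  define TX where "TX = (\<lambda>x. \<Sum>\<^sub>\<infinity>k\<in>Lat N. ?w k * (V k * (\<Prod>i\<in>?I. x - of_real (lat N k i)) * y powi sk k))"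
  have sl1: "(\<lambda>k. ?w k * (V k * y powi sk k)) summable_on Lat N" "T1 = G0 * \<Theta>"
  proof -
    note sl = slices[of "\<lambda>_. 1"]
    show "(\<lambda>k. ?w k * (V k * y powi sk k)) summable_on Lat N"
      using sl(1) lat_scale.exp_growth_const by simp
    have "((\<lambda>\<kappa>. y powi \<kappa> * slice_sum \<tau> N (\<lambda>_. 1) \<kappa>) has_sum T1) UNIV"
      using sl(2) lat_scale.exp_growth_const by (simp add: T1_def)
    moreover have "y powi \<kappa> * slice_sum \<tau> N (\<lambda>_. 1) \<kappa> = ?\<theta> \<kappa> * y powi \<kappa> * G0" for \<kappa>
      by (subst slice_sum_shift[OF N]) (simp add: G0_def)
    ultimately have "((\<lambda>\<kappa>. ?\<theta> \<kappa> * y powi \<kappa> * G0) has_sum T1) UNIV" by simp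
    from has_sum_unique[OF this has_sum_cmult_left[OF \<Theta>]] show "T1 = G0 * \<Theta>" by (simp add: mult.commute)
  qed
  have slX: "(\<lambda>k. ?w k * (V k * (\<Prod>i\<in>?I. x - of_real (lat N k i)) * y powi sk k)) summable_on Lat N"
    "((\<lambda>\<kappa>. ?\<theta> \<kappa> * y powi \<kappa> * S (x - of_int \<kappa>)) has_sum TX x) UNIV" for x
  proof -
    have g: "exp_growth (Lat N) (lat_size N) (\<lambda>k. x - of_real (lat N k i))" if "i \<in> ?I" for i
      by (intro lat_scale.exp_growth_diff lat_scale.exp_growth_const exp_growth_lat N that)
    note sl = slices[of "\<lambda>t. x - of_real t", OF g]
    show "(\<lambda>k. ?w k * (V k * (\<Prod>i\<in>?I. x - of_real (lat N k i)) * y powi sk k)) summable_on Lat N"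
      by (rule sl(1))
    have "y powi \<kappa> * slice_sum \<tau> N (\<lambda>t. x - of_real t) \<kappa> = ?\<theta> \<kappa> * y powi \<kappa> * S (x - of_int \<kappa>)" for \<kappa>
      by (subst slice_sum_shift[OF N]) (simp add: S_def algebra_simps)
    with sl(2) show "((\<lambda>\<kappa>. ?\<theta> \<kappa> * y powi \<kappa> * S (x - of_int \<kappa>)) has_sum TX x) UNIV"
      by (simp add: TX_def)
  qed
  have gy1: "exp_growth UNIV (\<lambda>K::int. \<bar>of_int K\<bar>) (\<lambda>K. y powi K)"
    by (rule int_scale.exp_growth_linear[of _ 1 0]) (simp add: norm_power_int y)
  have gK1: "exp_growth UNIV (\<lambda>K::int. \<bar>of_int K\<bar>) (\<lambda>K. of_int K)"
    by (rule int_scale.exp_growth_linear[of _ 0 1]) simp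
  have QK: "(\<lambda>K. ?\<theta> K * (y powi K * poly Q (x - of_int K))) summable_on UNIV" for x
    by (intro theta_weighted_summable[OF \<tau>] int_scale.exp_growth_mult int_scale.exp_growth_poly
          int_scale.exp_growth_diff int_scale.exp_growth_const gy1 gK1)
  \<comment> \<open>Each interpolation term sums to zero: it depends on the i-th coordinate and the theta
      variable only through the orthogonality relation.\<close>
  define H where "H = (\<lambda>i x k. complex_of_real (vdm_omit N i (lat N k)) * (\<Prod>j\<in>?I-{i}. x - of_real (lat N k j)))"
  define F where "F = (\<lambda>i x (k, K). ?w k * ?\<theta> K * (y powi (sk k + K) * (H i x k * poly Q (of_real (lat N k i) - of_int K))))"
  have F0: "(F i x has_sum 0) (Lat N \<times> UNIV)" if i: "i \<in> ?I" for i x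
  proof -
    have "exp_growth (Lat N) (lat_size N) (H i x)"
      unfolding H_def vdm_omit_def of_real_mult of_real_prod case_prod_unfold of_real_diff
      by (intro lat_scale.exp_growth_mult lat_scale.exp_growth_prod lat_scale.exp_growth_diff
            lat_scale.exp_growth_const exp_growth_lat N) (auto simp: idx_pairs_def)
    note gH = exp_growth_pairI[OF this]
    have gK: "exp_growth (Lat N \<times> UNIV) (\<lambda>(k, K). lat_size N k + \<bar>of_int K\<bar>) (\<lambda>(k, K). of_int K)"
      by (rule latZ_scale.exp_growth_linear[of _ _ 0 1]) (auto intro: sum_nonneg)
    note gl = exp_growth_pairI[OF exp_growth_lat[OF N i]]
    have gy: "exp_growth (Lat N \<times> UNIV) (\<lambda>(k, K). lat_size N k + \<bar>of_int K\<bar>) (\<lambda>(k, K). y powi (sk k + K))"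
      by (rule latZ_scale.exp_growth_linear[of _ _ 1 0]) (auto simp: norm_power_int y)
    have "(\<lambda>(k, K). ?w k * ?\<theta> K * ((\<lambda>p. (case p of (k, K) \<Rightarrow> y powi (sk k + K)) * ((case p of (k, K) \<Rightarrow> H i x k) *
        poly Q ((case p of (k, K) \<Rightarrow> of_real (lat N k i)) - (case p of (k, K) \<Rightarrow> of_int K)))) (k, K))) summable_on Lat N \<times> UNIV"
      by (intro weighted_lattice_int_summable[OF \<tau> N] latZ_scale.exp_growth_mult latZ_scale.exp_growth_poly
            latZ_scale.exp_growth_diff gH gK gl gy)
    then have "F i x summable_on Lat N \<times> UNIV" by (simp add: F_def)
    then have hs: "(F i x has_sum infsum (F i x) (Lat N \<times> UNIV)) (Lat N \<times> UNIV)" by (rule has_sum_infsum)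
    define F' where "F' = (\<lambda>(k, K). F i x (k(i := k i - K), K))"
    have hs': "(F' has_sum infsum (F i x) (Lat N \<times> UNIV)) (Lat N \<times> UNIV)"
      using hs
      by (rule has_sum_reindex_bij_witness[of _ "\<lambda>(k, K). (k(i := k i - K), K)" "\<lambda>(k, K). (k(i := k i + K), K)", THEN iffD1, rotated -1])
         (use i in \<open>auto simp: F'_def PiE_def extensional_def\<close>)
    have inner: "((\<lambda>K. F' (k, K)) has_sum 0) UNIV" if k: "k \<in> Lat N" for k
    proof -
      define M where "M = lat N k i"
      define s where "s = (int N - 1) * k i - int i"
      have M: "M = of_int s + real N / 2" by (simp add: M_def lat_def rho_def s_def algebra_simps)
      define R where "R = (\<Sum>j\<in>?I-{i}. (lat N k j)\<^sup>2) / (2 * (real N - 1)) + M\<^sup>2 / (2 * (real N - 1)) - M\<^sup>2 / (2 * real N)"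
      define c where "c = qpow \<tau> R * y powi sk k * H i x k"
      have "F' (k, K) = c * (((-1) ^ N) powi K * qpow \<tau> ((M - real N * of_int K)\<^sup>2 / (2 * real N)) * poly Q (of_real (M - real N * of_int K)))" for K
      proof -
        let ?k = "k(i := k i - K)"
        have lj: "lat N ?k j = lat N k j" if "j \<in> ?I - {i}" for j using that by (simp add: lat_def)
        have li: "lat N ?k i = M - (real N - 1) * of_int K" by (simp add: lat_def M_def algebra_simps)
        have skk: "sk ?k + K = sk k"
        proof -
          have "sk ?k = (\<Sum>j\<in>?I. k j - (if j = i then K else 0))" unfolding sk_def by (intro sum.cong) auto
          also have "\<dots> = sk k - K" using i by (simp add: sum_subtractf sk_def sum.delta)
          finally show ?thesis by simp
        qed
        have H: "H i x ?k = H i x k"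
          unfolding H_def using lj by (intro arg_cong2[where f = "(*)"] prod.cong arg_cong[where f = of_real] vdm_omit_cong) auto
        have "(\<Sum>j\<in>?I. (lat N ?k j)\<^sup>2) = (M - (real N - 1) * of_int K)\<^sup>2 + (\<Sum>j\<in>?I-{i}. (lat N k j)\<^sup>2)"
          using i lj li by (subst sum.remove[of _ i]) auto
        moreover have "((M - (real N - 1) * of_int K)\<^sup>2 + Z) / (2 * (real N - 1)) + (of_int K)\<^sup>2 / 2
            = Z / (2 * (real N - 1)) + M\<^sup>2 / (2 * (real N - 1)) - M\<^sup>2 / (2 * real N) + (M - real N * of_int K)\<^sup>2 / (2 * real N)" for Z
        proof -
          define n where "n = real N - 1"
          have n: "n > 0" "real N = n + 1" using N by (auto simp: n_def)
          define K' where "K' = real_of_int K"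
          have "n + 1 \<noteq> 0" "n \<noteq> 0" using n by auto
          then have "((M - n * K')\<^sup>2 + Z) / (2 * n) + K'\<^sup>2 / 2
              = Z / (2 * n) + M\<^sup>2 / (2 * n) - M\<^sup>2 / (2 * (n + 1)) + (M - (n + 1) * K')\<^sup>2 / (2 * (n + 1))"
            by (simp add: divide_simps power2_eq_square) (simp add: algebra_simps)
          then show ?thesis unfolding n(2) K'_def by simp
        qed
        ultimately have "?w ?k * ?\<theta> K = ((-1) ^ N) powi K * (qpow \<tau> R * qpow \<tau> ((M - real N * of_int K)\<^sup>2 / (2 * real N)))"
          unfolding weight_def theta_weight_def R_def qpow_add[symmetric]
          by (simp add: mult.left_commute flip: qpow_add)
        moreover have "complex_of_real (lat N ?k i) - of_int K = of_real (M - real N * of_int K)"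
          unfolding li by (simp add: algebra_simps)
        ultimately show ?thesis
          unfolding F'_def F_def prod.case skk H by (simp add: c_def mult_ac)
      qed
      then show ?thesis using has_sum_cmult_right[OF theta_orth[of s], of c] by (simp add: M)
    qed
    have "((\<lambda>_. 0) has_sum infsum (F i x) (Lat N \<times> UNIV)) (Lat N)"
      by (rule has_sum_SigmaD[OF hs' inner])
    then have "infsum (F i x) (Lat N \<times> UNIV) = 0" using has_sum_unique[OF _ has_sum_0_simp] by blast
    with hs show ?thesis by simp
  qed
  have key: "coeff Q (N - 1) * (TX x * \<Theta>) = T1 * (\<Sum>\<^sub>\<infinity>K. ?\<theta> K * (y powi K * poly Q (x - of_int K)))" for x
  proof -
    have A: "((\<lambda>(k, K). ?w k * (V k * (\<Prod>i\<in>?I. x - of_real (lat N k i)) * y powi sk k) * (?\<theta> K * y powi K)) has_sum TX x * \<Theta>) (Lat N \<times> UNIV)"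
      unfolding TX_def by (intro has_sum_product has_sum_infsum slX \<Theta>)
    have B: "((\<lambda>(k, K). ?w k * (V k * y powi sk k) * (?\<theta> K * (y powi K * poly Q (x - of_int K)))) has_sum
        T1 * (\<Sum>\<^sub>\<infinity>K. ?\<theta> K * (y powi K * poly Q (x - of_int K)))) (Lat N \<times> UNIV)"
      unfolding T1_def by (intro has_sum_product has_sum_infsum sl1 QK)
    have C: "((\<lambda>p. \<Sum>i\<in>?I. F i x p) has_sum (\<Sum>i\<in>?I. 0)) (Lat N \<times> UNIV)"
      by (intro has_sum_finite_sum F0) auto
    note D = has_sum_diff[OF B C]
    have "coeff Q (N - 1) * (?w k * (V k * (\<Prod>i\<in>?I. x - of_real (lat N k i)) * y powi sk k) * (?\<theta> K * y powi K))
      = ?w k * (V k * y powi sk k) * (?\<theta> K * (y powi K * poly Q (x - of_int K))) - (\<Sum>i\<in>?I. F i x (k, K))" for k K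
    proof -
      have e: "y powi (sk k + K) = y powi sk k * y powi K" using y0 by (simp add: power_int_add)
      have "(\<Sum>i\<in>?I. F i x (k, K)) = ?w k * ?\<theta> K * y powi sk k * y powi K * (\<Sum>i\<in>?I. H i x k * poly Q (of_real (lat N k i) - of_int K))"
        unfolding F_def prod.case e by (simp add: sum_distrib_left mult_ac)
      moreover have "(\<Sum>i\<in>?I. H i x k * poly Q (of_real (lat N k i) - of_int K))
          = V k * poly Q (x - of_int K) - coeff Q (N - 1) * (V k * (\<Prod>i\<in>?I. x - of_real (lat N k i)))"
        unfolding V_def H_def weighted_interpolation[OF N deg, of k x "of_int K"] by simp
      ultimately show ?thesis by (simp only:) (simp add: algebra_simps)
    qed
    then have "(\<lambda>p. (case p of (k, K) \<Rightarrow> ?w k * (V k * y powi sk k) * (?\<theta> K * (y powi K * poly Q (x - of_int K)))) - (\<Sum>i\<in>?I. F i x p))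
       = (\<lambda>p. coeff Q (N - 1) * (case p of (k, K) \<Rightarrow> ?w k * (V k * (\<Prod>i\<in>?I. x - of_real (lat N k i)) * y powi sk k) * (?\<theta> K * y powi K)))"
      by (auto simp: fun_eq_iff)
    with D have "((\<lambda>p. coeff Q (N - 1) * (case p of (k, K) \<Rightarrow> ?w k * (V k * (\<Prod>i\<in>?I. x - of_real (lat N k i)) * y powi sk k) * (?\<theta> K * y powi K)))
       has_sum T1 * (\<Sum>\<^sub>\<infinity>K. ?\<theta> K * (y powi K * poly Q (x - of_int K)))) (Lat N \<times> UNIV)" by simp
    from has_sum_unique[OF has_sum_cmult_right[OF A] this] show ?thesis .
  qed
  \<comment> \<open>Both sides are polynomials in x.\<close>
  have SP: "poly (slice_poly \<tau> N) x = S x" for x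
    unfolding S_def by (rule poly_slice_poly[OF \<tau> N])
  define E where "E = smult (coeff Q (N - 1)) (slice_poly \<tau> N) - smult G0 Q"
  have "E = 0"
  proof (rule poly_zero_from_shifts[OF _ \<Theta>])
    fix x
    have 1: "((\<lambda>K. coeff Q (N - 1) * (?\<theta> K * y powi K * S (x - of_int K))) has_sum coeff Q (N - 1) * TX x) UNIV"
      by (intro has_sum_cmult_right slX)
    have 2: "((\<lambda>K. G0 * (?\<theta> K * (y powi K * poly Q (x - of_int K)))) has_sum
        G0 * (\<Sum>\<^sub>\<infinity>K. ?\<theta> K * (y powi K * poly Q (x - of_int K)))) UNIV"
      by (intro has_sum_cmult_right has_sum_infsum QK)
    have "coeff Q (N - 1) * TX x * \<Theta> = G0 * (\<Sum>\<^sub>\<infinity>K. ?\<theta> K * (y powi K * poly Q (x - of_int K))) * \<Theta>"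
      using key[of x] unfolding sl1(2) by (simp add: mult_ac)
    then have "coeff Q (N - 1) * TX x - G0 * (\<Sum>\<^sub>\<infinity>K. ?\<theta> K * (y powi K * poly Q (x - of_int K))) = 0"
      using \<Theta>0 by (simp add: \<Theta>_def)
    with has_sum_diff[OF 1 2]
    show "((\<lambda>K. ?\<theta> K * y powi K * poly E (x - of_int K)) has_sum 0) UNIV"
      by (simp add: E_def SP algebra_simps)
  qed (use \<Theta>0 in \<open>simp add: \<Theta>_def\<close>)
  then show ?thesis by (simp add: E_def G0_def)
qed

section \<open>The residue polynomial\<close>

text \<open>Up to the factorial, the polynomial \<open>pole_poly\<close> in the variable \<open>r = s + N / 2\<close>; its zeros are
  symmetric about \<open>k\<close>.\<close>

definition pole_shift :: "nat \<Rightarrow> int \<Rightarrow> complex poly" where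
  "pole_shift N k = smult (1 / fact (N - 1)) (\<Prod>i\<in>{1..<N}. [:- (of_int k - of_real (rho N i)), 1:])"

text \<open>The jump of the Laurent coefficients at the pole as a polynomial in the exponent.\<close>

definition residue_poly :: "nat \<Rightarrow> (int \<Rightarrow> complex) \<Rightarrow> complex poly" where
  "residue_poly N h = poly_infsum UNIV (N - 1) (\<lambda>k. smult (h k) (pole_shift N k))"

lemma poly_pole_shift:
  assumes "N \<ge> 2"
  shows "poly (pole_shift N k) (of_real (of_int s + real N / 2)) = pole_poly (N - 1) (of_int (s - k))"
proof -
  have "pole_poly (N - 1) (of_int (s - k)) = (\<Prod>i = 0..<N - 1. of_int (s - k) + of_nat (N - 1) - of_nat i) / fact (N - 1)"
    unfolding pole_poly_def by (rule gbinomial_prod_rev)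
  also have "(\<Prod>i = 0..<N - 1. of_int (s - k) + of_nat (N - 1) - of_nat i :: complex)
      = (\<Prod>i\<in>{1..<N}. of_int (s - k) + of_nat N - of_nat i)"
    by (rule prod.reindex_bij_witness[of _ "\<lambda>i. i - 1" "\<lambda>i. i + 1"]) (use assms in \<open>auto simp: of_nat_diff\<close>)
  also have "\<dots> = (\<Prod>i\<in>{1..<N}. poly [:- (of_int k - of_real (rho N i)), 1:] (of_real (of_int s + real N / 2)))"
    by (intro prod.cong) (auto simp: rho_def)
  finally show ?thesis by (simp add: pole_shift_def poly_prod)
qed

lemma degree_pole_shift: "degree (pole_shift N k) \<le> N - 1"
  unfolding pole_shift_def using degree_prod_linear[of "{1..<N}" "\<lambda>i. of_int k - complex_of_real (rho N i)"]
  by (intro order.trans[OF degree_smult_le]) simp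

lemma power_le_exp:
  fixes \<epsilon> :: real
  assumes "\<epsilon> > 0"
  obtains B where "B \<ge> 0" "\<And>x. x \<ge> 0 \<Longrightarrow> x ^ n \<le> B * exp (\<epsilon> * x)"
proof (cases "n = 0")
  case True
  then show ?thesis using assms by (intro that[of 1]) auto
next
  case False
  define c where "c = \<epsilon> / real n"
  have c: "c > 0" using assms False by (simp add: c_def)
  have "x ^ n \<le> (1 / c) ^ n * exp (\<epsilon> * x)" if x: "x \<ge> 0" for x
  proof -
    have "c * x \<le> exp (c * x)" using exp_ge_add_one_self[of "c * x"] by linarith
    then have "(c * x) ^ n \<le> exp (c * x) ^ n" using c x by (intro power_mono) auto
    also have "exp (c * x) ^ n = exp (\<epsilon> * x)"
      using False by (simp add: c_def flip: exp_of_nat_mult)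
    finally show ?thesis using c by (simp add: power_mult_distrib power_one_over field_simps)
  qed
  then show ?thesis using that[of "(1 / c) ^ n"] c by simp
qed

text \<open>All moments of the coefficients exist, because they decay exponentially in both directions.\<close>

lemma exp_decay_times_poly_summable:
  fixes h f :: "int \<Rightarrow> complex"
  assumes "\<delta> > 0" "(\<lambda>k. norm (h k) * exp (\<delta> * of_int \<bar>k\<bar>)) summable_on UNIV"
    and f: "\<And>k. norm (f k) \<le> (a + of_int \<bar>k\<bar>) ^ n" "a \<ge> 0"
  shows "(\<lambda>k. h k * f k) summable_on UNIV"
proof -
  obtain B where B: "B \<ge> 0" "\<And>x. x \<ge> 0 \<Longrightarrow> x ^ n \<le> B * exp (\<delta> * x)"
    using power_le_exp[OF assms(1), of n] by blast
  show ?thesis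
  proof (rule norm_summable_onI)
    show "(\<lambda>k. B * exp (\<delta> * a) * (norm (h k) * exp (\<delta> * of_int \<bar>k\<bar>))) summable_on UNIV"
      using assms(2) by (rule summable_on_cmult_right)
    fix k
    have "norm (f k) \<le> B * exp (\<delta> * (a + of_int \<bar>k\<bar>))"
      using f(1)[of k] B(2)[of "a + of_int \<bar>k\<bar>"] f(2) by simp
    then have "norm (h k) * norm (f k) \<le> norm (h k) * (B * exp (\<delta> * (a + of_int \<bar>k\<bar>)))"
      by (rule mult_left_mono) simp
    then show "norm (h k * f k) \<le> B * exp (\<delta> * a) * (norm (h k) * exp (\<delta> * of_int \<bar>k\<bar>))"
      by (simp add: norm_mult ring_distribs exp_add mult_ac)
  qed
qed

lemma norm_coeff_pole_shift:
  "norm (coeff (pole_shift N k) l) \<le> (1 + real N + of_int \<bar>k\<bar>) ^ (N - 1)"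
proof -
  have "norm (coeff (pole_shift N k) l)
      \<le> norm (coeff (\<Prod>i\<in>{1..<N}. [:- (of_int k - complex_of_real (rho N i)), 1:]) l)"
    by (simp add: pole_shift_def norm_divide divide_le_eq mult_le_cancel_left1 fact_ge_1)
  also have "\<dots> \<le> (\<Prod>i\<in>{1..<N}. 1 + norm (of_int k - complex_of_real (rho N i)))"
    by (rule norm_coeff_prod_linear) simp
  also have "\<dots> \<le> (\<Prod>i\<in>{1..<N}. 1 + real N + of_int \<bar>k\<bar>)"
  proof (intro prod_mono conjI)
    fix i assume "i \<in> {1..<N}"
    then have "\<bar>rho N i\<bar> \<le> real N" by (auto simp: rho_def abs_le_iff)
    moreover have "norm (of_int k - complex_of_real (rho N i)) \<le> of_int \<bar>k\<bar> + \<bar>rho N i\<bar>"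
      using norm_triangle_ineq4[of "of_int k" "complex_of_real (rho N i)"] by simp
    ultimately show "1 + norm (of_int k - complex_of_real (rho N i)) \<le> 1 + real N + of_int \<bar>k\<bar>" by linarith
  qed auto
  finally show ?thesis by simp
qed

text \<open>The annulus contains the unit circle in its interior, so that the coefficients can be compared with
  circles of radius \<open>exp \<delta>\<close> and \<open>exp (- \<delta>)\<close>.\<close>

lemma laurent_exp_decay:
  fixes h :: "int \<Rightarrow> complex"
  assumes r: "0 < r" "r < 1"
    and h: "\<And>\<zeta>::complex. r < norm \<zeta> \<Longrightarrow> norm \<zeta> * r < 1 \<Longrightarrow> (\<lambda>k. h k * \<zeta> powi k) summable_on UNIV"
  obtains \<delta> where "\<delta> > 0" "\<And>x. \<bar>x\<bar> < \<delta> \<Longrightarrow> r < exp x" "\<And>x. \<bar>x\<bar> < \<delta> \<Longrightarrow> exp x * r < 1"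
    "(\<lambda>k. norm (h k) * exp (\<delta> * of_int \<bar>k\<bar>)) summable_on UNIV"
proof -
  define \<delta> where "\<delta> = - ln r / 2"
  have \<delta>: "\<delta> > 0" using r by (simp add: \<delta>_def)
  have rd: "r = exp (- (2 * \<delta>))" using r by (simp add: \<delta>_def)
  have s: "(\<lambda>k. norm (h k * (of_real (exp x)) powi k)) summable_on UNIV" if "\<bar>x\<bar> \<le> \<delta>" for x
    by (rule summable_on_normD, rule h) (use that \<delta> in \<open>auto simp: rd simp flip: exp_add\<close>)
  show ?thesis
  proof (rule that[OF \<delta>])
    show "(\<lambda>k. norm (h k) * exp (\<delta> * of_int \<bar>k\<bar>)) summable_on UNIV"
    proof (rule summable_on_comparison_test)
      show "(\<lambda>k. norm (h k * (of_real (exp \<delta>)) powi k) + norm (h k * (of_real (exp (- \<delta>))) powi k)) summable_on UNIV"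
        by (intro summable_on_add s) (use \<delta> in auto)
      fix k :: int
      show "norm (h k) * exp (\<delta> * of_int \<bar>k\<bar>) \<le> norm (h k * (of_real (exp \<delta>)) powi k) + norm (h k * (of_real (exp (- \<delta>))) powi k)"
        by (cases "k \<ge> 0") (auto simp: norm_mult norm_power_int exp_power_int mult.commute)
    qed auto
  qed (use \<delta> in \<open>auto simp: rd simp flip: exp_add\<close>)
qed

text \<open>The coefficients \<open>h\<close> of the regular part, which are determined by \<open>\<tau>\<close> and \<open>N\<close>, are carried along as a
  parameter.\<close>

locale laurent_regular =
  fixes \<tau> :: complex and N :: nat and h :: "int \<Rightarrow> complex"
  assumes \<tau>: "Im \<tau> > 0" and N: "N \<ge> 2"
    and h: "\<And>\<zeta>::complex. norm (nome \<tau>) < norm \<zeta> \<Longrightarrow> norm \<zeta> * norm (nome \<tau>) < 1 \<Longrightarrow>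
       ((\<lambda>k. h k * \<zeta> powi k) has_sum
          1 / (qpoch_inf \<tau> (\<zeta> * nome \<tau>) * qpoch_inf \<tau> (nome \<tau> / \<zeta>)) ^ N) UNIV"
begin

lemma decay:
  obtains \<delta> where "\<delta> > 0" "\<And>x. \<bar>x\<bar> < \<delta> \<Longrightarrow> norm (nome \<tau>) < exp x" "\<And>x. \<bar>x\<bar> < \<delta> \<Longrightarrow> exp x * norm (nome \<tau>) < 1"
    "(\<lambda>k. norm (h k) * exp (\<delta> * of_int \<bar>k\<bar>)) summable_on UNIV"
  using laurent_exp_decay[OF nome_bounds(3,2)[OF \<tau>] has_sum_imp_summable[OF h]] by blast

lemma moment_summable: 
  assumes "\<And>k. norm (f k) \<le> (a + of_int \<bar>k\<bar>) ^ n" "a \<ge> 0"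
  shows "(\<lambda>k. h k * f k) summable_on UNIV"
  using decay exp_decay_times_poly_summable[OF _ _ assms] by metis

lemma coeff_summable: "(\<lambda>k. coeff (smult (h k) (pole_shift N k)) l) summable_on UNIV"
  unfolding coeff_smult by (rule moment_summable[OF norm_coeff_pole_shift]) simp

lemma degree_residue_poly: "degree (residue_poly N h) \<le> N - 1"
  unfolding residue_poly_def by (rule degree_poly_infsum)

lemma has_sum_residue_poly:
  "((\<lambda>k. h k * pole_poly (N - 1) (of_int (s - k))) has_sum
      poly (residue_poly N h) (of_real (of_int s + real N / 2))) UNIV"
proof -
  have "((\<lambda>k. poly (smult (h k) (pole_shift N k)) (of_real (of_int s + real N / 2))) has_sum
      poly (residue_poly N h) (of_real (of_int s + real N / 2))) UNIV"
    unfolding residue_poly_def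
    by (intro has_sum_poly_infsum coeff_summable order.trans[OF degree_smult_le degree_pole_shift])
  then show ?thesis by (simp only: poly_smult poly_pole_shift[OF N])
qed

lemma sum_h: "(\<Sum>\<^sub>\<infinity>k. h k) = 1 / qpoch_inf \<tau> (nome \<tau>) ^ (2 * N)"
  using infsumI[OF h[of 1]] nome_bounds[OF \<tau>] by (simp add: power_mult power2_eq_square)

lemma coeff_residue_top: "coeff (residue_poly N h) (N - 1) = (\<Sum>\<^sub>\<infinity>k. h k) / fact (N - 1)"
proof -
  have "coeff (pole_shift N k) (N - 1) = 1 / fact (N - 1)" for k
    using coeff_prod_linear_top[of "{1..<N}" "\<lambda>i. of_int k - complex_of_real (rho N i)"]
    by (simp add: pole_shift_def)
  then show ?thesis
    by (simp add: residue_poly_def coeff_poly_infsum divide_inverse infsum_cmult_left')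
qed

text \<open>As the entries of \<open>rho\<close> sum to \<open>0\<close>, the second elementary symmetric function of the zeros of
  \<open>pole_shift N k\<close> involves only \<open>k\<^sup>2\<close> and the norm of \<open>rho\<close>.\<close>

lemma coeff_residue_sub:
  assumes "N = Suc (Suc (Suc e))"
  shows "coeff (residue_poly N h) e = (real (N - 1) * real (N - 2) * (\<Sum>\<^sub>\<infinity>k. h k * (of_int k)\<^sup>2)
      - (\<Sum>i\<in>{1..<N}. (rho N i)\<^sup>2) * (\<Sum>\<^sub>\<infinity>k. h k)) / (2 * fact (N - 1))"
proof -
  define n where "n = real (N - 1)"
  define R where "R = complex_of_real (\<Sum>i\<in>{1..<N}. (rho N i)\<^sup>2)"
  have n2: "real (N - 2) = n - 1" using N by (simp add: n_def of_nat_diff)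
  have c: "coeff (pole_shift N k) e = (of_real (n * (n - 1)) * (of_int k)\<^sup>2 - R) / (2 * fact (N - 1))" for k
  proof -
    have s1: "(\<Sum>i\<in>{1..<N}. of_int k - complex_of_real (rho N i)) = of_real n * of_int k"
      using sum_rho[of N] by (simp add: sum_subtractf n_def flip: of_real_sum)
    have "(\<Sum>i\<in>{1..<N}. (of_int k - complex_of_real (rho N i))\<^sup>2)
        = (\<Sum>i\<in>{1..<N}. (of_int k)\<^sup>2 - 2 * of_int k * complex_of_real (rho N i) + of_real ((rho N i)\<^sup>2))"
      by (intro sum.cong) (auto simp: power2_eq_square algebra_simps)
    also have "\<dots> = of_real n * (of_int k)\<^sup>2 - 2 * of_int k * of_real (\<Sum>i\<in>{1..<N}. rho N i) + R"
      by (simp add: sum.distrib sum_subtractf sum_distrib_left R_def n_def)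
    finally have s2: "(\<Sum>i\<in>{1..<N}. (of_int k - complex_of_real (rho N i))\<^sup>2) = of_real n * (of_int k)\<^sup>2 + R"
      by (simp add: sum_rho[simplified])
    have "card {1..<N} = Suc (Suc e)" using assms by simp
    from coeff_prod_linear_2[OF _ this, of "\<lambda>i. of_int k - complex_of_real (rho N i)"]
    have C: "coeff (\<Prod>i\<in>{1..<N}. [:- (of_int k - complex_of_real (rho N i)), 1:]) e
        = ((of_real n * of_int k)\<^sup>2 - (of_real n * (of_int k)\<^sup>2 + R)) / 2"
      unfolding s1 s2 by simp
    show ?thesis unfolding pole_shift_def coeff_smult C by (simp add: power2_eq_square field_simps)
  qed
  have sm2: "(\<lambda>k. h k * (of_int k)\<^sup>2) summable_on UNIV"
    by (rule moment_summable[of _ 0 2]) (auto simp: norm_power)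
  have sm0: "h summable_on UNIV"
    using moment_summable[of "\<lambda>_. 1" 1 0] by simp
  have "coeff (residue_poly N h) e = (\<Sum>\<^sub>\<infinity>k. h k * coeff (pole_shift N k) e)"
    using assms by (simp add: residue_poly_def coeff_poly_infsum)
  also have "\<dots> = (\<Sum>\<^sub>\<infinity>k. of_real (n * (n - 1)) / (2 * fact (N - 1)) * (h k * (of_int k)\<^sup>2) - R / (2 * fact (N - 1)) * h k)"
    unfolding c by (intro infsum_cong) (simp add: field_simps)
  also have "\<dots> = of_real (n * (n - 1)) / (2 * fact (N - 1)) * (\<Sum>\<^sub>\<infinity>k. h k * (of_int k)\<^sup>2) - R / (2 * fact (N - 1)) * (\<Sum>\<^sub>\<infinity>k. h k)"
    by (intro infsumI has_sum_diff has_sum_cmult_right has_sum_infsum sm2 sm0)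
  also have "\<dots> = (of_real (real (N - 1) * real (N - 2)) * (\<Sum>\<^sub>\<infinity>k. h k * (of_int k)\<^sup>2) - R * (\<Sum>\<^sub>\<infinity>k. h k)) / (2 * fact (N - 1))"
    unfolding n2 n_def[symmetric] by (simp add: diff_divide_distrib)
  finally show ?thesis by (simp add: R_def)
qed

end

section \<open>The second moment of the regular part\<close>

lemma DERIV_infsum_exp_at:
  fixes a c :: "'i \<Rightarrow> complex"
  assumes w: "norm w < \<delta>" and sm: "(\<lambda>t. norm (c t) * exp (\<delta> * norm (a t))) summable_on A"
  shows "((\<lambda>z. \<Sum>\<^sub>\<infinity>t\<in>A. c t * exp (a t * z)) has_field_derivative (\<Sum>\<^sub>\<infinity>t\<in>A. c t * a t * exp (a t * w))) (at w)"
proof -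
  have "((\<lambda>z. \<Sum>\<^sub>\<infinity>t\<in>A. (c t * exp (a t * w)) * exp (a t * z)) has_field_derivative (\<Sum>\<^sub>\<infinity>t\<in>A. (c t * exp (a t * w)) * a t)) (at 0)"
  proof (rule DERIV_infsum_exp[of "\<delta> - norm w"])
    show "(\<lambda>t. norm (c t * exp (a t * w)) * exp ((\<delta> - norm w) * norm (a t))) summable_on A"
    proof (rule summable_on_comparison_test[OF sm])
      fix t
      have "Re (a t * w) \<le> norm w * norm (a t)"
        using complex_Re_le_cmod[of "a t * w"] by (simp add: norm_mult mult.commute)
      then have "exp (Re (a t * w)) * exp ((\<delta> - norm w) * norm (a t)) \<le> exp (\<delta> * norm (a t))"
        unfolding exp_add[symmetric] by (simp add: algebra_simps)
      then have "norm (c t) * (exp (Re (a t * w)) * exp ((\<delta> - norm w) * norm (a t))) \<le> norm (c t) * exp (\<delta> * norm (a t))"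
        by (rule mult_left_mono) simp
      then show "norm (c t * exp (a t * w)) * exp ((\<delta> - norm w) * norm (a t)) \<le> norm (c t) * exp (\<delta> * norm (a t))"
        by (simp add: norm_mult norm_exp_eq_Re mult.assoc)
    qed auto
  qed (use w in simp)
  also have "(\<lambda>z. \<Sum>\<^sub>\<infinity>t\<in>A. (c t * exp (a t * w)) * exp (a t * z)) = (\<lambda>z. \<Sum>\<^sub>\<infinity>t\<in>A. c t * exp (a t * (z + w)))"
    by (simp add: ring_distribs exp_add mult_ac)
  finally have "((\<lambda>z. \<Sum>\<^sub>\<infinity>t\<in>A. c t * exp (a t * (z + w))) has_field_derivative (\<Sum>\<^sub>\<infinity>t\<in>A. c t * a t * exp (a t * w))) (at 0)"
    by (simp add: mult_ac)
  then show ?thesis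
    using DERIV_shift[of "\<lambda>z. \<Sum>\<^sub>\<infinity>t\<in>A. c t * exp (a t * z)" _ 0 w] by simp
qed

lemma summable_exp_times_linear:
  fixes a c :: "'i \<Rightarrow> complex"
  assumes "\<delta>' < \<delta>" and sm: "(\<lambda>t. norm (c t) * exp (\<delta> * norm (a t))) summable_on A"
  shows "(\<lambda>t. norm (c t * a t) * exp (\<delta>' * norm (a t))) summable_on A"
proof (rule summable_on_comparison_test)
  define e where "e = \<delta> - \<delta>'"
  have e: "e > 0" using assms by (simp add: e_def)
  show "(\<lambda>t. 1 / e * (norm (c t) * exp (\<delta> * norm (a t)))) summable_on A"
    using sm by (rule summable_on_cmult_right)
  fix t
  have "e * norm (a t) \<le> exp (e * norm (a t))" using exp_ge_add_one_self[of "e * norm (a t)"] by linarith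
  then have "norm (a t) \<le> 1 / e * exp (e * norm (a t))" using e by (simp add: field_simps)
  then have "norm (c t) * exp (\<delta>' * norm (a t)) * norm (a t) \<le> norm (c t) * exp (\<delta>' * norm (a t)) * (1 / e * exp (e * norm (a t)))"
    by (intro mult_left_mono) auto
  also have "\<dots> = 1 / e * (norm (c t) * exp (\<delta> * norm (a t)))"
  proof -
    have "exp (\<delta>' * norm (a t)) * exp (e * norm (a t)) = exp (\<delta> * norm (a t))"
      by (simp add: e_def algebra_simps flip: exp_add)
    then show ?thesis by (simp add: mult_ac)
  qed
  finally show "norm (c t * a t) * exp (\<delta>' * norm (a t)) \<le> 1 / e * (norm (c t) * exp (\<delta> * norm (a t)))"
    by (simp add: norm_mult mult_ac)
qed auto

text \<open>The generating series of the sums of divisors, as a Lambert series.\<close>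

definition sigma_series :: "complex \<Rightarrow> complex" where
  "sigma_series \<tau> = (\<Sum>\<^sub>\<infinity>(m, j)\<in>{1..} \<times> (UNIV :: nat set). of_nat m * nome \<tau> ^ (m * Suc j))"

context laurent_regular
begin

text \<open>With \<open>\<zeta> = exp z\<close> the regular part is \<open>H = exp (N (L z + L (- z)))\<close>, an even function, and its second
  derivative at \<open>0\<close> is \<open>2 N L'' H\<close> there; termwise, this derivative is the second moment, and
  \<open>L''\<close> is the divisor sum.\<close>

lemma second_moment: "(\<Sum>\<^sub>\<infinity>k. h k * (of_int k)\<^sup>2) = 2 * of_nat N * sigma_series \<tau> * (\<Sum>\<^sub>\<infinity>k. h k)"
proof -
  let ?q = "nome \<tau>"
  obtain \<delta> where \<delta>: "\<delta> > 0" "\<And>x. \<bar>x\<bar> < \<delta> \<Longrightarrow> norm ?q < exp x" "\<And>x. \<bar>x\<bar> < \<delta> \<Longrightarrow> exp x * norm ?q < 1"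
    and hs: "(\<lambda>k. norm (h k) * exp (\<delta> * of_int \<bar>k\<bar>)) summable_on UNIV"
    using decay by blast
  define I where "I = {1::nat..} \<times> (UNIV :: nat set)"
  define c where "c = (\<lambda>(m, j). ?q ^ m * ?q ^ (m * j) / of_nat m :: complex)"
  define b where "b = (\<lambda>(m::nat, j::nat). of_nat m :: complex)"
  define \<epsilon> where "\<epsilon> = \<delta> / 2"
  have \<epsilon>: "0 < \<epsilon>" "\<epsilon> < \<delta>" using \<delta> by (auto simp: \<epsilon>_def)
  have cs: "(\<lambda>t. norm (c t) * exp (\<epsilon> * norm (b t))) summable_on I"
  proof -
    have "norm (of_real (exp \<epsilon>) * ?q) < 1" using \<delta>(3)[of \<epsilon>] \<epsilon> by (simp add: norm_mult)
    from summable_on_normD[OF log_poch_summable[OF \<tau> this]]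
    show ?thesis unfolding I_def
      by (rule summable_on_cong[THEN iffD1, rotated])
         (auto simp: c_def b_def norm_mult norm_divide norm_power power_mult_distrib mult_ac exp_of_nat_mult[symmetric])
  qed
  define L where "L = (\<lambda>z. \<Sum>\<^sub>\<infinity>t\<in>I. c t * exp (b t * z))"
  define L1 where "L1 = (\<lambda>z. \<Sum>\<^sub>\<infinity>t\<in>I. c t * b t * exp (b t * z))"
  define L2 where "L2 = (\<Sum>\<^sub>\<infinity>t\<in>I. c t * b t * b t)"
  have dL: "(L has_field_derivative L1 z) (at z)" if "norm z < \<epsilon>" for z
    unfolding L_def L1_def by (rule DERIV_infsum_exp_at[OF that cs])
  have dL1: "(L1 has_field_derivative L2) (at 0)"
    unfolding L1_def L2_def using \<epsilon> by (intro DERIV_infsum_exp[of "\<epsilon>/2"] summable_exp_times_linear[OF _ cs]) auto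
  have hs': "(\<lambda>k. norm (h k) * exp (\<delta> * norm (of_int k :: complex))) summable_on UNIV"
    using hs by simp
  define H where "H = (\<lambda>z. \<Sum>\<^sub>\<infinity>k. h k * exp (of_int k * z))"
  define H1 where "H1 = (\<lambda>z. \<Sum>\<^sub>\<infinity>k. h k * of_int k * exp (of_int k * z))"
  define H2 where "H2 = (\<Sum>\<^sub>\<infinity>k. h k * of_int k * of_int k)"
  have dH: "(H has_field_derivative H1 z) (at z)" if "norm z < \<delta>" for z
    unfolding H_def H1_def by (rule DERIV_infsum_exp_at[OF that hs'])
  have dH1: "(H1 has_field_derivative H2) (at 0)"
    unfolding H1_def H2_def using \<delta> by (intro DERIV_infsum_exp[of "\<delta>/2"] summable_exp_times_linear[OF _ hs']) auto
  have Lp: "qpoch_inf \<tau> (exp z * ?q) = exp (- L z)" if z: "norm z < \<delta>" for z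
  proof -
    have "\<bar>Re z\<bar> < \<delta>" using z abs_Re_le_cmod[of z] by linarith
    then have lt: "norm (exp z * ?q) < 1" using \<delta>(3)[of "Re z"] by (simp add: norm_mult norm_exp_eq_Re)
    have "log_poch \<tau> (exp z * ?q) = L z"
      unfolding log_poch_def L_def I_def
      by (rule infsum_cong) (auto simp: c_def b_def power_mult_distrib exp_of_nat_mult exp_of_nat2_mult mult_ac)
    then show ?thesis using qpoch_inf_eq_exp[OF \<tau> lt] by simp
  qed
  have HL: "H z = exp (of_nat N * (L z + L (- z)))" if z: "norm z < \<delta>" for z
  proof -
    have "\<bar>Re z\<bar> < \<delta>" using z abs_Re_le_cmod[of z] by linarith
    then have "((\<lambda>k. h k * exp z powi k) has_sum 1 / (qpoch_inf \<tau> (exp z * ?q) * qpoch_inf \<tau> (?q / exp z)) ^ N) UNIV"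
      using \<delta>(2,3)[of "Re z"] by (intro h) (auto simp: norm_exp_eq_Re)
    then have "H z = 1 / (qpoch_inf \<tau> (exp z * ?q) * qpoch_inf \<tau> (?q / exp z)) ^ N"
      unfolding H_def by (simp add: exp_power_int infsumI)
    also have "?q / exp z = exp (- z) * ?q" by (simp add: exp_minus field_simps)
    also have "qpoch_inf \<tau> (exp z * ?q) * qpoch_inf \<tau> (exp (- z) * ?q) = exp (- (L z + L (- z)))"
      using Lp[of z] Lp[of "- z"] z by (simp add: exp_diff exp_minus field_simps)
    finally show ?thesis
      by (simp only: exp_minus exp_of_nat_mult) (simp add: power_inverse divide_inverse)
  qed
  \<comment> \<open>The first derivative is needed in a neighbourhood of the origin in order to differentiate again.\<close>
  have mirror: "((\<lambda>z::complex. - z) has_field_derivative -1) (at z)" for z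
    by (auto intro!: derivative_eq_intros)
  have H1L: "H1 z = H z * (of_nat N * (L1 z - L1 (- z)))" if z: "norm z < \<epsilon>" for z
  proof -
    have "((\<lambda>z. exp (of_nat N * (L z + L (- z)))) has_field_derivative
        exp (of_nat N * (L z + L (- z))) * (of_nat N * (L1 z + L1 (- z) * (-1)))) (at z)"
    proof -
      have "(L has_field_derivative L1 (- z)) (at (- z))" using dL[of "- z"] z by simp
      then have "((\<lambda>z. L (- z)) has_field_derivative L1 (- z) * (-1)) (at z)"
        by (rule DERIV_chain2[of L "L1 (- z)" "\<lambda>z. - z" z "-1" UNIV, OF _ mirror])
      then show ?thesis using dL[OF z] by (auto intro!: derivative_eq_intros)
    qed
    note D = this
    have ev: "\<forall>\<^sub>F w in nhds z. exp (of_nat N * (L w + L (- w))) = H w"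
      using eventually_nhds_in_open[of "ball 0 \<delta>" z] z \<epsilon>
      by (auto elim!: eventually_mono simp: HL)
    have "(H has_field_derivative exp (of_nat N * (L z + L (- z))) * (of_nat N * (L1 z + L1 (- z) * (-1)))) (at z)"
      by (rule DERIV_cong_ev[OF refl ev refl, THEN iffD1, OF D])
    from DERIV_unique[OF dH this] z \<epsilon> show ?thesis by (simp add: HL)
  qed
  have dL1': "((\<lambda>z. L1 (- z)) has_field_derivative L2 * (-1)) (at 0)"
    by (rule DERIV_chain2[of L1 L2 "\<lambda>z. - z" 0 "-1" UNIV, OF _ mirror]) (use dL1 in simp)
  have D: "((\<lambda>z. H z * (of_nat N * (L1 z - L1 (- z)))) has_field_derivative H 0 * (of_nat N * (L2 - L2 * (-1)))) (at 0)"
    using dH[of 0] dL1 dL1' \<delta>(1) by (auto intro!: derivative_eq_intros)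
  have ev: "\<forall>\<^sub>F w in nhds 0. H w * (of_nat N * (L1 w - L1 (- w))) = H1 w"
    using eventually_nhds_in_open[of "ball 0 \<epsilon>" 0] \<epsilon> by (auto elim!: eventually_mono simp: H1L)
  have "(H1 has_field_derivative H 0 * (of_nat N * (L2 - L2 * (-1)))) (at 0)"
    by (rule DERIV_cong_ev[OF refl ev refl, THEN iffD1, OF D])
  then have "H2 = H 0 * (of_nat N * (L2 - L2 * (-1)))" by (rule DERIV_unique[OF dH1])
  moreover have "L2 = sigma_series \<tau>"
    unfolding L2_def sigma_series_def I_def by (rule infsum_cong) (auto simp: c_def b_def power_add)
  moreover have "H 0 = (\<Sum>\<^sub>\<infinity>k. h k)" by (simp add: H_def)
  moreover have "H2 = (\<Sum>\<^sub>\<infinity>k. h k * (of_int k)\<^sup>2)" by (simp add: H2_def power2_eq_square mult.assoc)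
  ultimately show ?thesis by simp
qed

end

section \<open>Proportionality of the lattice sum and the residue\<close>

text \<open>The coefficients \<open>c\<close> on the inner annulus together with their jump across the pole.\<close>

locale theta_power_expansion = laurent_regular +
  fixes c :: "int \<Rightarrow> complex"
  assumes c: "\<And>\<zeta>::complex. norm (nome \<tau>) < norm \<zeta> \<Longrightarrow> norm \<zeta> < 1 \<Longrightarrow>
       ((\<lambda>k. c k * \<zeta> powi k) has_sum 1 / (qpoch_inf \<tau> \<zeta> * qpoch_inf \<tau> (nome \<tau> / \<zeta>)) ^ N) UNIV"
    and jump: "\<And>s. ((\<lambda>k. h k * pole_poly (N - 1) (of_int (s - k))) has_sum
       c s - (-1) ^ N * nome \<tau> powi (s + int N) * c (s + int N)) UNIV"

lemma theta_power_expansion_exists: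
  assumes "Im \<tau> > 0" "N \<ge> 2"
  obtains h c where "theta_power_expansion \<tau> N h c"
proof (rule annulus_expansion[OF assms(1), of "N - 1"])
  have e: "Suc (N - 1) = N" using assms by simp
  fix h c :: "int \<Rightarrow> complex"
  assume 1: "\<And>\<zeta>::complex. norm (nome \<tau>) < norm \<zeta> \<Longrightarrow> norm \<zeta> * norm (nome \<tau>) < 1 \<Longrightarrow>
       ((\<lambda>k. h k * \<zeta> powi k) has_sum
          1 / (qpoch_inf \<tau> (\<zeta> * nome \<tau>) * qpoch_inf \<tau> (nome \<tau> / \<zeta>)) ^ Suc (N - 1)) UNIV"
    and 2: "\<And>\<zeta>::complex. norm (nome \<tau>) < norm \<zeta> \<Longrightarrow> norm \<zeta> < 1 \<Longrightarrow>
       ((\<lambda>k. c k * \<zeta> powi k) has_sum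
          1 / (qpoch_inf \<tau> \<zeta> * qpoch_inf \<tau> (nome \<tau> / \<zeta>)) ^ Suc (N - 1)) UNIV"
    and 3: "\<And>s. ((\<lambda>k. h k * pole_poly (N - 1) (of_int (s - k))) has_sum
       c s - (-1) ^ Suc (N - 1) * nome \<tau> powi (s + int (Suc (N - 1))) * c (s + int (Suc (N - 1)))) UNIV"
  show thesis
    by (rule that[of h c]) (unfold_locales; (rule assms 1[unfolded e] 2[unfolded e] 3[unfolded e]; assumption))
qed

context theta_power_expansion
begin

abbreviation "R \<equiv> residue_poly N h"

lemma residue_jump:
  "poly R (of_real (of_int s + real N / 2)) = c s - (-1) ^ N * nome \<tau> powi (s + int N) * c (s + int N)"
  using has_sum_unique[OF has_sum_residue_poly jump] .

text \<open>The two evaluations of the theta-like series of the residue polynomial: one-sided for the coefficient,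
  two-sided for the orthogonality relation.\<close>

lemma coefficient_as_theta_sum:
  defines "F \<equiv> \<lambda>s (j::int). ((-1) ^ N) powi j * qpow \<tau> ((of_int s + real N / 2 + real N * of_int j)\<^sup>2 / (2 * real N))
      * poly R (of_real (of_int s + real N / 2 + real N * of_int j))"
  shows "(F s has_sum 0) UNIV"
    and "(F s has_sum qpow \<tau> ((of_int s + real N / 2)\<^sup>2 / (2 * real N)) * c s) {0..}"
proof -
  obtain r where r: "norm (nome \<tau>) < r" "r < 1" using dense nome_bounds(2)[OF \<tau>] by blast
  have r0: "r > 0" using nome_bounds(3)[OF \<tau>] r(1) by (rule less_trans)
  have "(\<lambda>k. c k * of_real r powi k) summable_on UNIV"
    using r r0 by (intro has_sum_imp_summable[OF c]) auto
  then obtain B C where BC: "\<And>k. norm (c k) \<le> B * exp (C * of_int \<bar>k\<bar>)" "B \<ge> 0" "C \<ge> 0"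
    using laurent_coeff_growth[of "of_real r" c] r0 by auto
  define Q where "Q = (\<lambda>s. poly R (of_real (of_int s + real N / 2)))"
  have F: "F s = (\<lambda>j. ((-1) ^ N) powi j * qpow \<tau> ((of_int s + real N / 2 + real N * of_int j)\<^sup>2 / (2 * real N)) * Q (s + int N * j))"
    by (rule ext) (simp add: F_def Q_def algebra_simps)
  note T = telescoping_theta_sum[OF \<tau> _ BC, of N Q s]
  show "(F s has_sum 0) UNIV"
    "(F s has_sum qpow \<tau> ((of_int s + real N / 2)\<^sup>2 / (2 * real N)) * c s) {0..}"
    unfolding F using N residue_jump by (intro T; simp add: Q_def)+
qed

lemma theta_orthogonality:
  "((\<lambda>K. ((-1) ^ N) powi K * qpow \<tau> ((of_int s + real N / 2 - real N * of_int K)\<^sup>2 / (2 * real N))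
      * poly R (of_real (of_int s + real N / 2 - real N * of_int K))) has_sum 0) UNIV"
proof -
  have e: "((-1) ^ N :: complex) powi (- K) = ((-1) ^ N) powi K" for K
    by (cases "even N") (auto simp: power_int_minus power_int_minus_left)
  show ?thesis
    by (rule has_sum_reindex_bij_witness[of _ uminus uminus, THEN iffD1, OF _ _ _ _ _ _ coefficient_as_theta_sum(1)[of s]])
       (auto simp: e)
qed

lemma slice_proportional:
  "smult ((\<Sum>\<^sub>\<infinity>k. h k) / fact (N - 1)) (slice_poly \<tau> N) = smult (slice_sum \<tau> N (\<lambda>_. 1) 0) R"
  unfolding coeff_residue_top[symmetric]
  by (rule slice_sum_proportional[OF \<tau> N degree_residue_poly theta_orthogonality])

lemma sum_h_nonzero: "(\<Sum>\<^sub>\<infinity>k. h k) \<noteq> 0"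
  using qpoch_inf_neq_0[OF \<tau>] nome_bounds[OF \<tau>] by (simp add: sum_h)

end

text \<open>Up to a constant, the derivative of the lattice sum with respect to \<open>\<tau>\<close>.\<close>

definition norm_sq_sum :: "complex \<Rightarrow> nat \<Rightarrow> complex" where
  "norm_sq_sum \<tau> N = (\<Sum>\<^sub>\<infinity>k\<in>Lat_slice N 0. weight \<tau> N k * of_real (vdm N (lat N k)) * of_real (\<Sum>i\<in>{1..<N}. (lat N k i)\<^sup>2))"

text \<open>Coefficients of degree \<open>N - 3\<close> in \<open>slice_proportional\<close>: on the slice \<open>\<kappa> = 0\<close> the coordinates sum to
  \<open>0\<close>, so their second elementary symmetric function is \<open>-1/2\<close> times the norm. For \<open>N = 2\<close> there is no such
  coefficient, but the slice is a single point of norm \<open>0\<close>.\<close>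

lemma norm_sq_sum_eq:
  assumes \<tau>: "Im \<tau> > 0" and N: "N \<ge> 2"
  shows "norm_sq_sum \<tau> N = slice_sum \<tau> N (\<lambda>_. 1) 0 *
    (of_real (\<Sum>i\<in>{1..<N}. (rho N i)\<^sup>2) - 2 * of_nat N * of_nat (N - 1) * of_nat (N - 2) * sigma_series \<tau>)"
proof (cases "N = 2")
  case True
  have "lat N k 1 = 0" if "k \<in> Lat_slice N 0" for k
    using that by (simp add: True Lat_slice_def lat_def rho_def numeral_2_eq_2)
  then have "norm_sq_sum \<tau> N = (\<Sum>\<^sub>\<infinity>k\<in>Lat_slice N 0. 0)"
    unfolding norm_sq_sum_def by (intro infsum_cong) (simp add: True numeral_2_eq_2)
  then show ?thesis by (simp add: True rho_def numeral_2_eq_2)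
next
  case False
  obtain h c where "theta_power_expansion \<tau> N h c" using theta_power_expansion_exists[OF \<tau> N] .
  then interpret theta_power_expansion \<tau> N h c .
  obtain e where e: "N = Suc (Suc (Suc e))" using False N by (metis Suc_1 add_2_eq_Suc le_neq_implies_less less_eqE less_iff_Suc_add)
  define G where "G = slice_sum \<tau> N (\<lambda>_. 1) 0"
  define M where "M = (\<Sum>\<^sub>\<infinity>k. h k)"
  have "coeff (slice_poly \<tau> N) e = (\<Sum>\<^sub>\<infinity>k\<in>Lat_slice N 0. coeff (slice_term \<tau> N k) e)"
    unfolding slice_poly_def by (rule coeff_poly_infsum) (simp add: e)
  also have "\<dots> = (\<Sum>\<^sub>\<infinity>k\<in>Lat_slice N 0. (weight \<tau> N k * of_real (vdm N (lat N k)) * of_real (\<Sum>i\<in>{1..<N}. (lat N k i)\<^sup>2)) * (- 1 / 2))"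
  proof (rule infsum_cong)
    fix k assume k: "k \<in> Lat_slice N 0"
    have s: "(\<Sum>i\<in>{1..<N}. complex_of_real (lat N k i)) = 0"
      using k sum_lat[of N k] by (simp add: Lat_slice_def flip: of_real_sum)
    have "coeff (\<Prod>i\<in>{1..<N}. [:- complex_of_real (lat N k i), 1:]) e = ((\<Sum>i\<in>{1..<N}. complex_of_real (lat N k i))\<^sup>2 - (\<Sum>i\<in>{1..<N}. (complex_of_real (lat N k i))\<^sup>2)) / 2"
      by (rule coeff_prod_linear_2) (simp_all add: e)
    then show "coeff (slice_term \<tau> N k) e = (weight \<tau> N k * of_real (vdm N (lat N k)) * of_real (\<Sum>i\<in>{1..<N}. (lat N k i)\<^sup>2)) * (- 1 / 2)"
      unfolding slice_term_def coeff_smult s by simp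
  qed
  also have "\<dots> = norm_sq_sum \<tau> N * (- 1 / 2)"
    unfolding norm_sq_sum_def by (rule infsum_cmult_left')
  finally have 1: "coeff (slice_poly \<tau> N) e = norm_sq_sum \<tau> N * (- 1 / 2)" .
  have 2: "M / fact (N - 1) * coeff (slice_poly \<tau> N) e = G * coeff R e"
    using arg_cong[OF slice_proportional, of "\<lambda>p. coeff p e"] by (simp add: M_def G_def)
  define D where "D = of_real (\<Sum>i\<in>{1..<N}. (rho N i)\<^sup>2) - 2 * of_nat N * of_nat (N - 1) * of_nat (N - 2) * sigma_series \<tau>"
  have "coeff R e = - (M * D) / (2 * fact (N - 1))"
    unfolding coeff_residue_sub[OF e] second_moment M_def[symmetric] D_def
    by (simp add: right_diff_distrib mult_ac)
  with 1 2 have "M * norm_sq_sum \<tau> N = M * (G * D)" by (simp add: field_simps)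
  then show ?thesis using sum_h_nonzero by (simp add: M_def G_def D_def)
qed

section \<open>The normalisation: a differential equation in the modular parameter\<close>

lemma sum_rho_sq:
  assumes "N \<ge> 2"
  shows "(\<Sum>i\<in>{1..<N}. (rho N i)\<^sup>2) = real N * (real N - 1) * (real N - 2) / 12"
proof -
  have 1: "(\<Sum>i\<in>{1..<M}. real i) = real M * (real M - 1) / 2" if "M \<ge> 1" for M
    using that by (induction M rule: dec_induct) (auto simp: field_simps)
  have 2: "(\<Sum>i\<in>{1..<M}. (real i)\<^sup>2) = (real M - 1) * real M * (2 * real M - 1) / 6" if "M \<ge> 1" for M
    using that by (induction M rule: dec_induct) (auto simp: field_simps power2_eq_square)
  have "(\<Sum>i\<in>{1..<N}. (rho N i)\<^sup>2) = (\<Sum>i\<in>{1..<N}. (real N)\<^sup>2 / 4 - real N * real i + (real i)\<^sup>2)"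
    by (intro sum.cong) (auto simp: rho_def power2_eq_square field_simps)
  also have "\<dots> = real (N - 1) * ((real N)\<^sup>2 / 4) - real N * (\<Sum>i\<in>{1..<N}. real i) + (\<Sum>i\<in>{1..<N}. (real i)\<^sup>2)"
    by (simp add: sum.distrib sum_subtractf sum_distrib_left)
  also have "\<dots> = real N * (real N - 1) * (real N - 2) / 12"
    using assms by (subst 1, simp, subst 2, simp) (simp add: of_nat_diff field_simps power2_eq_square)
  finally show ?thesis .
qed

lemma vdm_slice_summable:
  assumes "Im \<tau> > 0" "N \<ge> 2"
  shows "(\<lambda>k. weight \<tau> N k * of_real (vdm N (lat N k))) summable_on Lat_slice N 0"
  by (rule summable_on_subset_banach[OF weighted_lattice_summable[OF assms exp_growth_vdm[OF assms(2)]]])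
     (auto simp: Lat_slice_def)

lemma DERIV_slice_sum:
  assumes \<tau>: "Im \<tau> > 0" and N: "N \<ge> 2"
  shows "((\<lambda>\<tau>. slice_sum \<tau> N (\<lambda>_. 1) 0) has_field_derivative
    2 * of_real pi * \<i> / (2 * (of_nat N - 1)) * norm_sq_sum \<tau> N) (at \<tau>)"
proof -
  define E where "E = (\<lambda>k. (\<Sum>i\<in>{1..<N}. (lat N k i)\<^sup>2) / (2 * (real N - 1)))"
  define a where "a = (\<lambda>k. 2 * of_real pi * \<i> * complex_of_real (E k))"
  define v where "v = (\<lambda>k. weight \<tau> N k * of_real (vdm N (lat N k)))"
  define \<delta> where "\<delta> = Im \<tau> / 2"
  have \<delta>: "\<delta> > 0" using \<tau> by (simp add: \<delta>_def)
  have E0: "E k \<ge> 0" for k using N by (auto simp: E_def intro!: divide_nonneg_nonneg sum_nonneg)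
  have wE: "weight \<tau> N k = qpow \<tau> (E k)" for \<tau> k by (simp add: weight_def E_def)
  have wt: "weight (\<tau> + w) N k = weight \<tau> N k * exp (a k * w)" for w k
    by (simp add: weight_def qpow_def a_def E_def ring_distribs exp_add)
  have "((\<lambda>w. \<Sum>\<^sub>\<infinity>k\<in>Lat_slice N 0. v k * exp (a k * w)) has_field_derivative (\<Sum>\<^sub>\<infinity>k\<in>Lat_slice N 0. v k * a k)) (at 0)"
  proof (rule DERIV_infsum_exp[OF \<delta>])
    \<comment> \<open>The exponential majorant is the same series at a point lower in the upper half-plane.\<close>
    from \<delta> have "Im (\<i> * of_real (Im \<tau> - \<delta>)) > 0" by (simp add: \<delta>_def)
    from summable_on_normD[OF vdm_slice_summable[OF this N]]
    show "(\<lambda>k. norm (v k) * exp (\<delta> * norm (a k))) summable_on Lat_slice N 0"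
    proof (rule summable_on_cong[THEN iffD1, rotated])
      fix k
      have "norm (a k) = 2 * pi * E k" using E0[of k] by (simp add: a_def norm_mult)
      then show "norm (weight (\<i> * of_real (Im \<tau> - \<delta>)) N k * of_real (vdm N (lat N k))) = norm (v k) * exp (\<delta> * norm (a k))"
        by (simp add: v_def norm_mult wE norm_qpow mult_ac flip: exp_add)
           (simp add: algebra_simps)
    qed
  qed
  also have "(\<lambda>w. \<Sum>\<^sub>\<infinity>k\<in>Lat_slice N 0. v k * exp (a k * w)) = (\<lambda>w. slice_sum (w + \<tau>) N (\<lambda>_. 1) 0)"
    unfolding slice_sum_def v_def
    by (intro ext infsum_cong) (simp add: add.commute[of _ \<tau>] wt)
  also have "(\<Sum>\<^sub>\<infinity>k\<in>Lat_slice N 0. v k * a k) = 2 * of_real pi * \<i> / (2 * (of_nat N - 1)) * norm_sq_sum \<tau> N"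
    unfolding norm_sq_sum_def infsum_cmult_right'[symmetric]
    by (rule infsum_cong) (simp add: v_def a_def E_def mult_ac)
  finally show ?thesis
    using DERIV_shift[of "\<lambda>\<tau>. slice_sum \<tau> N (\<lambda>_. 1) 0" _ 0 \<tau>] by simp
qed

text \<open>The differentiated series has \<open>Suc j\<close> in place of \<open>m\<close>; the symmetry of \<open>q ^ (m * Suc j)\<close> makes it the
  same divisor sum as in \<open>second_moment\<close>.\<close>

lemma DERIV_log_poch_nome:
  assumes \<tau>: "Im \<tau> > 0"
  shows "((\<lambda>\<tau>. log_poch \<tau> (nome \<tau>)) has_field_derivative 2 * of_real pi * \<i> * sigma_series \<tau>) (at \<tau>)"
proof -
  define I where "I = {1::nat..} \<times> (UNIV :: nat set)"
  define a where "a = (\<lambda>(m, j). 2 * of_real pi * \<i> * complex_of_real (real (m * Suc j)))"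
  define v where "v = (\<lambda>(m, j). nome \<tau> ^ (m * Suc j) / of_nat m)"
  define \<delta> where "\<delta> = Im \<tau> / 2"
  have \<delta>: "\<delta> > 0" using \<tau> by (simp add: \<delta>_def)
  have nt: "nome (\<tau> + w) ^ k = nome \<tau> ^ k * exp (2 * of_real pi * \<i> * complex_of_real (real k) * w)" for w k
    by (simp add: qpow_power) (simp add: qpow_def ring_distribs exp_add)
  have "((\<lambda>w. \<Sum>\<^sub>\<infinity>p\<in>I. v p * exp (a p * w)) has_field_derivative (\<Sum>\<^sub>\<infinity>p\<in>I. v p * a p)) (at 0)"
  proof (rule DERIV_infsum_exp[OF \<delta>])
    \<comment> \<open>The exponential majorant is the same series at a point lower in the upper half-plane.\<close>
    define \<tau>' where "\<tau>' = \<i> * of_real (Im \<tau> - \<delta>)"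
    have \<tau>': "Im \<tau>' > 0" using \<delta> by (simp add: \<delta>_def \<tau>'_def)
    from summable_on_normD[OF log_poch_summable[OF this nome_bounds(2)[OF this]]]
    show "(\<lambda>p. norm (v p) * exp (\<delta> * norm (a p))) summable_on I"
      unfolding I_def
    proof (rule summable_on_cong[THEN iffD1, rotated])
      fix p :: "nat \<times> nat"
      obtain m j where p: "p = (m, j)" by force
      have "nome \<tau>' ^ m * nome \<tau>' ^ (m * j) = nome \<tau>' ^ (m * Suc j)" by (simp add: power_add)
      moreover have "norm (nome \<tau>' ^ k) = norm (nome \<tau> ^ k) * exp (\<delta> * (2 * pi * real k))" for k
        by (simp add: qpow_power norm_qpow \<tau>'_def flip: exp_add) (simp add: algebra_simps)
      ultimately show "norm (case p of (m, j) \<Rightarrow> nome \<tau>' ^ m * nome \<tau>' ^ (m * j) / of_nat m) = norm (v p) * exp (\<delta> * norm (a p))"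
        by (simp add: p v_def a_def norm_divide norm_mult del: of_nat_Suc of_nat_mult mult_Suc_right)
    qed
  qed
  also have "(\<lambda>w. \<Sum>\<^sub>\<infinity>p\<in>I. v p * exp (a p * w)) = (\<lambda>w. log_poch (w + \<tau>) (nome (w + \<tau>)))"
  proof (rule ext, unfold log_poch_def I_def, rule infsum_cong)
    fix w p assume "p \<in> {1::nat..} \<times> (UNIV :: nat set)"
    obtain m j where p: "p = (m, j)" by force
    have "nome (w + \<tau>) ^ m * nome (w + \<tau>) ^ (m * j) = nome (\<tau> + w) ^ (m * Suc j)" by (simp add: power_add add.commute)
    then show "v p * exp (a p * w) = (case p of (m, j) \<Rightarrow> nome (w + \<tau>) ^ m * nome (w + \<tau>) ^ (m * j) / of_nat m)"
      unfolding p prod.case nt by (simp add: v_def a_def)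
  qed
  also have "(\<Sum>\<^sub>\<infinity>p\<in>I. v p * a p) = 2 * of_real pi * \<i> * (\<Sum>\<^sub>\<infinity>(m, j)\<in>I. of_nat (Suc j) * nome \<tau> ^ (m * Suc j))"
    unfolding infsum_cmult_right'[symmetric] I_def
    by (rule infsum_cong) (auto simp: v_def a_def field_simps)
  also have "(\<Sum>\<^sub>\<infinity>(m, j)\<in>I. of_nat (Suc j) * nome \<tau> ^ (m * Suc j)) = sigma_series \<tau>"
    unfolding sigma_series_def I_def
    by (rule infsum_reindex_bij_witness[of _ "\<lambda>(m, j). (Suc j, m - 1)" "\<lambda>(m, j). (Suc j, m - 1)"])
       (auto simp: Suc_le_eq gr0_conv_Suc algebra_simps)
  finally show ?thesis
    using DERIV_shift[of "\<lambda>\<tau>. log_poch \<tau> (nome \<tau>)" _ 0 \<tau>] by simp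
qed

lemma vdm_rho:
  assumes "N \<ge> 2"
  shows "vdm N (rho M) = real (superfact (N - 2))"
  using assms
proof (induction N rule: dec_induct)
  case base
  have "idx_pairs 2 = {}" by (auto simp: idx_pairs_def)
  then show ?case by (simp add: vdm_def superfact_def)
next
  case (step N)
  have "(\<Prod>c\<in>{1..<N}. rho M c - rho M N) = (\<Prod>c\<in>{1..N - 1}. real c)"
    by (rule prod.reindex_bij_witness[of _ "\<lambda>c. N - c" "\<lambda>c. N - c"]) (use step in \<open>auto simp: rho_def of_nat_diff\<close>)
  also have "\<dots> = fact (N - 1)" by (simp add: fact_prod)
  finally have "vdm (Suc N) (rho M) = real (superfact (N - 2)) * fact (N - 1)"
    unfolding vdm_Suc using step by simp
  moreover have "superfact (Suc N - 2) = superfact (N - 2) * fact (N - 1)"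
  proof -
    obtain n where "N = Suc (Suc n)" using step by (metis Suc_1 add_2_eq_Suc le_Suc_ex)
    then show ?thesis by (simp add: superfact_def)
  qed
  ultimately show ?case by simp
qed

text \<open>For an integer \<open>k\<close>, \<open>k\<^sup>2 \<ge> |k|\<close> and \<open>|rho N i| \<le> (N - 2) / 2\<close>, so each nonzero \<open>k i\<close> costs at least
  \<open>|k i| / 2\<close>. The Weyl vector is thus the only shortest vector.\<close>

lemma lattice_norm_gap:
  assumes N: "N \<ge> 2" and k: "i0 \<in> {1..<N}" "k i0 \<noteq> 0"
  shows "(\<Sum>i\<in>{1..<N}. (rho N i)\<^sup>2) / (2 * (real N - 1)) + 1 / 2 \<le> (\<Sum>i\<in>{1..<N}. (lat N k i)\<^sup>2) / (2 * (real N - 1))"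
proof -
  define n where "n = real N - 1"
  have n: "n > 0" using N by (simp add: n_def)
  have le: "(rho N i)\<^sup>2 / (2 * n) + \<bar>real_of_int (k i)\<bar> / 2 \<le> (lat N k i)\<^sup>2 / (2 * n)" if i: "i \<in> {1..<N}" for i
  proof -
    define x where "x = real_of_int (k i)"
    have "(lat N k i)\<^sup>2 / (2 * n) = (rho N i)\<^sup>2 / (2 * n) + rho N i * x + n / 2 * x\<^sup>2"
      using n by (simp add: lat_def n_def[symmetric] x_def field_simps power2_eq_square)
    moreover have "- (rho N i * x) \<le> (n - 1) / 2 * \<bar>x\<bar>"
    proof -
      have "\<bar>rho N i\<bar> \<le> (n - 1) / 2" using i by (auto simp: rho_def n_def abs_le_iff field_simps)
      then have "\<bar>rho N i * x\<bar> \<le> (n - 1) / 2 * \<bar>x\<bar>" unfolding abs_mult by (intro mult_right_mono) auto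
      then show ?thesis by linarith
    qed
    moreover have "n / 2 * \<bar>x\<bar> \<le> n / 2 * x\<^sup>2"
    proof (intro mult_left_mono)
      have "\<bar>k i\<bar> \<le> \<bar>k i\<bar> * \<bar>k i\<bar>"
        using mult_left_mono[of 1 "\<bar>k i\<bar>" "\<bar>k i\<bar>"] by (cases "k i = 0") auto
      then have "real_of_int \<bar>k i\<bar> \<le> of_int (\<bar>k i\<bar> * \<bar>k i\<bar>)" by (simp only: of_int_le_iff)
      then show "\<bar>x\<bar> \<le> x\<^sup>2" by (simp add: x_def power2_eq_square)
    qed (use n in simp)
    ultimately show ?thesis unfolding x_def by (simp add: field_simps)
  qed
  have "1 \<le> \<bar>k i0\<bar>" using k by simp
  then have "(1::real) \<le> \<bar>of_int (k i0)\<bar>" by (simp flip: of_int_abs)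
  also have "\<dots> \<le> lat_size N k" using k by (intro member_le_sum) auto
  finally have "1 / 2 \<le> (\<Sum>i\<in>{1..<N}. \<bar>real_of_int (k i)\<bar> / 2)" by (simp flip: sum_divide_distrib)
  then have "(\<Sum>i\<in>{1..<N}. (rho N i)\<^sup>2) / (2 * n) + 1 / 2
      \<le> (\<Sum>i\<in>{1..<N}. (rho N i)\<^sup>2 / (2 * n) + \<bar>real_of_int (k i)\<bar> / 2)"
    by (simp add: sum.distrib sum_divide_distrib)
  also have "\<dots> \<le> (\<Sum>i\<in>{1..<N}. (lat N k i)\<^sup>2 / (2 * n))" by (intro sum_mono le)
  finally show ?thesis by (simp add: n_def sum_divide_distrib)
qed

lemma log_poch_nome_decay: "((\<lambda>y. log_poch (\<i> * of_real y) (nome (\<i> * of_real y))) \<longlongrightarrow> 0) at_top"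
proof -
  define I where "I = {1::nat..} \<times> (UNIV :: nat set)"
  define E where "E = (\<lambda>(m, j). 2 * pi * real (m * Suc j))"
  define b where "b = (\<lambda>(m::nat, j::nat). 1 / of_nat m :: complex)"
  have eq: "b p * of_real (exp (- (y * E p))) = (case p of (m, j) \<Rightarrow> nome (\<i> * of_real y) ^ m * nome (\<i> * of_real y) ^ (m * j) / of_nat m)" for p y
  proof -
    obtain m j where p: "p = (m, j)" by force
    have "nome (\<i> * of_real y) ^ m * nome (\<i> * of_real y) ^ (m * j) = nome (\<i> * of_real y) ^ (m * Suc j)"
      by (simp add: power_add)
    also have "\<dots> = of_real (exp (- (y * E p)))"
      unfolding qpow_power by (simp add: qpow_def E_def p mult_ac flip: exp_of_real)
    finally show ?thesis by (simp add: p b_def)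
  qed
  have "((\<lambda>y. \<Sum>\<^sub>\<infinity>p\<in>I. b p * of_real (exp (- (y * E p)))) \<longlongrightarrow> 0) at_top"
  proof (rule infsum_exp_decay[of "2 * pi"])
    fix p assume "p \<in> I"
    then obtain m j where p: "p = (m, j)" "m \<ge> 1" by (auto simp: I_def)
    then have "1 \<le> m * Suc j" by simp
    then have "real 1 \<le> real (m * Suc j)" by (rule of_nat_mono)
    from mult_left_mono[OF this, of "2 * pi"] show "2 * pi \<le> E p" by (simp add: E_def p)
  next
    have "(\<lambda>(m, j). nome \<i> ^ m * nome \<i> ^ (m * j) / of_nat m) summable_on I"
      unfolding I_def by (rule log_poch_summable) (use nome_bounds(2)[of \<i>] in auto)
    then show "(\<lambda>p. b p * of_real (exp (- E p))) summable_on I"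
      using eq[of _ 1] by simp
  qed simp
  then show ?thesis unfolding eq log_poch_def I_def .
qed

text \<open>The Macdonald identity for \<open>sl(N - 1)\<close>. The quotient of the two sides has derivative \<open>0\<close> on
  the upper half-plane by \<open>norm_sq_sum_eq\<close> and \<open>DERIV_log_poch_nome\<close>. Along the imaginary axis only the
  shortest vector survives in the limit.\<close>

theorem slice_sum_eq_eta_power:
  assumes \<tau>: "Im \<tau> > 0" and N: "N \<ge> 2"
  shows "slice_sum \<tau> N (\<lambda>_. 1) 0 = of_nat (superfact (N - 2)) * dedekind_eta \<tau> ^ (N * (N - 2))"
proof -
  define e0 where "e0 = real N * (real N - 2) / 24"
  have rr: "(\<Sum>i\<in>{1..<N}. (rho N i)\<^sup>2) = 2 * (real N - 1) * e0"
    unfolding sum_rho_sq[OF N] e0_def by simp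
  have e0': "real (N * (N - 2)) = 24 * e0" using N by (simp add: e0_def of_nat_diff)
  have N2: "of_nat N * of_nat (N - 2) = complex_of_real (24 * e0)"
    unfolding e0'[symmetric] by simp
  define G where "G = (\<lambda>\<tau>. slice_sum \<tau> N (\<lambda>_. 1) 0)"
  define D where "D = (\<lambda>\<tau>. G \<tau> * exp (- (2 * of_real pi * \<i> * of_real e0 * \<tau>)) * exp (of_real (24 * e0) * log_poch \<tau> (nome \<tau>)))"
  define U where "U = {\<tau>. Im \<tau> > 0}"
  have D': "(D has_field_derivative 0) (at \<tau>)" if \<tau>: "\<tau> \<in> U" for \<tau>
  proof -
    have im: "Im \<tau> > 0" using \<tau> by (simp add: U_def)
    have n0: "of_nat N - 1 \<noteq> (0::complex)" using N by (metis Suc_1 not_less_eq_eq of_nat_1 of_nat_eq_iff order_refl right_minus_eq)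
    have n1: "of_nat (N - 1) = of_nat N - (1::complex)" using N by (simp add: of_nat_diff)
    have "2 * of_real pi * \<i> / (2 * (of_nat N - 1)) * norm_sq_sum \<tau> N
        = 2 * of_real pi * \<i> / (2 * (of_nat N - 1)) * (G \<tau> * (2 * (of_nat N - 1) * (of_real e0 - of_real (24 * e0) * sigma_series \<tau>)))"
    proof -
      have "of_real (\<Sum>i\<in>{1..<N}. (rho N i)\<^sup>2) - 2 * of_nat N * of_nat (N - 1) * of_nat (N - 2) * sigma_series \<tau>
          = 2 * (of_nat N - 1) * of_real e0 - 2 * (of_nat N - 1) * (of_nat N * of_nat (N - 2)) * sigma_series \<tau>"
        unfolding rr n1 by simp
      then show ?thesis unfolding norm_sq_sum_eq[OF im N] G_def N2 by (simp add: right_diff_distrib)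
    qed
    also have "\<dots> = 2 * of_real pi * \<i> * G \<tau> * (of_real e0 - of_real (24 * e0) * sigma_series \<tau>)"
      using n0 by simp
    finally have dG: "(G has_field_derivative 2 * of_real pi * \<i> * G \<tau> * (of_real e0 - of_real (24 * e0) * sigma_series \<tau>)) (at \<tau>)"
      using DERIV_slice_sum[OF im N] by (simp add: G_def)
    have "(D has_field_derivative
       (2 * of_real pi * \<i> * G \<tau> * (of_real e0 - of_real (24 * e0) * sigma_series \<tau>) * exp (- (2 * of_real pi * \<i> * of_real e0 * \<tau>))
         + exp (- (2 * of_real pi * \<i> * of_real e0 * \<tau>)) * (- (2 * of_real pi * \<i> * of_real e0)) * G \<tau>) * exp (of_real (24 * e0) * log_poch \<tau> (nome \<tau>))
       + exp (of_real (24 * e0) * log_poch \<tau> (nome \<tau>)) * (of_real (24 * e0) * (2 * of_real pi * \<i> * sigma_series \<tau>)) * (G \<tau> * exp (- (2 * of_real pi * \<i> * of_real e0 * \<tau>)))) (at \<tau>)"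
      unfolding D_def
      by (intro DERIV_mult dG DERIV_cmult DERIV_log_poch_nome[OF im] DERIV_chain2[OF DERIV_exp])
         (auto intro!: derivative_eq_intros)
    then show ?thesis by (rule DERIV_cong) (simp add: algebra_simps)
  qed
  have "convex U" unfolding U_def by (rule convex_halfspace_Im_gt)
  then obtain C where C: "\<And>\<tau>. \<tau> \<in> U \<Longrightarrow> D \<tau> = C"
    using has_field_derivative_zero_constant[of U D] D' has_field_derivative_at_within by blast
  define z where "z = restrict (\<lambda>_. 0 :: int) {1..<N}"
  have z: "z \<in> Lat_slice N 0" by (simp add: z_def Lat_slice_def)
  have Vz: "vdm N (lat N z) = real (superfact (N - 2))"
    using vdm_cong[of N "lat N z" "rho N"] vdm_rho[OF N] by (simp add: lat_def z_def)
  define E where "E = (\<lambda>k. (\<Sum>i\<in>{1..<N}. (lat N k i)\<^sup>2) / (2 * (real N - 1)))"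
  define v where "v = (\<lambda>k. complex_of_real (vdm N (lat N k)))"
  have Ez: "E z = e0"
  proof -
    have "(\<Sum>i\<in>{1..<N}. (lat N z i)\<^sup>2) = (\<Sum>i\<in>{1..<N}. (rho N i)\<^sup>2)"
      by (intro sum.cong) (auto simp: lat_def z_def)
    then show ?thesis unfolding E_def rr using N by simp
  qed
  define E' where "E' = (\<lambda>k. 2 * pi * (E k - e0))"
  have term_eq: "weight (\<i> * of_real y) N k * v k * exp (- (2 * of_real pi * \<i> * of_real e0 * (\<i> * of_real y))) = v k * of_real (exp (- (y * E' k)))" for y k
  proof -
    have "weight (\<i> * of_real y) N k = exp (2 * of_real pi * \<i> * of_real (E k) * (\<i> * of_real y))"
      by (simp add: weight_def E_def qpow_def)
    then have "weight (\<i> * of_real y) N k * exp (- (2 * of_real pi * \<i> * of_real e0 * (\<i> * of_real y)))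
        = exp (2 * of_real pi * \<i> * of_real (E k) * (\<i> * of_real y) - 2 * of_real pi * \<i> * of_real e0 * (\<i> * of_real y))"
      by (simp add: exp_diff exp_minus divide_inverse)
    also have "2 * of_real pi * \<i> * of_real (E k) * (\<i> * of_real y) - 2 * of_real pi * \<i> * of_real e0 * (\<i> * of_real y) = of_real (- (y * E' k))"
      by (simp add: E'_def algebra_simps)
    finally show ?thesis by (simp only: exp_of_real mult_ac)
  qed
  have sm: "(\<lambda>k. v k * of_real (exp (- (y * E' k)))) summable_on Lat_slice N 0" if "y > 0" for y
  proof -
    have "Im (\<i> * of_real y) > 0" using that by simp
    from summable_on_cmult_left[OF vdm_slice_summable[OF this N], of "exp (- (2 * of_real pi * \<i> * of_real e0 * (\<i> * of_real y)))"]
    show ?thesis unfolding term_eq[symmetric] by (simp only: v_def)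
  qed
  have lim1: "((\<lambda>y. \<Sum>\<^sub>\<infinity>k\<in>Lat_slice N 0 - {z}. v k * of_real (exp (- (y * E' k)))) \<longlongrightarrow> 0) at_top"
  proof (rule infsum_exp_decay[of pi])
    fix k assume k: "k \<in> Lat_slice N 0 - {z}"
    then obtain i where i: "i \<in> {1..<N}" "k i \<noteq> 0"
      by (auto simp: z_def Lat_slice_def PiE_def extensional_def restrict_def fun_eq_iff) metis
    from lattice_norm_gap[where k = k, OF N this] have "e0 + 1 / 2 \<le> E k"
      unfolding rr E_def using N by simp
    then have "1 / 2 \<le> E k - e0" by simp
    from mult_left_mono[OF this, of "2 * pi"] show "pi \<le> E' k" by (simp add: E'_def)
  next
    show "(\<lambda>k. v k * of_real (exp (- E' k))) summable_on Lat_slice N 0 - {z}"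
      using sm[of 1] by (rule_tac summable_on_subset_banach[OF _ Diff_subset]) simp
  qed simp
  have G_eq: "G (\<i> * of_real y) * exp (- (2 * of_real pi * \<i> * of_real e0 * (\<i> * of_real y)))
      = v z + (\<Sum>\<^sub>\<infinity>k\<in>Lat_slice N 0 - {z}. v k * of_real (exp (- (y * E' k))))" if y: "y > 0" for y
  proof -
    have "G (\<i> * of_real y) * exp (- (2 * of_real pi * \<i> * of_real e0 * (\<i> * of_real y)))
        = (\<Sum>\<^sub>\<infinity>k\<in>Lat_slice N 0. v k * of_real (exp (- (y * E' k))))"
      unfolding G_def slice_sum_def infsum_cmult_left'[symmetric] term_eq[symmetric]
      by (rule infsum_cong) (simp add: v_def)
    also have "Lat_slice N 0 = insert z (Lat_slice N 0 - {z})" using z by blast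
    also have "(\<Sum>\<^sub>\<infinity>k\<in>insert z (Lat_slice N 0 - {z}). v k * of_real (exp (- (y * E' k))))
        = v z * of_real (exp (- (y * E' z))) + (\<Sum>\<^sub>\<infinity>k\<in>Lat_slice N 0 - {z}. v k * of_real (exp (- (y * E' k))))"
      by (rule infsum_insert[OF summable_on_subset_banach[OF sm[OF y] Diff_subset]]) simp
    finally show ?thesis by (simp add: E'_def Ez)
  qed
  have "((\<lambda>y. (v z + (\<Sum>\<^sub>\<infinity>k\<in>Lat_slice N 0 - {z}. v k * of_real (exp (- (y * E' k)))))
      * exp (of_real (24 * e0) * log_poch (\<i> * of_real y) (nome (\<i> * of_real y)))) \<longlongrightarrow> (v z + 0) * exp (of_real (24 * e0) * 0)) at_top"
    by (intro tendsto_intros lim1 log_poch_nome_decay)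
  moreover have "\<forall>\<^sub>F y in at_top. (v z + (\<Sum>\<^sub>\<infinity>k\<in>Lat_slice N 0 - {z}. v k * of_real (exp (- (y * E' k)))))
      * exp (of_real (24 * e0) * log_poch (\<i> * of_real y) (nome (\<i> * of_real y))) = C"
    using eventually_gt_at_top[of 0]
  proof eventually_elim
    case (elim y)
    then show ?case using C[of "\<i> * of_real y"] G_eq[OF elim] by (simp add: D_def U_def)
  qed
  ultimately have "((\<lambda>_. C) \<longlongrightarrow> v z) (at_top :: real filter)"
    using Lim_transform_eventually by fastforce
  then have "C = v z" using tendsto_unique[OF _ tendsto_const] by force
  with C[of \<tau>] \<tau> have "G \<tau> * exp (- (2 * of_real pi * \<i> * of_real e0 * \<tau>)) * exp (of_real (24 * e0) * log_poch \<tau> (nome \<tau>)) = v z"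
    by (simp add: D_def U_def)
  then have "G \<tau> = v z * exp (2 * of_real pi * \<i> * of_real e0 * \<tau>) * exp (- (of_real (24 * e0) * log_poch \<tau> (nome \<tau>)))"
    by (simp add: exp_minus field_simps)
  also have "exp (2 * of_real pi * \<i> * of_real e0 * \<tau>) = qpow \<tau> (1/24) ^ (N * (N - 2))"
    unfolding qpow_power e0' by (simp add: qpow_def)
  also have "exp (- (of_real (24 * e0) * log_poch \<tau> (nome \<tau>))) = qpoch_inf \<tau> (nome \<tau>) ^ (N * (N - 2))"
  proof -
    have "qpoch_inf \<tau> (nome \<tau>) ^ (N * (N - 2)) = exp (of_nat (N * (N - 2)) * (- log_poch \<tau> (nome \<tau>)))"
      unfolding qpoch_inf_eq_exp[OF \<tau> nome_bounds(2)[OF \<tau>]] exp_of_nat_mult ..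
    also have "of_nat (N * (N - 2)) = complex_of_real (24 * e0)" using N2 by simp
    finally show ?thesis by simp
  qed
  finally show ?thesis by (simp add: G_def v_def Vz dedekind_eta_def power_mult_distrib)
qed

section \<open>Coordinates on the root lattice\<close>

text \<open>For \<open>t\<close> with \<open>t 0 = t N = 0\<close> these are the coordinates with respect to an orthonormal basis
  \<open>\<epsilon>\<^sub>1, \<dots>, \<epsilon>\<^sub>N\<close> in which the simple roots are \<open>\<epsilon>\<^sub>n - \<epsilon>\<^sub>n\<^sub>+\<^sub>1\<close>.\<close>

definition root_coord :: "(nat \<Rightarrow> real) \<Rightarrow> nat \<Rightarrow> real" where
  "root_coord t i = t i - t (i - 1)"

text \<open>Summation by parts: the Cartan matrix is the second difference operator.\<close>

lemma bilin_root_coord: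
  assumes t: "t 0 = 0" "t N = 0" and u: "u 0 = 0" "u N = 0" and N: "N \<ge> 1"
  shows "bilin N t u = (\<Sum>i\<in>{1..N}. root_coord t i * root_coord u i)"
proof -
  have inner: "(\<Sum>n\<in>{1..<N}. cartan_sl m n * u n) = root_coord u m - root_coord u (Suc m)" if m: "m \<in> {1..<N}" for m
  proof -
    have "(\<Sum>n\<in>{1..<N}. cartan_sl m n * u n) = (\<Sum>n\<in>{..N}. cartan_sl m n * u n)"
      by (rule sum.mono_neutral_left) (use u in \<open>auto simp: not_less_eq_eq not_less le_less_Suc_eq\<close>)
    also have "\<dots> = (\<Sum>n\<in>{..N}. (if n = m then 2 * u n else 0) + ((if n = m - 1 then - u n else 0) + (if n = Suc m then - u n else 0)))"
      using m by (intro sum.cong) (auto simp: cartan_sl_def)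
    also have "\<dots> = 2 * u m - u (m - 1) - u (Suc m)"
    proof -
      have "m - 1 \<le> N" "Suc m \<le> N" "m \<le> N" using m by auto
      then show ?thesis by (simp add: sum.distrib sum.delta)
    qed
    finally show ?thesis by (simp add: root_coord_def)
  qed
  have "bilin N t u = (\<Sum>m\<in>{1..<N}. t m * (\<Sum>n\<in>{1..<N}. cartan_sl m n * u n))"
    unfolding bilin_def by (simp add: sum_distrib_left mult.assoc)
  also have "\<dots> = (\<Sum>m\<in>{1..<N}. t m * (root_coord u m - root_coord u (Suc m)))"
    by (intro sum.cong refl) (simp only: inner)
  also have "\<dots> = (\<Sum>m\<in>{1..<N}. t m * root_coord u m) - (\<Sum>m\<in>{1..<N}. t m * root_coord u (Suc m))"
    by (simp add: right_diff_distrib sum_subtractf)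
  also have "(\<Sum>m\<in>{1..<N}. t m * root_coord u m) = (\<Sum>i\<in>{1..N}. t i * root_coord u i)"
    by (rule sum.mono_neutral_left) (use t in \<open>auto simp: not_less\<close>)
  also have "(\<Sum>m\<in>{1..<N}. t m * root_coord u (Suc m)) = (\<Sum>m\<in>{0..<N}. t m * root_coord u (Suc m))"
    by (rule sum.mono_neutral_left) (use t in \<open>auto simp: not_le\<close>)
  also have "\<dots> = (\<Sum>i\<in>{1..N}. t (i - 1) * root_coord u i)"
    by (rule sum.reindex_bij_witness[of _ "\<lambda>i. i - 1" Suc]) auto
  finally show ?thesis by (simp add: root_coord_def left_diff_distrib sum_subtractf)
qed

lemma bilin_root_sum:
  assumes t: "t 0 = 0" "t N = 0" and ij: "1 \<le> i" "i \<le> j" "j < N"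
  shows "bilin N t (root_sum i j) = root_coord t i - root_coord t (Suc j)"
proof -
  have "bilin N t (root_sum i j) = (\<Sum>l\<in>{1..N}. root_coord t l * root_coord (root_sum i j) l)"
    using ij by (intro bilin_root_coord t) (auto simp: root_sum_def)
  also have "\<dots> = (\<Sum>l\<in>{1..N}. (if l = i then root_coord t l else 0) - (if l = Suc j then root_coord t l else 0))"
    using ij by (intro sum.cong refl) (auto simp: root_coord_def root_sum_def)
  also have "\<dots> = root_coord t i - root_coord t (Suc j)"
    using ij by (simp add: sum_subtractf sum.delta)
  finally show ?thesis .
qed

lemma prod_pos_roots:
  assumes t: "t 0 = 0" "t N = 0" and N: "N \<ge> 2"
  shows "(\<Prod>\<alpha>\<in>pos_roots N. bilin N t \<alpha>) = vdm (Suc N) (root_coord t)"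
proof -
  have bij: "bij_betw (\<lambda>p. root_sum (fst p) (snd p - 1)) (idx_pairs (Suc N)) (pos_roots N)"
      unfolding bij_betw_def
    proof
      show "inj_on (\<lambda>p. root_sum (fst p) (snd p - 1)) (idx_pairs (Suc N))"
        by (rule inj_onI) (auto simp: idx_pairs_def root_sum_eq_iff)
      show "(\<lambda>p. root_sum (fst p) (snd p - 1)) ` idx_pairs (Suc N) = pos_roots N"
      proof (intro equalityI subsetI)
        fix \<alpha> assume "\<alpha> \<in> pos_roots N"
        then obtain i j where "\<alpha> = root_sum i j" "1 \<le> i" "i \<le> j" "j \<le> N - 1" by (auto simp: pos_roots_def)
        then show "\<alpha> \<in> (\<lambda>p. root_sum (fst p) (snd p - 1)) ` idx_pairs (Suc N)"
          using N by (intro image_eqI[of _ _ "(i, Suc j)"]) (auto simp: idx_pairs_def)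
      next
        fix \<alpha> assume "\<alpha> \<in> (\<lambda>p. root_sum (fst p) (snd p - 1)) ` idx_pairs (Suc N)"
        then obtain a b where ab: "\<alpha> = root_sum a (b - 1)" "1 \<le> a" "a < b" "b < Suc N"
          by (auto simp: idx_pairs_def)
        show "\<alpha> \<in> pos_roots N"
          unfolding pos_roots_def using ab by (intro CollectI exI[of _ a] exI[of _ "b - 1"]) auto
      qed
    qed
  have "(\<Prod>\<alpha>\<in>pos_roots N. bilin N t \<alpha>) = (\<Prod>(a, b)\<in>idx_pairs (Suc N). bilin N t (root_sum a (b - 1)))"
    unfolding case_prod_unfold by (rule prod.reindex_bij_betw[OF bij, symmetric])
  also have "\<dots> = vdm (Suc N) (root_coord t)"
    unfolding vdm_def by (intro prod.cong) (auto simp: idx_pairs_def bilin_root_sum[OF t])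
  finally show ?thesis .
qed

text \<open>The common translation between the first \<open>N - 1\<close> root coordinates of the elements of \<open>T_set N s\<close> and \<open>lat\<close>.\<close>

definition offset :: "nat \<Rightarrow> int \<Rightarrow> real" where
  "offset N s = 1 / 2 - of_int s / real N"

definition lat_vector :: "nat \<Rightarrow> int \<Rightarrow> (nat \<Rightarrow> int) \<Rightarrow> nat \<Rightarrow> real" where
  "lat_vector N s k = (\<lambda>n. if n \<in> {1..<N} then \<Sum>i\<in>{1..n}. lat N k i + offset N s else 0)"

text \<open>The range of the total that the sign condition in \<open>T_set\<close> selects.\<close>

definition slices :: "int \<Rightarrow> int set" where
  "slices s = (if s \<ge> 0 then {0..} else {..<0})"

abbreviation lat_total :: "nat \<Rightarrow> (nat \<Rightarrow> int) \<Rightarrow> int" where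
  "lat_total N k \<equiv> \<Sum>i\<in>{1..<N}. k i"

lemma partial_sums_lat:
  "(\<Sum>i\<in>{1..n}. lat N k i + offset N s)
    = (real N - real n) * real n / 2 - of_int s * real n / real N + (real N - 1) * of_int (\<Sum>i\<in>{1..n}. k i)"
proof (induction n)
  case (Suc n)
  have "(\<Sum>i\<in>{1..Suc n}. lat N k i + offset N s)
      = (\<Sum>i\<in>{1..n}. lat N k i + offset N s) + (lat N k (Suc n) + offset N s)" by simp
  then show ?case unfolding Suc.IH
    by (simp add: lat_def rho_def offset_def add_divide_distrib diff_divide_distrib algebra_simps)
qed simp

lemma bij_betw_lat_vector:
  assumes N: "N \<ge> 2"
  shows "bij_betw (lat_vector N s) {k \<in> Lat N. lat_total N k \<in> slices s} (T_set N s)"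
  unfolding bij_betw_def
proof
  define n where "n = real N - 1"
  have n: "n > 0" using N by (simp add: n_def)
  have cond: "(real_of_int m + 1/2) * (real_of_int s + 1/2) \<ge> 0 \<longleftrightarrow> m \<in> slices s" for m
  proof -
    have 1: "real_of_int m + 1/2 \<ge> 0 \<longleftrightarrow> m \<ge> 0" "real_of_int m + 1/2 \<le> 0 \<longleftrightarrow> m < 0" for m
      by linarith+
    show ?thesis unfolding zero_le_mult_iff 1 by (auto simp: slices_def)
  qed
  show "inj_on (lat_vector N s) {k \<in> Lat N. lat_total N k \<in> slices s}"
  proof (rule inj_onI)
    fix k l assume k: "k \<in> {k \<in> Lat N. lat_total N k \<in> slices s}" and l: "l \<in> {k \<in> Lat N. lat_total N k \<in> slices s}"
      and eq: "lat_vector N s k = lat_vector N s l"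
    have ps: "(\<Sum>i\<in>{1..m}. k i) = (\<Sum>i\<in>{1..m}. l i)" if "m < N" for m
    proof (cases "m = 0")
      case False
      then have "lat_vector N s k m = lat_vector N s l m" using eq by simp
      then have "(real N - 1) * of_int (\<Sum>i\<in>{1..m}. k i) = (real N - 1) * of_int (\<Sum>i\<in>{1..m}. l i)"
        using False that by (simp only: lat_vector_def partial_sums_lat) simp
      then have "real_of_int (\<Sum>i\<in>{1..m}. k i) = of_int (\<Sum>i\<in>{1..m}. l i)" using N by simp
      then show ?thesis by (simp only: of_int_eq_iff)
    qed simp
    have "k i = l i" if i: "i \<in> {1..<N}" for i
    proof -
      obtain j where j: "i = Suc j" using i by (cases i) auto
      show ?thesis using ps[of i] ps[of j] i by (simp add: j)
    qed
    then show "k = l" using k l by (intro PiE_ext[of k "{1..<N}" "\<lambda>_. UNIV" l]) auto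
  qed
  have tot: "lat_total N k = (\<Sum>i\<in>{1..N - 1}. k i)" for k :: "nat \<Rightarrow> int"
    using N by (intro sum.cong) auto
  show "lat_vector N s ` {k \<in> Lat N. lat_total N k \<in> slices s} = T_set N s"
  proof (intro equalityI subsetI)
    fix t assume "t \<in> lat_vector N s ` {k \<in> Lat N. lat_total N k \<in> slices s}"
    then obtain k where k: "t = lat_vector N s k" "lat_total N k \<in> slices s" by blast
    show "t \<in> T_set N s"
      unfolding T_set_def cond using k
      by (intro CollectI exI[of _ "\<lambda>n. \<Sum>i\<in>{1..n}. k i"] conjI) (simp_all only: lat_vector_def partial_sums_lat tot)
  next
    fix t assume "t \<in> T_set N s"
    then obtain m where m: "t = (\<lambda>n. if n \<in> {1..<N}
           then (real N - real n) * real n / 2 - of_int s * real n / real N + (real N - 1) * of_int (m n) else 0)"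
      "m (N - 1) \<in> slices s" unfolding T_set_def cond by blast
    define k where "k = restrict (\<lambda>i. m i - (if i = 1 then 0 else m (i - 1))) {1..<N}"
    have ps: "(\<Sum>i\<in>{1..j}. k i) = m j" if "1 \<le> j" "j < N" for j
      using that
    proof (induction j rule: dec_induct)
      case (step j)
      then show ?case by (simp add: k_def)
    qed (simp add: k_def)
    have "t = lat_vector N s k"
    proof
      fix j show "t j = lat_vector N s k j"
        by (cases "j \<in> {1..<N}") (simp_all only: m(1) lat_vector_def partial_sums_lat ps atLeastLessThan_iff if_True if_False)
    qed
    moreover have "k \<in> Lat N" by (simp add: k_def)
    moreover have "lat_total N k \<in> slices s" unfolding tot using ps[of "N - 1"] m(2) N by simp
    ultimately show "t \<in> lat_vector N s ` {k \<in> Lat N. lat_total N k \<in> slices s}" by blast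
  qed
qed

lemma root_coord_lat_vector:
  assumes N: "N \<ge> 2"
  shows "i \<in> {1..<N} \<Longrightarrow> root_coord (lat_vector N s k) i = lat N k i + offset N s"
    and "root_coord (lat_vector N s k) N = - ((real N - 1) * (of_int (lat_total N k) + offset N s))"
proof -
  assume i: "i \<in> {1..<N}"
  then obtain j where j: "i = Suc j" by (cases i) auto
  show "root_coord (lat_vector N s k) i = lat N k i + offset N s"
    using i by (auto simp: root_coord_def lat_vector_def j)
next
  have "{1..N - 1} = {1..<N}" by auto
  then have "(\<Sum>i\<in>{1..N - 1}. lat N k i + offset N s) = (real N - 1) * (of_int (lat_total N k) + offset N s)"
    using sum_lat[of N k] N by (simp add: sum.distrib of_nat_diff algebra_simps)
  then show "root_coord (lat_vector N s k) N = - ((real N - 1) * (of_int (lat_total N k) + offset N s))"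
    using N by (simp add: root_coord_def lat_vector_def)
qed

lemma lat_vector_ends [simp]: "lat_vector N s k 0 = 0" "lat_vector N s k N = 0"
  by (simp_all add: lat_vector_def)

text \<open>Completing the square in the translation: besides \<open>weight\<close>, the quadratic form depends on the total only.\<close>

lemma qpow_bilin_lat_vector:
  assumes N: "N \<ge> 2"
  defines "\<kappa> \<equiv> \<lambda>k. real_of_int (lat_total N k)"
  shows "qpow \<tau> (bilin N (lat_vector N s k) (lat_vector N s k) / (2 * (real N - 1)))
    = weight \<tau> N k * qpow \<tau> (real N * (\<kappa> k + offset N s)\<^sup>2 / 2 - (\<kappa> k)\<^sup>2 / 2)"
proof -
  define n where "n = real N - 1"
  define b where "b = offset N s"
  define t where "t = lat_vector N s k"
  define Z where "Z = (\<Sum>i\<in>{1..<N}. (lat N k i)\<^sup>2)"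
  have n: "n > 0" "real N = n + 1" using N by (auto simp: n_def)
  have "{1..N} = insert N {1..<N}" using N by auto
  then have "bilin N t t = (root_coord t N)\<^sup>2 + (\<Sum>i\<in>{1..<N}. (root_coord t i)\<^sup>2)"
    using N by (subst bilin_root_coord) (simp_all add: t_def power2_eq_square)
  also have "(\<Sum>i\<in>{1..<N}. (root_coord t i)\<^sup>2) = (\<Sum>i\<in>{1..<N}. (lat N k i)\<^sup>2 + 2 * b * lat N k i + b\<^sup>2)"
    unfolding t_def by (intro sum.cong refl) (simp only: root_coord_lat_vector(1)[OF N], simp add: b_def power2_eq_square algebra_simps)
  also have "\<dots> = Z + 2 * b * (\<Sum>i\<in>{1..<N}. lat N k i) + n * b\<^sup>2"
    using N by (simp add: Z_def sum.distrib sum_distrib_left n_def of_nat_diff)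
  also have "(root_coord t N)\<^sup>2 = (n * (\<kappa> k + b))\<^sup>2"
    unfolding t_def root_coord_lat_vector(2)[OF N] by (simp add: n_def b_def \<kappa>_def)
  finally have "bilin N t t = (n * (\<kappa> k + b))\<^sup>2 + (Z + 2 * b * (n * \<kappa> k) + n * b\<^sup>2)"
    unfolding sum_lat by (simp add: n_def \<kappa>_def)
  then have "bilin N t t / (2 * n) = Z / (2 * n) + ((n + 1) * (\<kappa> k + b)\<^sup>2 / 2 - (\<kappa> k)\<^sup>2 / 2)"
    using n(1) by (simp add: field_simps power2_eq_square)
  then show ?thesis
    unfolding weight_def qpow_add[symmetric] t_def[symmetric] b_def[symmetric] Z_def[symmetric]
    by (simp add: n_def)
qed

text \<open>The last coordinate is determined by the total and plays the role of the extra variable \<open>x\<close> of the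
  lattice polynomial.\<close>

lemma prod_pos_roots_lat_vector:
  assumes N: "N \<ge> 2"
  shows "(\<Prod>\<alpha>\<in>pos_roots N. bilin N (lat_vector N s k) \<alpha>)
    = (-1) ^ (N - 1) * (vdm N (lat N k) *
        (\<Prod>i\<in>{1..<N}. (of_int s - real N / 2 - (real N - 1) * of_int (lat_total N k)) - lat N k i))"
proof -
  define b where "b = offset N s"
  define t where "t = lat_vector N s k"
  have "(\<Prod>\<alpha>\<in>pos_roots N. bilin N t \<alpha>) = vdm N (root_coord t) * (\<Prod>i\<in>{1..<N}. root_coord t i - root_coord t N)"
    using N by (subst prod_pos_roots) (simp_all add: t_def vdm_Suc)
  also have "vdm N (root_coord t) = vdm N (\<lambda>i. lat N k i - (- b))"
    by (rule vdm_cong) (simp add: t_def b_def root_coord_lat_vector(1)[OF N])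
  also have "\<dots> = vdm N (lat N k)" by (rule vdm_shift)
  also have "(\<Prod>i\<in>{1..<N}. root_coord t i - root_coord t N)
      = (\<Prod>i\<in>{1..<N}. (-1) * ((of_int s - real N / 2 - (real N - 1) * of_int (lat_total N k)) - lat N k i))"
  proof (rule prod.cong)
    fix i assume "i \<in> {1..<N}"
    note 1 = root_coord_lat_vector(1)[OF N this, of s k]
    show "root_coord t i - root_coord t N
        = (-1) * ((of_int s - real N / 2 - (real N - 1) * of_int (lat_total N k)) - lat N k i)"
      unfolding t_def 1 root_coord_lat_vector(2)[OF N] offset_def using N by (simp add: field_simps)
  qed simp
  also have "\<dots> = (-1) ^ (N - 1) * (\<Prod>i\<in>{1..<N}. (of_int s - real N / 2 - (real N - 1) * of_int (lat_total N k)) - lat N k i)"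
    by (subst prod.distrib) simp
  finally show ?thesis by (simp add: t_def mult_ac)
qed

section \<open>Convergence and termwise differentiation of the partial theta function\<close>

lemma abs_lat_vector_le:
  assumes N: "N \<ge> 2"
  shows "\<bar>lat_vector N s k n\<bar> \<le> real N * (real N + \<bar>offset N s\<bar>) + real N * real N * lat_size N k"
proof (cases "n \<in> {1..<N}")
  case True
  define M where "M = real N + \<bar>offset N s\<bar> + real N * lat_size N k"
  have M: "M \<ge> 0" unfolding M_def by (intro add_nonneg_nonneg mult_nonneg_nonneg sum_nonneg) auto
  have "\<bar>\<Sum>i\<in>{1..n}. lat N k i + offset N s\<bar> \<le> (\<Sum>i\<in>{1..n}. \<bar>lat N k i + offset N s\<bar>)"
    by (rule sum_abs)
  also have "\<dots> \<le> (\<Sum>i\<in>{1..n}. M)"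
  proof (rule sum_mono)
    fix i assume "i \<in> {1..n}"
    then have "i \<in> {1..<N}" using True by auto
    from abs_lat_le[OF N this, of k] show "\<bar>lat N k i + offset N s\<bar> \<le> M"
      unfolding M_def by linarith
  qed
  also have "\<dots> = real n * M" by simp
  also have "\<dots> \<le> real N * M" using True M by (intro mult_right_mono) auto
  finally show ?thesis using True by (simp add: lat_vector_def M_def algebra_simps)
next
  case False
  then have "lat_vector N s k n = 0" unfolding lat_vector_def by (simp only: if_False)
  then show ?thesis by (auto intro!: add_nonneg_nonneg mult_nonneg_nonneg sum_nonneg)
qed

text \<open>With \<open>x\<close> the total and \<open>b\<close> the offset, \<open>x\<^sup>2 \<le> 2 (x + b)\<^sup>2 + 2 b\<^sup>2\<close> and \<open>N \<ge> 2\<close> bound the additional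
  quadratic form from below, so the additional factor stays bounded.\<close>

lemma qpow_bilin_bounded:
  assumes \<tau>: "Im \<tau> > 0" and N: "N \<ge> 2"
  shows "exp_growth (Lat N) (lat_size N)
    (\<lambda>k. qpow \<tau> (real N * (of_int (lat_total N k) + offset N s)\<^sup>2 / 2 - (of_int (lat_total N k))\<^sup>2 / 2))"
proof (rule lat_scale.exp_growth_linear[of _ _ "exp (2 * pi * Im \<tau> * (real N * (offset N s)\<^sup>2))" 0])
  fix k :: "nat \<Rightarrow> int"
  define x where "x = real_of_int (lat_total N k)"
  define b where "b = offset N s"
  have "0 \<le> (x + 2 * b)\<^sup>2" by simp
  then have "x\<^sup>2 \<le> 2 * (x + b)\<^sup>2 + 2 * b\<^sup>2" by (simp add: power2_eq_square algebra_simps)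
  then have "real N * x\<^sup>2 \<le> real N * (2 * (x + b)\<^sup>2 + 2 * b\<^sup>2)" by (intro mult_left_mono) auto
  also have "\<dots> = 2 * (real N * (x + b)\<^sup>2) + 2 * (real N * b\<^sup>2)" by (simp add: distrib_left)
  finally have "real N * x\<^sup>2 \<le> \<dots>" .
  moreover have "2 * x\<^sup>2 \<le> real N * x\<^sup>2" using N by (intro mult_right_mono) auto
  moreover have "0 \<le> real N * b\<^sup>2" by simp
  ultimately have "- (real N * b\<^sup>2) \<le> real N * (x + b)\<^sup>2 / 2 - x\<^sup>2 / 2" by linarith
  from mult_left_mono[OF this, of "2 * pi * Im \<tau>"] \<tau>
  show "norm (qpow \<tau> (real N * (of_int (lat_total N k) + offset N s)\<^sup>2 / 2 - (of_int (lat_total N k))\<^sup>2 / 2))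
      \<le> exp (2 * pi * Im \<tau> * (real N * (offset N s)\<^sup>2)) + 0 * lat_size N k"
    unfolding norm_qpow x_def[symmetric] b_def[symmetric] by simp
qed

context
  fixes \<tau> :: complex and N :: nat and s :: int
  assumes \<tau>: "Im \<tau> > 0" and N: "N \<ge> 2"
begin

abbreviation "q_form t \<equiv> qpow \<tau> (bilin N t t / (2 * (real N - 1)))"
abbreviation "growth_ok f \<equiv> exp_growth (Lat N) (lat_size N) (\<lambda>k. f (lat_vector N s k))"

lemma T_set_summable_lattice:
  assumes "growth_ok f"
  shows "(\<lambda>k. f (lat_vector N s k) * q_form (lat_vector N s k)) summable_on Lat N"
proof -
  have "(\<lambda>k. weight \<tau> N k * (f (lat_vector N s k) *
      qpow \<tau> (real N * (of_int (lat_total N k) + offset N s)\<^sup>2 / 2 - (of_int (lat_total N k))\<^sup>2 / 2))) summable_on Lat N"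
    by (intro weighted_lattice_summable[OF \<tau> N] lat_scale.exp_growth_mult assms qpow_bilin_bounded[OF \<tau> N])
  then show ?thesis unfolding qpow_bilin_lat_vector[OF N] by (simp only: mult_ac)
qed

lemma T_set_summable:
  assumes "growth_ok f"
  shows "(\<lambda>t. f t * q_form t) summable_on T_set N s"
proof -
  have "(\<lambda>k. f (lat_vector N s k) * q_form (lat_vector N s k)) summable_on {k \<in> Lat N. lat_total N k \<in> slices s}"
    by (rule summable_on_subset_banach[OF T_set_summable_lattice[OF assms]]) blast
  then show ?thesis
    using summable_on_reindex_bij_betw[OF bij_betw_lat_vector[OF N], of "\<lambda>t. f t * q_form t" s] by blast
qed

lemma growth_bilin_bound:
  obtains a b where "\<And>k. \<bar>bilin N (lat_vector N s k) \<alpha>\<bar> \<le> a + b * lat_size N k"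
proof
  define A where "A = real N * (real N + \<bar>offset N s\<bar>)"
  define B where "B = real N * real N"
  define M where "M = (\<Sum>m\<in>{1..<N}. \<Sum>n\<in>{1..<N}. \<bar>cartan_sl m n * \<alpha> n\<bar>)"
  fix k :: "nat \<Rightarrow> int"
  define S where "S = (\<Sum>i\<in>{1..<N}. \<bar>real_of_int (k i)\<bar>)"
  have "\<bar>bilin N (lat_vector N s k) \<alpha>\<bar> \<le> (\<Sum>m\<in>{1..<N}. \<Sum>n\<in>{1..<N}. \<bar>lat_vector N s k m * cartan_sl m n * \<alpha> n\<bar>)"
    unfolding bilin_def by (intro order.trans[OF sum_abs] sum_mono sum_abs)
  also have "\<dots> \<le> (\<Sum>m\<in>{1..<N}. \<Sum>n\<in>{1..<N}. (A + B * S) * \<bar>cartan_sl m n * \<alpha> n\<bar>)"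
    unfolding abs_mult mult.assoc A_def B_def S_def
    by (intro sum_mono mult_right_mono abs_lat_vector_le[OF N, unfolded mult.assoc]) auto
  also have "\<dots> = (A + B * S) * M" by (simp only: M_def sum_distrib_left)
  also have "\<dots> = A * M + B * M * S" by (simp add: algebra_simps)
  finally show "\<bar>bilin N (lat_vector N s k) \<alpha>\<bar> \<le> A * M + B * M * lat_size N k"
    by (simp add: S_def)
qed

lemma growth_bilin: "growth_ok (\<lambda>t. of_real (bilin N t \<alpha>))"
proof -
  obtain a b where "\<And>k. \<bar>bilin N (lat_vector N s k) \<alpha>\<bar> \<le> a + b * lat_size N k"
    using growth_bilin_bound[of \<alpha>] by blast
  then show ?thesis by (intro lat_scale.exp_growth_linear[of _ _ a b]) simp
qed

lemma growth_exp_bilin: "growth_ok (\<lambda>t. exp (of_real \<bar>bilin N t \<alpha>\<bar>))"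
proof -
  obtain a b where "\<And>k. \<bar>bilin N (lat_vector N s k) \<alpha>\<bar> \<le> a + b * lat_size N k"
    using growth_bilin_bound[of \<alpha>] by blast
  then show ?thesis by (intro lat_scale.exp_growth_exp[of _ _ a b]) simp
qed

lemma growth_exp_form: "growth_ok (\<lambda>t. exp_form N t u)"
  unfolding exp_form_def
proof (rule lat_scale.exp_growth_exp)
  define A where "A = real N * (real N + \<bar>offset N s\<bar>)"
  define B where "B = real N * real N"
  define M where "M = (\<Sum>n\<in>{1..<N}. norm (u n))"
  fix k :: "nat \<Rightarrow> int"
  define S where "S = (\<Sum>i\<in>{1..<N}. \<bar>real_of_int (k i)\<bar>)"
  have "norm (lin_form N (lat_vector N s k) u) \<le> (\<Sum>n\<in>{1..<N}. norm (of_real (lat_vector N s k n) * u n))"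
    unfolding lin_form_def by (rule norm_sum)
  also have "\<dots> \<le> (\<Sum>n\<in>{1..<N}. (A + B * S) * norm (u n))"
    unfolding norm_mult norm_of_real A_def B_def S_def
    by (intro sum_mono mult_right_mono abs_lat_vector_le[OF N]) auto
  also have "\<dots> = (A + B * S) * M" by (simp only: M_def sum_distrib_left)
  also have "\<dots> = A * M + B * M * S" by (simp add: algebra_simps)
  finally show "norm (lin_form N (lat_vector N s k) u) \<le> A * M + B * M * lat_size N k"
    by (simp add: S_def)
qed

lemma exp_form_root_shift:
  "exp_form N t (\<lambda>n. u n + w * of_real (bilin N (simple_root n) \<alpha>)) = exp_form N t u * exp (of_real (bilin N t \<alpha>) * w)"
proof -
  have simple: "bilin N (simple_root m) \<alpha> = (\<Sum>n\<in>{1..<N}. cartan_sl m n * \<alpha> n)" if "m \<in> {1..<N}" for m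
  proof -
    have "bilin N (simple_root m) \<alpha> = (\<Sum>k\<in>{1..<N}. if k = m then (\<Sum>n\<in>{1..<N}. cartan_sl k n * \<alpha> n) else 0)"
      unfolding bilin_def root_sum_def by (intro sum.cong refl) auto
    then show ?thesis using that by (simp add: sum.delta)
  qed
  have "bilin N t \<alpha> = (\<Sum>m\<in>{1..<N}. t m * bilin N (simple_root m) \<alpha>)"
    unfolding bilin_def[of N t] by (intro sum.cong refl) (simp add: simple sum_distrib_left mult.assoc)
  then have "lin_form N t (\<lambda>n. u n + w * of_real (bilin N (simple_root n) \<alpha>)) = lin_form N t u + of_real (bilin N t \<alpha>) * w"
    unfolding lin_form_def by (simp add: algebra_simps sum.distrib sum_distrib_left)
  then show ?thesis by (simp add: exp_form_def exp_add)
qed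

text \<open>Along the direction belonging to \<open>\<alpha>\<close> each term is an exponential function of one variable, and
  \<open>DERIV_infsum_exp\<close> applies to the whole family.\<close>

lemma root_derivs_partial_theta:
  "foldr (root_deriv N) L (partial_theta N s \<tau>)
    = (\<lambda>u. \<Sum>\<^sub>\<infinity>t\<in>T_set N s. of_real (\<Prod>\<alpha>\<leftarrow>L. bilin N t \<alpha>) * exp_form N t u * q_form t)"
proof (induction L)
  case Nil
  show ?case by (rule ext) (simp add: partial_theta_def)
next
  case (Cons \<alpha> L)
  have gL: "growth_ok (\<lambda>t. of_real (\<Prod>\<alpha>\<leftarrow>L. bilin N t \<alpha>))" for L
  proof (induction L)
    case Nil
    show ?case unfolding list.map prod_list.Nil by (rule lat_scale.exp_growth_const)
  next
    case (Cons \<alpha> L)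
    then show ?case
      unfolding list.map prod_list.Cons of_real_mult by (intro lat_scale.exp_growth_mult growth_bilin)
  qed
  show ?case
  proof
    fix u
    define cf where "cf = (\<lambda>t. of_real (\<Prod>\<alpha>\<leftarrow>L. bilin N t \<alpha>) * exp_form N t u * q_form t)"
    have "((\<lambda>w. \<Sum>\<^sub>\<infinity>t\<in>T_set N s. cf t * exp (of_real (bilin N t \<alpha>) * w)) has_field_derivative
        (\<Sum>\<^sub>\<infinity>t\<in>T_set N s. cf t * of_real (bilin N t \<alpha>))) (at 0)"
    proof (rule DERIV_infsum_exp[of 1])
      have "growth_ok (\<lambda>t. of_real (\<Prod>\<alpha>\<leftarrow>L. bilin N t \<alpha>) * exp_form N t u * exp (of_real \<bar>bilin N t \<alpha>\<bar>))"
        by (intro lat_scale.exp_growth_mult gL growth_exp_form growth_exp_bilin)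
      from summable_on_normD[OF T_set_summable[OF this]]
      show "(\<lambda>t. norm (cf t) * exp (1 * norm (complex_of_real (bilin N t \<alpha>)))) summable_on T_set N s"
        by (simp add: cf_def norm_mult mult_ac)
    qed simp
    moreover have "foldr (root_deriv N) L (partial_theta N s \<tau>) (\<lambda>n. u n + w * of_real (bilin N (simple_root n) \<alpha>))
        = (\<Sum>\<^sub>\<infinity>t\<in>T_set N s. cf t * exp (of_real (bilin N t \<alpha>) * w))" for w
      unfolding Cons.IH exp_form_root_shift by (intro infsum_cong) (simp add: cf_def mult_ac)
    ultimately have "root_deriv N \<alpha> (foldr (root_deriv N) L (partial_theta N s \<tau>)) u
        = (\<Sum>\<^sub>\<infinity>t\<in>T_set N s. cf t * of_real (bilin N t \<alpha>))"
      unfolding root_deriv_def by (simp add: DERIV_imp_deriv)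
    also have "\<dots> = (\<Sum>\<^sub>\<infinity>t\<in>T_set N s. of_real (\<Prod>\<alpha>\<leftarrow>\<alpha> # L. bilin N t \<alpha>) * exp_form N t u * q_form t)"
      by (intro infsum_cong) (simp add: cf_def mult_ac)
    finally show "foldr (root_deriv N) (\<alpha> # L) (partial_theta N s \<tau>) u
        = (\<Sum>\<^sub>\<infinity>t\<in>T_set N s. of_real (\<Prod>\<alpha>\<leftarrow>\<alpha> # L. bilin N t \<alpha>) * exp_form N t u * q_form t)" by simp
  qed
qed

lemma prod_pos_root_list: "(\<Prod>\<alpha>\<leftarrow>pos_root_list N. bilin N t \<alpha>) = (\<Prod>\<alpha>\<in>pos_roots N. bilin N t \<alpha>)"
  unfolding set_pos_root_list[symmetric] by (rule prod.distinct_set_conv_list[OF distinct_pos_root_list, symmetric])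

lemma root_diff_op_partial_theta_at_one:
  "all_exp_one (root_diff_op N (partial_theta N s \<tau>))
    = (\<Sum>\<^sub>\<infinity>t\<in>T_set N s. of_real (\<Prod>\<alpha>\<in>pos_roots N. bilin N t \<alpha>) * q_form t)"
  unfolding all_exp_one_def root_diff_op_def root_derivs_partial_theta prod_pos_root_list
  by (simp add: exp_form_def lin_form_def)

lemma growth_prod_pos_roots: "growth_ok (\<lambda>t. of_real (\<Prod>\<alpha>\<in>pos_roots N. bilin N t \<alpha>))"
  unfolding of_real_prod by (intro lat_scale.exp_growth_prod growth_bilin)

end

section \<open>The Fourier coefficients\<close>

lemma zpow_half_shift: "zpow z (real N / 2 + of_int k) = zpow z (real N / 2) * zpow z 1 powi k"
  by (simp add: zpow_def exp_power_int ring_distribs mult_ac flip: exp_add)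

lemma phi_eq:
  assumes \<tau>: "Im \<tau> > 0"
  shows "phi N z \<tau> = zpow z (real N / 2) * (\<i> ^ N * qpow \<tau> (- (real N / 8)) / qpoch_inf \<tau> (nome \<tau>) ^ N
      / (qpoch_inf \<tau> (zpow z 1) * qpoch_inf \<tau> (nome \<tau> / zpow z 1)) ^ N)"
proof -
  have z1: "zpow z (-1) * nome \<tau> = nome \<tau> / zpow z 1"
    by (simp add: zpow_def exp_minus divide_inverse)
  have zh: "zpow z (real N / 2) = 1 / zpow z (-1/2) ^ N"
  proof -
    have "zpow z (-1/2) ^ N = exp (of_nat N * (2 * of_real pi * \<i> * of_real (-1/2) * z))"
      unfolding zpow_def by (rule exp_of_nat_mult[symmetric])
    also have "of_nat N * (2 * of_real pi * \<i> * of_real (-1/2) * z) = - (2 * of_real pi * \<i> * of_real (real N / 2) * z)"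
      by simp
    finally have e: "zpow z (-1/2) ^ N = exp (- (2 * of_real pi * \<i> * of_real (real N / 2) * z))" .
    show ?thesis
      unfolding e unfolding zpow_def by (simp only: exp_minus divide_inverse inverse_inverse_eq mult_1_left)
  qed
  have qh: "qpow \<tau> (- (real N / 8)) = 1 / qpow \<tau> (1/8) ^ N"
    unfolding qpow_power qpow_minus by (simp add: inverse_eq_divide)
  have ih: "\<i> ^ N = 1 / (- \<i>) ^ N"
  proof -
    have "\<i> ^ N * (- \<i>) ^ N = 1" by (simp flip: power_mult_distrib)
    then show ?thesis by (simp add: field_simps)
  qed
  have alg: "inverse ((I * A * B * P * X * Y) ^ N) = 1 / A ^ N * (1 / I ^ N * (1 / B ^ N) / P ^ N / (X * Y) ^ N)"
    for I A B P X Y :: complex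
    by (simp add: power_mult_distrib divide_inverse)
  show ?thesis
    unfolding phi_def jacobi_theta_def power_int_minus power_int_of_nat z1 zh qh ih by (rule alg)
qed

lemma half_shifted_bij: "bij_betw (\<lambda>k. real N / 2 + of_int k) UNIV (half_shifted_ints N)"
  unfolding half_shifted_ints_def by (auto simp: bij_betw_def inj_on_def)

context theta_power_expansion
begin

definition "phi_factor = \<i> ^ N * qpow \<tau> (- (real N / 8)) / qpoch_inf \<tau> (nome \<tau>) ^ N"

lemma fourier_iff_laurent:
  assumes z: "norm (nome \<tau>) < norm (zpow z 1)" "norm (zpow z 1) < 1"
  shows "((\<lambda>r. d r * zpow z r) has_sum phi N z \<tau>) (half_shifted_ints N) \<longleftrightarrow>
    ((\<lambda>k. d (real N / 2 + of_int k) * zpow z 1 powi k) has_sum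
       phi_factor / (qpoch_inf \<tau> (zpow z 1) * qpoch_inf \<tau> (nome \<tau> / zpow z 1)) ^ N) UNIV"
proof -
  have z0: "zpow z (real N / 2) \<noteq> 0" by (simp add: zpow_def)
  have "((\<lambda>r. d r * zpow z r) has_sum phi N z \<tau>) (half_shifted_ints N) \<longleftrightarrow>
      ((\<lambda>k. d (real N / 2 + of_int k) * zpow z (real N / 2 + of_int k)) has_sum phi N z \<tau>) UNIV"
    by (rule has_sum_reindex_bij_betw[OF half_shifted_bij, symmetric])
  also have "\<dots> \<longleftrightarrow> ((\<lambda>k. zpow z (real N / 2) * (d (real N / 2 + of_int k) * zpow z 1 powi k)) has_sum
      zpow z (real N / 2) * (phi_factor / (qpoch_inf \<tau> (zpow z 1) * qpoch_inf \<tau> (nome \<tau> / zpow z 1)) ^ N)) UNIV"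
    unfolding zpow_half_shift phi_eq[OF \<tau>] phi_factor_def by (simp only: mult_ac)
  also have "\<dots> \<longleftrightarrow> ((\<lambda>k. d (real N / 2 + of_int k) * zpow z 1 powi k) has_sum
       phi_factor / (qpoch_inf \<tau> (zpow z 1) * qpoch_inf \<tau> (nome \<tau> / zpow z 1)) ^ N) UNIV"
    by (subst has_sum_cmult_right_iff[OF z0]) (simp add: z0)
  finally show ?thesis .
qed

text \<open>Both existence and uniqueness in the definition of \<open>chi\<close> are those of a Laurent expansion in
  \<open>\<zeta> = zpow z 1\<close>, after the factor \<open>zpow z (N/2)\<close> is removed.\<close>

lemma chi_eq_coefficient: "chi N (real N / 2 + of_int s) \<tau> = phi_factor * c s"
proof -
  define d where "d = (\<lambda>r. if r \<in> half_shifted_ints N then phi_factor * c \<lfloor>r - real N / 2\<rfloor> else 0)"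
  have mem: "real N / 2 + of_int k \<in> half_shifted_ints N" for k by (auto simp: half_shifted_ints_def)
  have dk: "d (real N / 2 + of_int k) = phi_factor * c k" for k by (simp add: d_def mem)
  have four: "is_fourier_expansion N \<tau> d"
    unfolding is_fourier_expansion_def
  proof (intro allI impI, elim conjE)
    fix z assume z: "norm (nome \<tau>) < norm (zpow z 1)" "norm (zpow z 1) < 1"
    show "((\<lambda>r. d r * zpow z r) has_sum phi N z \<tau>) (half_shifted_ints N)"
      unfolding fourier_iff_laurent[OF z] dk using has_sum_cmult_right[OF c[OF z], of phi_factor]
      by (simp add: mult.assoc)
  qed
  obtain \<rho> where \<rho>: "norm (nome \<tau>) < \<rho>" "\<rho> < 1" using dense nome_bounds(2)[OF \<tau>] by blast
  have \<rho>0: "\<rho> > 0" using nome_bounds(3)[OF \<tau>] \<rho>(1) by (rule less_trans)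
  have unique: "d' = d" if d': "is_fourier_expansion N \<tau> d'" "\<forall>r. r \<notin> half_shifted_ints N \<longrightarrow> d' r = 0" for d'
  proof -
    have "(\<lambda>k. d' (real N / 2 + of_int k)) = (\<lambda>k. d (real N / 2 + of_int k))"
    proof (rule laurent_unique[OF \<rho>0])
      fix \<zeta> :: complex assume nz: "norm \<zeta> = \<rho>"
      define z where "z = Ln \<zeta> / (2 * of_real pi * \<i>)"
      have zz: "zpow z 1 = \<zeta>" using nz \<rho>0 by (auto simp: zpow_def z_def exp_Ln)
      then have z: "norm (nome \<tau>) < norm (zpow z 1)" "norm (zpow z 1) < 1" using nz \<rho> by auto
      show "((\<lambda>k. d' (real N / 2 + of_int k) * \<zeta> powi k) has_sum
          phi_factor / (qpoch_inf \<tau> \<zeta> * qpoch_inf \<tau> (nome \<tau> / \<zeta>)) ^ N) UNIV"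
        using d'(1) z fourier_iff_laurent[OF z, of d'] by (simp add: is_fourier_expansion_def zz)
      show "((\<lambda>k. d (real N / 2 + of_int k) * \<zeta> powi k) has_sum
          phi_factor / (qpoch_inf \<tau> \<zeta> * qpoch_inf \<tau> (nome \<tau> / \<zeta>)) ^ N) UNIV"
        using four z fourier_iff_laurent[OF z, of d] by (simp add: is_fourier_expansion_def zz)
    qed
    then have eq: "d' (real N / 2 + of_int k) = d (real N / 2 + of_int k)" for k by (rule fun_cong)
    show ?thesis
    proof
      fix r show "d' r = d r"
      proof (cases "r \<in> half_shifted_ints N")
        case True
        then show ?thesis using eq by (auto simp: half_shifted_ints_def)
      next
        case False
        then show ?thesis using d'(2) by (simp add: d_def)
      qed
    qed
  qed
  have "(THE d. is_fourier_expansion N \<tau> d \<and> (\<forall>r. r \<notin> half_shifted_ints N \<longrightarrow> d r = 0)) = d"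
  proof (rule the_equality)
    show "is_fourier_expansion N \<tau> d \<and> (\<forall>r. r \<notin> half_shifted_ints N \<longrightarrow> d r = 0)"
      using four by (simp add: d_def)
  next
    fix d' assume "is_fourier_expansion N \<tau> d' \<and> (\<forall>r. r \<notin> half_shifted_ints N \<longrightarrow> d' r = 0)"
    then show "d' = d" by (intro unique) (elim conjE, assumption)+
  qed
  then show ?thesis by (simp add: chi_def dk)
qed

text \<open>The shift to the slice \<open>\<kappa> = 0\<close> and the proportionality turn the slice into one value of the residue
  polynomial; the quadratic exponents combine to \<open>x\<^sup>2 / (2 N)\<close>.\<close>

lemma slice_contribution:
  fixes \<kappa> s :: int
  defines "x \<equiv> of_int s - real N / 2 - real N * of_int \<kappa>"
  shows "(\<Sum>\<^sub>\<infinity>k\<in>Lat_slice N \<kappa>. of_real (\<Prod>\<alpha>\<in>pos_roots N. bilin N (lat_vector N s k) \<alpha>)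
        * qpow \<tau> (bilin N (lat_vector N s k) (lat_vector N s k) / (2 * (real N - 1))))
    = (-1) ^ (N - 1) * slice_sum \<tau> N (\<lambda>_. 1) 0 * fact (N - 1) / (\<Sum>\<^sub>\<infinity>k. h k)
        * (((-1) ^ N) powi \<kappa> * qpow \<tau> (x\<^sup>2 / (2 * real N)) * poly R (of_real x))"
proof -
  define Y where "Y = of_int s - real N / 2 - (real N - 1) * of_int \<kappa>"
  define Q where "Q = qpow \<tau> (real N * (of_int \<kappa> + offset N s)\<^sup>2 / 2 - (of_int \<kappa>)\<^sup>2 / 2)"
  have "(\<Sum>\<^sub>\<infinity>k\<in>Lat_slice N \<kappa>. of_real (\<Prod>\<alpha>\<in>pos_roots N. bilin N (lat_vector N s k) \<alpha>)
        * qpow \<tau> (bilin N (lat_vector N s k) (lat_vector N s k) / (2 * (real N - 1))))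
    = (\<Sum>\<^sub>\<infinity>k\<in>Lat_slice N \<kappa>. ((-1) ^ (N - 1) * Q) *
        (weight \<tau> N k * (of_real (vdm N (lat N k)) * (\<Prod>i\<in>{1..<N}. of_real Y - of_real (lat N k i)))))"
  proof (rule infsum_cong)
    fix k assume "k \<in> Lat_slice N \<kappa>"
    then have tot: "lat_total N k = \<kappa>" by (simp add: Lat_slice_def)
    show "of_real (\<Prod>\<alpha>\<in>pos_roots N. bilin N (lat_vector N s k) \<alpha>)
        * qpow \<tau> (bilin N (lat_vector N s k) (lat_vector N s k) / (2 * (real N - 1)))
      = ((-1) ^ (N - 1) * Q) * (weight \<tau> N k * (of_real (vdm N (lat N k)) * (\<Prod>i\<in>{1..<N}. of_real Y - of_real (lat N k i))))"
      unfolding prod_pos_roots_lat_vector[OF N] qpow_bilin_lat_vector[OF N] tot Q_def Y_def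
      by (simp add: mult_ac)
  qed
  also have "\<dots> = (-1) ^ (N - 1) * Q * slice_sum \<tau> N (\<lambda>t. of_real Y - of_real t) \<kappa>"
    unfolding slice_sum_def by (rule infsum_cmult_right')
  also have "slice_sum \<tau> N (\<lambda>t. of_real Y - of_real t) \<kappa> = theta_weight \<tau> N \<kappa> * poly (slice_poly \<tau> N) (of_real x)"
  proof -
    have e: "complex_of_real Y - of_real (t + of_int \<kappa>) = of_real x - of_real t" for t
      by (simp add: Y_def x_def algebra_simps)
    show ?thesis unfolding poly_slice_poly[OF \<tau> N] by (subst slice_sum_shift[OF N]) (simp only: e)
  qed
  also have "poly (slice_poly \<tau> N) (of_real x) = slice_sum \<tau> N (\<lambda>_. 1) 0 * fact (N - 1) / (\<Sum>\<^sub>\<infinity>k. h k) * poly R (of_real x)"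
    using arg_cong[OF slice_proportional, of "\<lambda>p. poly p (of_real x)"] sum_h_nonzero by (simp add: field_simps)
  finally have "(\<Sum>\<^sub>\<infinity>k\<in>Lat_slice N \<kappa>. of_real (\<Prod>\<alpha>\<in>pos_roots N. bilin N (lat_vector N s k) \<alpha>)
        * qpow \<tau> (bilin N (lat_vector N s k) (lat_vector N s k) / (2 * (real N - 1))))
    = (-1) ^ (N - 1) * Q * (theta_weight \<tau> N \<kappa> * (slice_sum \<tau> N (\<lambda>_. 1) 0 * fact (N - 1) / (\<Sum>\<^sub>\<infinity>k. h k) * poly R (of_real x)))" .
  moreover have "Q * theta_weight \<tau> N \<kappa> = ((-1) ^ N) powi \<kappa> * qpow \<tau> (x\<^sup>2 / (2 * real N))"
  proof -
    have "real N * (of_int \<kappa> + offset N s) = - x" using N by (simp add: offset_def x_def field_simps)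
    then have "x\<^sup>2 / (2 * real N) = (real N * (of_int \<kappa> + offset N s))\<^sup>2 / (2 * real N)" by simp
    also have "\<dots> = real N * (of_int \<kappa> + offset N s)\<^sup>2 / 2" using N by (simp add: power2_eq_square)
    also have "\<dots> = (real N * (of_int \<kappa> + offset N s)\<^sup>2 / 2 - (of_int \<kappa>)\<^sup>2 / 2) + (of_int \<kappa>)\<^sup>2 / 2" by simp
    finally show ?thesis unfolding Q_def theta_weight_def by (simp only: qpow_add mult_ac)
  qed
  ultimately show ?thesis by (simp add: mult_ac)
qed

text \<open>The slice \<open>\<kappa>\<close> contributes the term \<open>j = - \<kappa> - 1\<close> of the theta sum. For \<open>s < 0\<close> these are the
  \<open>j \<ge> 0\<close>, whose sum is the coefficient; for \<open>s \<ge> 0\<close> they are the \<open>j < 0\<close>, whose sum is its negative.\<close>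

lemma lattice_sum_eq_coefficient:
  "(\<Sum>\<^sub>\<infinity>t\<in>T_set N s. of_real (\<Prod>\<alpha>\<in>pos_roots N. bilin N t \<alpha>) * qpow \<tau> (bilin N t t / (2 * (real N - 1))))
    = of_real (sign_ge0 (of_int s)) * (slice_sum \<tau> N (\<lambda>_. 1) 0 * fact (N - 1) / (\<Sum>\<^sub>\<infinity>k. h k))
      * (qpow \<tau> ((of_int s + real N / 2)\<^sup>2 / (2 * real N)) * c s)"
proof -
  define F where "F = (\<lambda>k. complex_of_real (\<Prod>\<alpha>\<in>pos_roots N. bilin N (lat_vector N s k) \<alpha>)
        * qpow \<tau> (bilin N (lat_vector N s k) (lat_vector N s k) / (2 * (real N - 1))))"
  define K where "K = slice_sum \<tau> N (\<lambda>_. 1) 0 * fact (N - 1) / (\<Sum>\<^sub>\<infinity>k. h k)"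
  define C where "C = qpow \<tau> ((of_int s + real N / 2)\<^sup>2 / (2 * real N)) * c s"
  define f where "f = (\<lambda>j::int. ((-1) ^ N) powi j * qpow \<tau> ((of_int s + real N / 2 + real N * of_int j)\<^sup>2 / (2 * real N))
      * poly R (of_real (of_int s + real N / 2 + real N * of_int j)))"
  note theta = coefficient_as_theta_sum[of s, folded f_def]
  have slice: "infsum F (Lat_slice N \<kappa>) = - K * f (- \<kappa> - 1)" for \<kappa>
  proof -
    have x: "of_int s - real N / 2 - real N * of_int \<kappa> = of_int s + real N / 2 + real N * of_int (- \<kappa> - 1)"
      by (simp add: algebra_simps)
    have sgn: "(-1) ^ (N - 1) * ((-1) ^ N) powi \<kappa> = - (((-1) ^ N) powi (- \<kappa> - 1) :: complex)"
    proof -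
      have "(-1) ^ N = - ((-1) ^ (N - 1) :: complex)" using N by (cases N) auto
      then show ?thesis by (cases "even (N - 1)"; cases "even \<kappa>") (simp_all add: power_int_minus_left)
    qed
    define A where "A = qpow \<tau> ((of_int s + real N / 2 + real N * of_int (- \<kappa> - 1))\<^sup>2 / (2 * real N))
        * poly R (of_real (of_int s + real N / 2 + real N * of_int (- \<kappa> - 1)))"
    have "infsum F (Lat_slice N \<kappa>) = (-1) ^ (N - 1) * slice_sum \<tau> N (\<lambda>_. 1) 0 * fact (N - 1) / (\<Sum>\<^sub>\<infinity>k. h k)
        * (((-1) ^ N) powi \<kappa> * A)"
      unfolding F_def slice_contribution x A_def by (simp only: mult.assoc)
    also have "\<dots> = ((-1) ^ (N - 1) * ((-1) ^ N) powi \<kappa>) * (K * A)" by (simp add: K_def)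
    also have "\<dots> = - K * (((-1) ^ N) powi (- \<kappa> - 1) * A)" unfolding sgn by simp
    also have "\<dots> = - K * f (- \<kappa> - 1)" unfolding f_def A_def by (simp only: mult.assoc)
    finally show ?thesis .
  qed
  have Fsum: "F summable_on Lat N"
    unfolding F_def by (rule T_set_summable_lattice[OF \<tau> N growth_prod_pos_roots[OF \<tau> N]])
  have "(\<Sum>\<^sub>\<infinity>t\<in>T_set N s. of_real (\<Prod>\<alpha>\<in>pos_roots N. bilin N t \<alpha>) * qpow \<tau> (bilin N t t / (2 * (real N - 1))))
      = infsum F {k \<in> Lat N. lat_total N k \<in> slices s}"
    unfolding F_def by (rule infsum_reindex_bij_betw[OF bij_betw_lat_vector[OF N], symmetric])
  moreover have "((\<lambda>\<kappa>. infsum F (Lat_slice N \<kappa>)) has_sum infsum F {k \<in> Lat N. lat_total N k \<in> slices s}) (slices s)"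
    by (rule has_sum_slices, rule summable_on_subset_banach[OF Fsum]) blast
  moreover have "((\<lambda>\<kappa>. - K * f (- \<kappa> - 1)) has_sum - K * (- of_real (sign_ge0 (of_int s)) * C)) (slices s)"
  proof (rule has_sum_cmult_right)
    show "((\<lambda>\<kappa>. f (- \<kappa> - 1)) has_sum (- of_real (sign_ge0 (of_int s)) * C)) (slices s)"
    proof (cases "s \<ge> 0")
      case True
      have "(f has_sum 0 - C) (UNIV - {0..})"
        using theta by (intro has_sum_Diff) (auto simp: C_def)
      then have "((\<lambda>\<kappa>. f (- \<kappa> - 1)) has_sum 0 - C) {0..}"
        by (rule has_sum_reindex_bij_witness[of _ "\<lambda>j. - j - 1" "\<lambda>j. - j - 1", THEN iffD1, rotated -1]) auto
      then show ?thesis using True by (simp add: slices_def sign_ge0_def)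
    next
      case False
      have "(f has_sum C) {0..}" using theta by (simp add: C_def)
      then have "((\<lambda>\<kappa>. f (- \<kappa> - 1)) has_sum C) {..<0}"
        by (rule has_sum_reindex_bij_witness[of _ "\<lambda>j. - j - 1" "\<lambda>j. - j - 1", THEN iffD1, rotated -1]) auto
      then show ?thesis using False by (simp add: slices_def sign_ge0_def)
    qed
  qed
  ultimately show ?thesis unfolding slice K_def[symmetric] C_def[symmetric]
    using has_sum_unique by (simp add: mult_ac) blast
qed

lemma chi_eq_lattice_sum:
  assumes r: "of_int s = r - real N / 2"
  shows "chi N r \<tau> = chi_prefactor N r \<tau> *
    (\<Sum>\<^sub>\<infinity>t\<in>T_set N s. of_real (\<Prod>\<alpha>\<in>pos_roots N. bilin N t \<alpha>) * qpow \<tau> (bilin N t t / (2 * (real N - 1))))"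
proof -
  define P where "P = qpoch_inf \<tau> (nome \<tau>)"
  define \<eta> where "\<eta> = dedekind_eta \<tau>"
  define \<sigma> where "\<sigma> = complex_of_real (sign_ge0 (of_int s))"
  define q where "q = qpow \<tau> (r\<^sup>2 / (2 * real N))"
  have P: "P \<noteq> 0" unfolding P_def by (rule qpoch_inf_neq_0[OF \<tau> nome_bounds(2)[OF \<tau>]])
  have \<eta>0: "\<eta> \<noteq> 0" using P by (simp add: \<eta>_def dedekind_eta_def P_def)
  have q0: "q \<noteq> 0" by (simp add: q_def)
  have \<sigma>: "\<sigma> * \<sigma> = 1" by (simp add: \<sigma>_def sign_ge0_def)
  have rs: "r = of_int s + real N / 2" using r by simp
  obtain n where n: "N = Suc (Suc n)" using N by (metis add_2_eq_Suc le_Suc_ex)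
  have sf: "superfact (N - 1) = superfact (N - 2) * fact (N - 1)" by (simp add: n superfact_def)
  have sf0: "of_nat (superfact (N - 2)) \<noteq> (0::complex)" by (simp add: superfact_def)
  have expo: "N * (N + 1) = N * (N - 2) + 3 * N" by (simp add: n algebra_simps)
  have \<eta>3: "\<eta> ^ (3 * N) = qpow \<tau> (real N / 8) * P ^ N * P ^ (2 * N)"
  proof -
    have "P ^ (3 * N) = P ^ N * P ^ (2 * N)" by (simp flip: power_add)
    then show ?thesis by (simp add: \<eta>_def dedekind_eta_def P_def power_mult_distrib qpow_power)
  qed
  have "chi_prefactor N r \<tau> *
      (\<Sum>\<^sub>\<infinity>t\<in>T_set N s. of_real (\<Prod>\<alpha>\<in>pos_roots N. bilin N t \<alpha>) * qpow \<tau> (bilin N t t / (2 * (real N - 1))))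
    = (\<i> ^ N * \<sigma> * inverse q / (\<eta> ^ (N * (N + 1)) * of_nat (superfact (N - 2) * fact (N - 1))))
       * (\<sigma> * (of_nat (superfact (N - 2)) * \<eta> ^ (N * (N - 2)) * fact (N - 1) / (1 / P ^ (2 * N))) * (q * c s))"
    unfolding lattice_sum_eq_coefficient chi_prefactor_def slice_sum_eq_eta_power[OF \<tau> N] sum_h sf r[symmetric] qpow_minus
    by (simp only: \<sigma>_def q_def \<eta>_def P_def rs)
  also have "\<dots> = (\<sigma> * \<sigma>) * (\<i> ^ N * P ^ (2 * N) / \<eta> ^ (3 * N) * c s)"
    using q0 \<eta>0 P sf0 unfolding expo power_add by (simp add: mult_ac)
  also have "\<dots> = \<i> ^ N / (qpow \<tau> (real N / 8) * P ^ N) * c s"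
    unfolding \<sigma> \<eta>3 using P by simp
  also have "\<dots> = phi_factor * c s"
    by (simp add: phi_factor_def qpow_minus P_def inverse_eq_divide)
  also have "\<dots> = chi N r \<tau>"
    using chi_eq_coefficient[of s] by (simp add: rs add.commute)
  finally show ?thesis ..
qed

end

theorem theorem1p2:
  fixes N :: nat and \<tau> :: complex and r :: real and s :: int
  assumes "N \<ge> 2" and "Im \<tau> > 0"
    and "r \<in> half_shifted_ints N" and "of_int s = r - real N / 2"
  shows "(\<forall>u. (\<lambda>t. exp_form N t u * qpow \<tau> (bilin N t t / (2 * (real N - 1))))
              summable_on T_set N s) \<and>
    (\<lambda>t. of_real (\<Prod>\<alpha>\<in>pos_roots N. bilin N t \<alpha>) * qpow \<tau> (bilin N t t / (2 * (real N - 1))))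
              summable_on T_set N s \<and>
    chi N r \<tau> = chi_prefactor N r \<tau> *
      (\<Sum>\<^sub>\<infinity>t\<in>T_set N s. of_real (\<Prod>\<alpha>\<in>pos_roots N. bilin N t \<alpha>)
                              * qpow \<tau> (bilin N t t / (2 * (real N - 1)))) \<and>
    chi N r \<tau> = chi_prefactor N r \<tau> *
      all_exp_one (root_diff_op N (partial_theta N s \<tau>))"
proof -
  note N = assms(1) and \<tau> = assms(2)
  obtain h c where "theta_power_expansion \<tau> N h c" using theta_power_expansion_exists[OF \<tau> N] .
  then interpret theta_power_expansion \<tau> N h c .
  show ?thesis
    unfolding root_diff_op_partial_theta_at_one[OF \<tau> N]
    using chi_eq_lattice_sum[OF assms(4)] T_set_summable[OF \<tau> N growth_exp_form[OF \<tau> N]]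
      T_set_summable[OF \<tau> N growth_prod_pos_roots[OF \<tau> N]] by blast
qed

end
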